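(* Let $n\in\mathbb{N}$, $P_n(\theta)=1-\cos n\theta$, $\alpha\in\ell^6$ and $(S-1)\alpha\in\ell^3$. Then $$\int_0^{2\pi}(1-\cos n\theta)\log w(\theta)\frac{d\theta}{2\pi}>-\infty\iff\alpha\in\ell^4\ \text{ and }\ (S^n-1)\alpha\in\ell^2.$$
   Context: $\mu$ is a probability measure with infinite support on the unit circle (identified with $[0,2\pi]$ via $e^{i\theta}\mapsto\theta$), with Lebesgue decomposition $d\mu(\theta)=w(\theta)\frac{d\theta}{2\pi}+d\mu_s(\theta)$. $\Phi_k$ are its monic orthogonal polynomials, and its sequence of Verblunsky coefficients is $\alpha=(\alpha_k)_{k\ge0}$, $\alpha_k=-\overline{\Phi_{k+1}(0)}\in\mathbb{D}$. $S$ is the left shift on sequences, $(S\alpha)_k=\alpha_{k+1}$. The integral is well defined in $[-\infty,\infty)$. *)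

theory Defs
  imports "HOL-Probability.Probability" "HOL-Computational_Algebra.Polynomial"
begin

subsection \<open>Measures on the unit circle\<close>

definition measure_support :: "'a::topological_space measure \<Rightarrow> 'a set" where
  "measure_support M = {x. \<forall>U. open U \<longrightarrow> x \<in> U \<longrightarrow> emeasure M U > 0}"

text \<open>Measures on the unit circle are Borel measures on the complex plane that are concentrated on
  the circle.\<close>

definition nontrivial_circle_measure :: "complex measure \<Rightarrow> bool" where
  "nontrivial_circle_measure \<mu> \<longleftrightarrow>
     prob_space \<mu> \<and> sets \<mu> = sets borel \<and> (AE z in \<mu>. z \<in> sphere 0 1) \<and>
     infinite (measure_support \<mu>)"

text \<open>The measure \<open>d\<theta>/2\<pi>\<close> on \<open>[0, 2\<pi>]\<close>.\<close>

definition angle_measure :: "real measure" where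
  "angle_measure = uniform_measure lborel {0..2 * pi}"

text \<open>The density \<open>w\<close> is a function of the angle, so the absolutely continuous part of \<open>\<mu>\<close> is the
  image under \<open>\<theta> \<mapsto> e\<^sup>i\<^sup>\<theta>\<close> of the measure \<open>w d\<theta>/2\<pi>\<close>.  The values of \<open>w\<close> outside
  \<open>[0, 2\<pi>]\<close> are irrelevant.\<close>

definition circle_lebesgue_decomposition ::
  "complex measure \<Rightarrow> (real \<Rightarrow> real) \<Rightarrow> complex measure \<Rightarrow> bool" where
  "circle_lebesgue_decomposition \<mu> w \<mu>s \<longleftrightarrow>
     w \<in> borel_measurable borel \<and> (\<forall>\<theta>\<in>{0..2 * pi}. 0 \<le> w \<theta>) \<and>
     sets \<mu>s = sets borel \<and>
     (\<exists>N\<in>null_sets (distr angle_measure borel cis). emeasure \<mu>s (- N) = 0) \<and>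
     (\<forall>A\<in>sets borel. emeasure \<mu> A =
        emeasure (distr (density angle_measure (\<lambda>\<theta>. ennreal (w \<theta>))) borel cis) A + emeasure \<mu>s A)"

subsection \<open>Orthogonal polynomials and Verblunsky coefficients\<close>

definition is_monic_orthogonal_poly :: "complex measure \<Rightarrow> nat \<Rightarrow> complex poly \<Rightarrow> bool" where
  "is_monic_orthogonal_poly \<mu> k p \<longleftrightarrow>
     degree p = k \<and> lead_coeff p = 1 \<and> (\<forall>j<k. (\<integral>z. cnj (z ^ j) * poly p z \<partial>\<mu>) = 0)"

definition monic_orthogonal_poly :: "complex measure \<Rightarrow> nat \<Rightarrow> complex poly" where
  "monic_orthogonal_poly \<mu> k = (THE p. is_monic_orthogonal_poly \<mu> k p)"

definition verblunsky :: "complex measure \<Rightarrow> nat \<Rightarrow> complex" where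
  "verblunsky \<mu> k = - cnj (poly (monic_orthogonal_poly \<mu> (Suc k)) 0)"

text \<open>The description of the monic orthogonal polynomials is proper for measures of infinite
  support.\<close>

lemma integrable_circle:
  fixes f :: "complex \<Rightarrow> complex"
  assumes "nontrivial_circle_measure \<mu>" and f: "continuous_on UNIV f"
  shows "integrable \<mu> f"
proof -
  interpret prob_space \<mu> using assms by (simp add: nontrivial_circle_measure_def)
  have S: "sets \<mu> = sets borel" and AE: "AE z in \<mu>. z \<in> sphere 0 1"
    using assms by (simp_all add: nontrivial_circle_measure_def)
  have "compact (f ` sphere 0 1)"
    using f by (intro compact_continuous_image) (auto intro: continuous_on_subset)
  then obtain B where B: "\<And>z. z \<in> sphere 0 1 \<Longrightarrow> norm (f z) \<le> B"
    by (meson bounded_iff compact_imp_bounded imageI)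
  have "f \<in> borel_measurable \<mu>"
    using borel_measurable_continuous_onI[OF f] S by (simp cong: measurable_cong_sets)
  moreover have "AE z in \<mu>. norm (f z) \<le> B"
    using AE by eventually_elim (rule B)
  ultimately show ?thesis by (rule integrable_const_bound[rotated])
qed

lemma poly_eq_0_of_L2_norm_eq_0:
  assumes mu: "nontrivial_circle_measure \<mu>"
    and 0: "(\<integral>z. cnj (poly p z) * poly p z \<partial>\<mu>) = 0"
  shows "p = 0"
proof (rule ccontr)
  assume p: "p \<noteq> 0"
  have S: "sets \<mu> = sets borel" using mu by (simp add: nontrivial_circle_measure_def)
  have eq: "cnj (poly p z) * poly p z = complex_of_real ((norm (poly p z))\<^sup>2)" for z
    by (metis complex_norm_square mult.commute)
  have int: "integrable \<mu> (\<lambda>z. (norm (poly p z))\<^sup>2)"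
  proof -
    have "integrable \<mu> (\<lambda>z. cnj (poly p z) * poly p z)"
      by (rule integrable_circle[OF mu]) (intro continuous_intros)
    from integrable_norm[OF this] show ?thesis by (simp add: norm_mult power2_eq_square)
  qed
  have "(\<integral>z. (norm (poly p z))\<^sup>2 \<partial>\<mu>) = 0"
    using 0 unfolding eq by (simp add: integral_complex_of_real del: of_real_power)
  then have AE: "AE z in \<mu>. poly p z = 0"
    using integral_nonneg_eq_0_iff_AE[OF int] by simp
  have op: "open {z. poly p z \<noteq> 0}"
    by (intro open_Collect_neq continuous_intros)
  have "emeasure \<mu> {z. poly p z \<noteq> 0} = 0"
  proof -
    have "{z \<in> space \<mu>. \<not> poly p z = 0} = {z. poly p z \<noteq> 0}"
      using sets_eq_imp_space_eq[OF S] by simp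
    then show ?thesis
      using AE AE_iff_measurable[of "{z. poly p z \<noteq> 0}" \<mu>] op S by (simp add: borel_open)
  qed
  then have "measure_support \<mu> \<subseteq> {z. poly p z = 0}"
    using op by (force simp: measure_support_def)
  then show False
    using mu poly_roots_finite[OF p] finite_subset by (auto simp: nontrivial_circle_measure_def)
qed

lemma orthogonal_lower_degree:
  assumes mu: "nontrivial_circle_measure \<mu>"
    and p: "\<forall>j<k. (\<integral>z. cnj (z ^ j) * poly p z \<partial>\<mu>) = 0"
    and q: "q = 0 \<or> degree q < k"
  shows "(\<integral>z. cnj (poly q z) * poly p z \<partial>\<mu>) = 0"
proof (cases "q = 0")
  case False
  then have d: "degree q < k" using q by simp
  have "(\<integral>z. cnj (poly q z) * poly p z \<partial>\<mu>) =
        (\<integral>z. (\<Sum>j\<le>degree q. cnj (coeff q j) * (cnj (z ^ j) * poly p z)) \<partial>\<mu>)"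
    by (simp add: poly_altdef sum_distrib_right mult.assoc)
  also have "\<dots> = (\<Sum>j\<le>degree q. \<integral>z. cnj (coeff q j) * (cnj (z ^ j) * poly p z) \<partial>\<mu>)"
    by (intro Bochner_Integration.integral_sum integrable_circle[OF mu] continuous_intros)
  also have "\<dots> = 0" using p d by (intro sum.neutral) simp
  finally show ?thesis .
qed simp

lemma is_monic_orthogonal_poly_unique:
  assumes mu: "nontrivial_circle_measure \<mu>"
    and p: "is_monic_orthogonal_poly \<mu> k p" and q: "is_monic_orthogonal_poly \<mu> k q"
  shows "p = q"
proof -
  have i: "(\<integral>z. cnj (z ^ j) * poly (p - q) z \<partial>\<mu>) = 0" if "j < k" for j
  proof -
    have "(\<integral>z. cnj (z ^ j) * poly (p - q) z \<partial>\<mu>) =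
          (\<integral>z. cnj (z ^ j) * poly p z - cnj (z ^ j) * poly q z \<partial>\<mu>)"
      by (simp add: algebra_simps)
    also have "\<dots> = (\<integral>z. cnj (z ^ j) * poly p z \<partial>\<mu>) - (\<integral>z. cnj (z ^ j) * poly q z \<partial>\<mu>)"
      by (intro Bochner_Integration.integral_diff integrable_circle[OF mu] continuous_intros)
    finally show ?thesis using p q that by (simp add: is_monic_orthogonal_poly_def)
  qed
  have "p - q = 0 \<or> degree (p - q) < k"
  proof (rule disjCI)
    assume n: "\<not> degree (p - q) < k"
    have "degree (p - q) \<le> k" using p q degree_diff_le[of p k q]
      by (simp add: is_monic_orthogonal_poly_def)
    then have "degree (p - q) = k" using n by simp
    moreover have "coeff (p - q) k = 0" using p q by (auto simp: is_monic_orthogonal_poly_def)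
    ultimately show "p - q = 0" using leading_coeff_0_iff by metis
  qed
  from orthogonal_lower_degree[OF mu _ this] i have "(\<integral>z. cnj (poly (p - q) z) * poly (p - q) z \<partial>\<mu>) = 0"
    by blast
  from poly_eq_0_of_L2_norm_eq_0[OF mu this] show ?thesis by simp
qed

lemma is_monic_orthogonal_poly_exists:
  assumes mu: "nontrivial_circle_measure \<mu>"
  shows "\<exists>p. is_monic_orthogonal_poly \<mu> k p"
proof (induction k rule: less_induct)
  case (less k)
  then obtain P where P: "\<And>j. j < k \<Longrightarrow> is_monic_orthogonal_poly \<mu> j (P j)" by metis
  define ip where "ip = (\<lambda>p q. \<integral>z. cnj (poly p z) * poly q z \<partial>\<mu>)"
  have ip_sub: "ip r (p - q) = ip r p - ip r q" for p q r
  proof -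
    have "ip r (p - q) = (\<integral>z. cnj (poly r z) * poly p z - cnj (poly r z) * poly q z \<partial>\<mu>)"
      by (simp add: ip_def algebra_simps)
    also have "\<dots> = ip r p - ip r q" unfolding ip_def
      by (intro Bochner_Integration.integral_diff integrable_circle[OF mu] continuous_intros)
    finally show ?thesis .
  qed
  have ip_sum: "ip r (\<Sum>j<m. smult (c j) (P j)) = (\<Sum>j<m. c j * ip r (P j))" for r c m
  proof -
    have "ip r (\<Sum>j<m. smult (c j) (P j)) =
          (\<integral>z. (\<Sum>j<m. c j * (cnj (poly r z) * poly (P j) z)) \<partial>\<mu>)"
      by (simp add: ip_def poly_sum sum_distrib_left mult_ac)
    also have "\<dots> = (\<Sum>j<m. \<integral>z. c j * (cnj (poly r z) * poly (P j) z) \<partial>\<mu>)"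
      by (intro Bochner_Integration.integral_sum integrable_circle[OF mu] continuous_intros)
    also have "\<dots> = (\<Sum>j<m. c j * ip r (P j))" by (simp add: ip_def)
    finally show ?thesis .
  qed
  have ip_cnj: "ip q p = cnj (ip p q)" for p q
    unfolding ip_def Bochner_Integration.integral_cnj[symmetric]
    by (simp add: mult.commute)
  have deg: "degree (P j) = j" and lc: "coeff (P j) j = 1" if "j < k" for j
    using P[OF that] by (auto simp: is_monic_orthogonal_poly_def)
  have P0: "P j \<noteq> 0" if "j < k" for j using lc[OF that] by auto
  have low: "ip q (P j) = 0" if "j < k" "q = 0 \<or> degree q < j" for j q
    using orthogonal_lower_degree[OF mu _ that(2)] P[OF that(1)]
    unfolding ip_def is_monic_orthogonal_poly_def by blast
  have ort: "ip (P i) (P j) = 0" if "i < k" "j < k" "i \<noteq> j" for i j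
  proof (cases "i < j")
    case True then show ?thesis using low[of j "P i"] that deg by simp
  next
    case False then show ?thesis using low[of i "P j"] that deg ip_cnj[of "P i" "P j"] by simp
  qed
  have nz: "ip (P j) (P j) \<noteq> 0" if "j < k" for j
    using poly_eq_0_of_L2_norm_eq_0[OF mu] P0[OF that] unfolding ip_def by blast
  define c where "c = (\<lambda>j. ip (P j) (monom 1 k) / ip (P j) (P j))"
  define s where "s = (\<Sum>j<k. smult (c j) (P j))"
  define Q where "Q = monom 1 k - s"
  have QP: "ip (P i) Q = 0" if "i < k" for i
  proof -
    have "(\<Sum>j<k. c j * ip (P i) (P j)) = (\<Sum>j<k. if j = i then c i * ip (P i) (P i) else 0)"
      using ort that by (intro sum.cong) auto
    also have "\<dots> = c i * ip (P i) (P i)" using that by simp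
    finally show ?thesis
      unfolding Q_def ip_sub s_def ip_sum using nz[OF that] by (simp add: c_def)
  qed
  have s_k: "coeff s i = 0" if "i \<ge> k" for i
    unfolding s_def coeff_sum using deg that by (intro sum.neutral) (auto simp: coeff_eq_0)
  have Qk: "coeff Q k = 1" using s_k by (simp add: Q_def)
  have degQ: "degree Q = k"
  proof (rule antisym)
    show "degree Q \<le> k" by (rule degree_le) (auto simp: Q_def s_k)
    show "k \<le> degree Q" using Qk by (intro le_degree) simp
  qed
  have "ip q Q = 0" if "degree q < k" for q
    using that
  proof (induction "degree q" arbitrary: q rule: less_induct)
    case less
    define d where "d = degree q"
    define r where "r = q - smult (coeff q d) (P d)"
    have dk: "d < k" using less.prems by (simp add: d_def)
    have rd: "degree r \<le> d" unfolding r_def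
      by (intro degree_diff_le) (use deg[OF dk] in \<open>auto simp: d_def\<close>)
    have rc: "coeff r d = 0" using lc[OF dk] by (simp add: r_def)
    have r0: "ip r Q = 0"
    proof (cases "degree r < d")
      case True then show ?thesis using less.hyps[of r] dk by (simp add: d_def)
    next
      case False
      then have "degree r = d" using rd by simp
      then have "r = 0" using rc leading_coeff_0_iff by metis
      then show ?thesis by (simp add: ip_def)
    qed
    have "ip Q r = ip Q q - ip Q (smult (coeff q d) (P d))" unfolding r_def ip_sub ..
    also have "ip Q (smult (coeff q d) (P d)) = coeff q d * ip Q (P d)"
      by (simp add: ip_def mult.left_commute)
    also have "ip Q (P d) = 0" using QP[OF dk] ip_cnj[of Q "P d"] by simp
    finally have "ip Q q = 0" using r0 ip_cnj[of Q r] by simp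
    then show ?case using ip_cnj[of q Q] by simp
  qed
  then have "(\<integral>z. cnj (z ^ j) * poly Q z \<partial>\<mu>) = 0" if "j < k" for j
    using that by (metis (mono_tags, lifting) Bochner_Integration.integral_cong degree_monom_eq ip_def
        mult_1 poly_monom zero_neq_one)
  then show ?case using degQ Qk unfolding is_monic_orthogonal_poly_def by auto
qed

lemma is_monic_orthogonal_poly_monic_orthogonal_poly:
  assumes "nontrivial_circle_measure \<mu>"
  shows "is_monic_orthogonal_poly \<mu> k (monic_orthogonal_poly \<mu> k)"
  unfolding monic_orthogonal_poly_def
  using is_monic_orthogonal_poly_exists[OF assms] is_monic_orthogonal_poly_unique[OF assms]
  by (metis theI)

subsection \<open>Sequences\<close>

definition ell :: "nat \<Rightarrow> (nat \<Rightarrow> complex) set" where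
  "ell p = {a. summable (\<lambda>k. norm (a k) ^ p)}"

definition left_shift :: "(nat \<Rightarrow> complex) \<Rightarrow> nat \<Rightarrow> complex" where
  "left_shift a = (\<lambda>k. a (Suc k))"

subsection \<open>Extended-real integrals\<close>

text \<open>On the reals, \<open>ln 0 = 0\<close>; here the logarithm is \<open>-\<infinity>\<close> at \<open>0\<close>.\<close>

definition ext_log :: "real \<Rightarrow> ereal" where
  "ext_log x = (if x > 0 then ereal (ln x) else -\<infinity>)"

text \<open>Integral of the positive part minus integral of the negative part (\<^const>\<open>e2ennreal\<close> maps
  negative numbers to \<open>0\<close>).  It is meaningful if one of the two is finite.\<close>

definition ext_integral :: "'a measure \<Rightarrow> ('a \<Rightarrow> ereal) \<Rightarrow> ereal" where
  "ext_integral M f =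
     enn2ereal (\<integral>\<^sup>+x. e2ennreal (f x) \<partial>M) - enn2ereal (\<integral>\<^sup>+x. e2ennreal (- f x) \<partial>M)"

end

theory Submission
  imports Defs "HOL-Complex_Analysis.Complex_Analysis"
begin

text \<open>Let \<open>P(\<theta>) = 1 - cos n\<theta>\<close> and let \<open>w\<^sub>N = \<parallel>\<Phi>\<^sub>N\<parallel>\<^sup>2 / |\<Phi>\<^sub>N|\<^sup>2\<close> be the density of the \<open>N\<close>-th
  Bernstein--Szego measure, which has the same moments as \<open>\<mu>\<close> up to order \<open>N\<close>.  The inequality
  \<open>ln x \<le> x - 1\<close> shows in one direction that \<open>\<integral> P ln w \<le> \<integral> P ln w\<^sub>N + const\<close>, and in the other
  direction, applied to \<open>w\<^sub>N h\<close> with \<open>h\<close> close to \<open>1 / min(w, 1)\<close> off the singular part, that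
  \<open>\<integral> P ln w\<close> is finite if the \<open>\<integral> P ln w\<^sub>N\<close> are bounded below.

  With \<open>b\<^sub>k = \<Phi>\<^sub>k / \<Phi>\<^sub>k\<^sup>*\<close>, the Szego recursion \<open>\<Phi>\<^sub>k\<^sub>+\<^sub>1\<^sup>* = \<Phi>\<^sub>k\<^sup>* (1 - \<alpha>\<^sub>k z b\<^sub>k)\<close> gives \<open>\<integral> P ln w\<^sub>N\<close> as
  the sum over \<open>k < N\<close> of \<open>ln (1 - |\<alpha>\<^sub>k|\<^sup>2) + Re [z\<^sup>n] log (1 - \<alpha>\<^sub>k z b\<^sub>k)\<close>.  Expanding up to sixth
  order in \<open>\<alpha>\<close>, the quadratic terms combine to \<open>-|\<alpha>\<^sub>k - \<alpha>\<^sub>k\<^sub>-\<^sub>n|\<^sup>2 / 2\<close> and the quartic terms to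
  \<open>-n\<^sup>2 |\<alpha>\<^sub>k|\<^sup>4 / 2\<close>, up to errors with bounded partial sums.  Both terms are nonpositive, so the
  sums are bounded below iff both series converge.\<close>

section \<open>Sequences with bounded partial sums\<close>

text \<open>The weight P has mean 1, and \<open>\<Phi>s N\<close> has no zeros in the closed disc,
  so on the circle ln |\<open>\<Phi>s N\<close>| is the real part of a holomorphic function
  vanishing at 0. Integrated against P it leaves only a Taylor coefficient of index n; hence the sum
  rule is exact at every finite N. The obstacle is that little converges absolutely: |\<alpha>_k|^2
  need not be summable, and it drops out only against a shifted copy of itself. Sums are therefore
  compared modulo sequences with bounded partial sums, where telescoping terms are negligible, and
  not modulo summable ones. In this calculus a quartic monomial with two conjugated factors and
  fixed shifts always counts as |\<alpha>_k|^4, so n^2/2 is a count: n(n-1)/2 from the cubic part of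
  b_k, (n-1)/2 from the quadratic term of the logarithm, and 1/2 from ln (1 - |\<alpha>_k|^2). On
  the side of the measure, one-sided bounds in each direction replace convergence of the entropies,
  and the test function equals 1 on a Lebesgue null set carrying the singular part, which thus
  contributes only a bounded amount.\<close>

definition bounded_sums :: "(nat \<Rightarrow> real) \<Rightarrow> bool" where
  "bounded_sums f \<longleftrightarrow> (\<exists>C. \<forall>N. \<bar>\<Sum>k<N. f k\<bar> \<le> C)"

lemma bounded_sums_0: "bounded_sums (\<lambda>_. 0)"
  by (auto simp: bounded_sums_def)

lemma bounded_sums_add:
  assumes "bounded_sums f" "bounded_sums g"
  shows "bounded_sums (\<lambda>k. f k + g k)"
proof -
  obtain C D where "\<And>N. \<bar>\<Sum>k<N. f k\<bar> \<le> C" "\<And>N. \<bar>\<Sum>k<N. g k\<bar> \<le> D"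
    using assms by (auto simp: bounded_sums_def)
  then have "\<bar>\<Sum>k<N. f k + g k\<bar> \<le> C + D" for N
    unfolding sum.distrib by (meson abs_triangle_ineq add_mono order_trans)
  then show ?thesis by (auto simp: bounded_sums_def)
qed

lemma bounded_sums_cmult:
  assumes "bounded_sums f"
  shows "bounded_sums (\<lambda>k. c * f k)"
proof -
  obtain C where "\<And>N. \<bar>\<Sum>k<N. f k\<bar> \<le> C"
    using assms by (auto simp: bounded_sums_def)
  then have "\<bar>\<Sum>k<N. c * f k\<bar> \<le> \<bar>c\<bar> * C" for N
    unfolding sum_distrib_left[symmetric] abs_mult by (simp add: mult_left_mono)
  then show ?thesis by (auto simp: bounded_sums_def)
qed

lemma bounded_sums_diff:
  assumes "bounded_sums f" "bounded_sums g"
  shows "bounded_sums (\<lambda>k. f k - g k)"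
  using bounded_sums_add[OF assms(1) bounded_sums_cmult[OF assms(2), of "-1"]] by simp

lemma bounded_sums_sum:
  assumes "\<And>i. i \<in> I \<Longrightarrow> bounded_sums (f i)"
  shows "bounded_sums (\<lambda>k. \<Sum>i\<in>I. f i k)"
  using assms
proof (induction I rule: infinite_finite_induct)
  case (insert i I)
  then show ?case using bounded_sums_add[of "f i" "\<lambda>k. \<Sum>i\<in>I. f i k"] by simp
qed (auto simp: bounded_sums_0)

lemma bounded_sums_summable:
  assumes "summable (\<lambda>k. \<bar>f k\<bar>)"
  shows "bounded_sums f"
proof -
  have "\<bar>\<Sum>k<N. f k\<bar> \<le> (\<Sum>k. \<bar>f k\<bar>)" for N
    using sum_abs[of f "{..<N}"] sum_le_suminf[OF assms, of "{..<N}"] by (meson abs_ge_zero finite_lessThan order_trans)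
  then show ?thesis by (auto simp: bounded_sums_def)
qed

lemma bounded_sums_eventually_cong:
  assumes "bounded_sums f" "\<And>k. k \<ge> K \<Longrightarrow> f k = g k"
  shows "bounded_sums g"
proof -
  have "summable (\<lambda>k. \<bar>g k - f k\<bar>)"
    by (rule summable_finite[of "{..<K}"]) (simp_all add: assms(2))
  from bounded_sums_add[OF assms(1) bounded_sums_summable[OF this]] show ?thesis by simp
qed

text \<open>Shifting an index is free. One unit of shift leaves two boundary terms, because k - Suc
  a is (k - 1) - a for k > 0, while the truncated subtraction makes the summand at k = 0 vanish;
  larger shifts are composed of unit ones.\<close>

lemma bounded_sums_telescope:
  assumes "\<And>k. \<bar>g k\<bar> \<le> B"
  shows "bounded_sums (\<lambda>k. g (k - a) - g k)"
proof (induction a)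
  case (Suc a)
  have "(\<Sum>k<N. g (k - Suc a) - g (k - a)) = (if N = 0 then 0 else g (0 - a) - g (N - 1 - a))" for N
  proof (induction N)
    case (Suc N)
    then show ?case by (cases N) simp_all
  qed simp
  moreover have "B \<ge> 0" using assms[of 0] by linarith
  ultimately have "\<bar>\<Sum>k<N. g (k - Suc a) - g (k - a)\<bar> \<le> 2 * B" for N
    using assms[of "0 - a"] assms[of "N - 1 - a"] by auto
  then have "bounded_sums (\<lambda>k. g (k - Suc a) - g (k - a))" unfolding bounded_sums_def by blast
  from bounded_sums_add[OF this Suc] show ?case by simp
qed (simp add: bounded_sums_0)

lemma summable_shift_back:
  fixes f :: "nat \<Rightarrow> real"
  assumes "summable f"
  shows "summable (\<lambda>k. f (k - a))"
  using assms summable_iff_shift[of "\<lambda>k. f (k - a)" a] by simp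

section \<open>Orders of smallness with respect to a sequence\<close>

text \<open>The window looks only backwards, so that the order of a sequence is stable under
  \<open>k \<mapsto> k - s\<close>; finitely many indices are irrelevant, which makes the truncated subtraction harmless.\<close>

definition window :: "(nat \<Rightarrow> complex) \<Rightarrow> nat \<Rightarrow> nat \<Rightarrow> real" where
  "window \<alpha> W k = (\<Sum>i\<le>W. norm (\<alpha> (k - i)))"

definition of_order :: "(nat \<Rightarrow> complex) \<Rightarrow> nat \<Rightarrow> (nat \<Rightarrow> complex) \<Rightarrow> bool" where
  "of_order \<alpha> p f \<longleftrightarrow> (\<exists>C W K. \<forall>k\<ge>K. norm (f k) \<le> C * window \<alpha> W k ^ p)"

lemma window_nonneg: "window \<alpha> W k \<ge> 0"
  by (auto simp: window_def intro: sum_nonneg)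

lemma window_mono: "W \<le> W' \<Longrightarrow> window \<alpha> W k \<le> window \<alpha> W' k"
  unfolding window_def by (rule sum_mono2) auto

lemma window_shift: "window \<alpha> W (k - s) \<le> window \<alpha> (W + s) k"
proof -
  have "window \<alpha> W (k - s) = (\<Sum>i\<in>(\<lambda>i. i + s) ` {..W}. norm (\<alpha> (k - i)))"
    by (subst sum.reindex) (auto simp: window_def add.commute)
  also have "\<dots> \<le> window \<alpha> (W + s) k"
    unfolding window_def by (rule sum_mono2) auto
  finally show ?thesis .
qed

text \<open>Normal form for combining two sequences: with a nonnegative constant every wider window
  also works, so two witnesses can be brought to the common window W + V.\<close>

lemma of_orderE:
  assumes "of_order \<alpha> p f"
  obtains C W K where "C \<ge> 0" and
    "\<And>k W'. k \<ge> K \<Longrightarrow> W' \<ge> W \<Longrightarrow> norm (f k) \<le> C * window \<alpha> W' k ^ p"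
proof -
  obtain C W K where *: "\<And>k. k \<ge> K \<Longrightarrow> norm (f k) \<le> C * window \<alpha> W k ^ p"
    using assms by (auto simp: of_order_def)
  have "norm (f k) \<le> \<bar>C\<bar> * window \<alpha> W' k ^ p" if "k \<ge> K" "W' \<ge> W" for k W'
  proof -
    have "norm (f k) \<le> C * window \<alpha> W k ^ p" using * that by simp
    also have "\<dots> \<le> \<bar>C\<bar> * window \<alpha> W' k ^ p"
      using that by (intro mult_mono power_mono window_mono window_nonneg zero_le_power) auto
    finally show ?thesis .
  qed
  then show ?thesis by (intro that[of "\<bar>C\<bar>" K W]) auto
qed

lemma of_order_0: "of_order \<alpha> p (\<lambda>_. 0)"
  unfolding of_order_def by (rule exI[of _ 0]) simp

lemma of_order_add:
  assumes "of_order \<alpha> p f" "of_order \<alpha> p g"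
  shows "of_order \<alpha> p (\<lambda>k. f k + g k)"
proof -
  obtain C W K where 1: "C \<ge> 0"
    "\<And>k W'. k \<ge> K \<Longrightarrow> W' \<ge> W \<Longrightarrow> norm (f k) \<le> C * window \<alpha> W' k ^ p"
    using assms(1) by (rule of_orderE) blast
  obtain D V L where 2: "D \<ge> 0"
    "\<And>k W'. k \<ge> L \<Longrightarrow> W' \<ge> V \<Longrightarrow> norm (g k) \<le> D * window \<alpha> W' k ^ p"
    using assms(2) by (rule of_orderE) blast
  have "norm (f k + g k) \<le> (C + D) * window \<alpha> (W + V) k ^ p" if "k \<ge> K + L" for k
    using 1(2)[of k "W + V"] 2(2)[of k "W + V"] that norm_triangle_ineq[of "f k" "g k"]
    by (simp add: distrib_right)
  then show ?thesis unfolding of_order_def by blast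
qed

lemma of_order_mult:
  assumes "of_order \<alpha> p f" "of_order \<alpha> q g"
  shows "of_order \<alpha> (p + q) (\<lambda>k. f k * g k)"
proof -
  obtain C W K where 1: "C \<ge> 0"
    "\<And>k W'. k \<ge> K \<Longrightarrow> W' \<ge> W \<Longrightarrow> norm (f k) \<le> C * window \<alpha> W' k ^ p"
    using assms(1) by (rule of_orderE) blast
  obtain D V L where 2: "D \<ge> 0"
    "\<And>k W'. k \<ge> L \<Longrightarrow> W' \<ge> V \<Longrightarrow> norm (g k) \<le> D * window \<alpha> W' k ^ q"
    using assms(2) by (rule of_orderE) blast
  have "norm (f k * g k) \<le> (C * D) * window \<alpha> (W + V) k ^ (p + q)" if "k \<ge> K + L" for k
  proof -
    have "norm (f k) * norm (g k) \<le> (C * window \<alpha> (W + V) k ^ p) * (D * window \<alpha> (W + V) k ^ q)"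
      using that 1 2 by (intro mult_mono) (auto simp: window_nonneg)
    then show ?thesis by (simp add: norm_mult power_add mult_ac)
  qed
  then show ?thesis unfolding of_order_def by blast
qed

lemma of_order_const: "of_order \<alpha> 0 (\<lambda>_. c)"
  unfolding of_order_def by (rule exI[of _ "norm c"]) simp

lemma of_order_cmult: "of_order \<alpha> p f \<Longrightarrow> of_order \<alpha> p (\<lambda>k. c * f k)"
  using of_order_mult[OF of_order_const, of \<alpha> p f c] by simp

lemma of_order_uminus: "of_order \<alpha> p f \<Longrightarrow> of_order \<alpha> p (\<lambda>k. - f k)"
  using of_order_cmult[of \<alpha> p f "-1"] by simp

lemma of_order_diff:
  "of_order \<alpha> p f \<Longrightarrow> of_order \<alpha> p g \<Longrightarrow> of_order \<alpha> p (\<lambda>k. f k - g k)"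
  using of_order_add[of \<alpha> p f "\<lambda>k. - g k"] of_order_uminus[of \<alpha> p g] by simp

lemma of_order_sum:
  assumes "\<And>i. i \<in> I \<Longrightarrow> of_order \<alpha> p (f i)"
  shows "of_order \<alpha> p (\<lambda>k. \<Sum>i\<in>I. f i k)"
  using assms
proof (induction I rule: infinite_finite_induct)
  case (insert i I)
  then show ?case using of_order_add[of \<alpha> p "f i" "\<lambda>k. \<Sum>i\<in>I. f i k"] by simp
qed (auto simp: of_order_0)

lemma of_order_shift:
  assumes "of_order \<alpha> p f"
  shows "of_order \<alpha> p (\<lambda>k. f (k - s))"
proof -
  obtain C W K where 1: "C \<ge> 0"
    "\<And>k W'. k \<ge> K \<Longrightarrow> W' \<ge> W \<Longrightarrow> norm (f k) \<le> C * window \<alpha> W' k ^ p"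
    using assms(1) by (rule of_orderE) blast
  have "norm (f (k - s)) \<le> C * window \<alpha> (W + s) k ^ p" if "k \<ge> K + s" for k
  proof -
    have "norm (f (k - s)) \<le> C * window \<alpha> W (k - s) ^ p" using 1 that by simp
    also have "\<dots> \<le> C * window \<alpha> (W + s) k ^ p"
      using 1 by (intro mult_left_mono power_mono window_shift window_nonneg)
    finally show ?thesis .
  qed
  then show ?thesis unfolding of_order_def by blast
qed

lemma of_order_eventually_cong:
  assumes "of_order \<alpha> p f" "\<And>k. k \<ge> N \<Longrightarrow> f k = g k"
  shows "of_order \<alpha> p g"
proof -
  obtain C W K where 1: "C \<ge> 0"
    "\<And>k W'. k \<ge> K \<Longrightarrow> W' \<ge> W \<Longrightarrow> norm (f k) \<le> C * window \<alpha> W' k ^ p"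
    using assms(1) by (rule of_orderE) blast
  have "norm (g k) \<le> C * window \<alpha> W k ^ p" if "k \<ge> K + N" for k
    using 1(2)[of k W] assms(2)[of k] that by simp
  then show ?thesis unfolding of_order_def by blast
qed

text \<open>A bounded \<alpha> has bounded windows, so surplus powers of the window are absorbed
  into the constant.\<close>

lemma of_order_weaken:
  assumes "of_order \<alpha> p f" "q \<le> p" and bd: "\<And>k. norm (\<alpha> k) \<le> 1"
  shows "of_order \<alpha> q f"
proof -
  obtain C W K where 1: "C \<ge> 0"
    "\<And>k W'. k \<ge> K \<Longrightarrow> W' \<ge> W \<Longrightarrow> norm (f k) \<le> C * window \<alpha> W' k ^ p"
    using assms(1) by (rule of_orderE) blast
  have w: "window \<alpha> W k \<le> real (W + 1)" for k
    unfolding window_def using sum_bounded_above[of "{..W}" "\<lambda>i. norm (\<alpha> (k - i))" 1] bd by simp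
  have "norm (f k) \<le> (C * real (W + 1) ^ (p - q)) * window \<alpha> W k ^ q" if "k \<ge> K" for k
  proof -
    have "norm (f k) \<le> C * (window \<alpha> W k ^ (p - q) * window \<alpha> W k ^ q)"
      using 1(2)[of k W] that assms(2) by (simp flip: power_add)
    also have "\<dots> \<le> C * (real (W + 1) ^ (p - q) * window \<alpha> W k ^ q)"
      using 1 by (intro mult_left_mono mult_right_mono power_mono w window_nonneg zero_le_power)
    finally show ?thesis by (simp add: mult_ac)
  qed
  then show ?thesis unfolding of_order_def by blast
qed

lemma of_order_self: "of_order \<alpha> 1 (\<lambda>k. \<alpha> (k - s))"
proof -
  have "norm (\<alpha> k) \<le> 1 * window \<alpha> 0 k ^ 1" for k by (simp add: window_def)
  then have "of_order \<alpha> 1 \<alpha>" unfolding of_order_def by blast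
  then show ?thesis by (rule of_order_shift)
qed

lemma of_order_cnj: "of_order \<alpha> p f \<Longrightarrow> of_order \<alpha> p (\<lambda>k. cnj (f k))"
  by (simp add: of_order_def)

text \<open>Comparison with the largest summand; the crude constant is harmless since the window
  length W is fixed.\<close>

lemma power_sum_le:
  fixes x :: "nat \<Rightarrow> real"
  assumes "\<And>i. x i \<ge> 0"
  shows "(\<Sum>i\<le>W. x i) ^ p \<le> real (W + 1) ^ p * (\<Sum>i\<le>W. x i ^ p)"
proof -
  obtain j where j: "j \<le> W" "\<And>i. i \<le> W \<Longrightarrow> x i \<le> x j"
  proof -
    have "Max (x ` {..W}) \<in> x ` {..W}" by (rule Max_in) auto
    then obtain j where j: "j \<in> {..W}" "Max (x ` {..W}) = x j" by (rule imageE) blast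
    have "x i \<le> x j" if "i \<le> W" for i
      unfolding j(2)[symmetric] using that by (intro Max_ge) auto
    with j(1) show ?thesis by (intro that[of j]) auto
  qed
  have "(\<Sum>i\<le>W. x i) \<le> real (W + 1) * x j"
    using sum_bounded_above[of "{..W}" x "x j"] j by simp
  then have "(\<Sum>i\<le>W. x i) ^ p \<le> real (W + 1) ^ p * x j ^ p"
    unfolding power_mult_distrib[symmetric] using assms by (intro power_mono sum_nonneg) auto
  also have "x j ^ p \<le> (\<Sum>i\<le>W. x i ^ p)"
    using member_le_sum[of j "{..W}" "\<lambda>i. x i ^ p"] j assms by simp
  finally show ?thesis by (simp add: mult_left_mono)
qed

text \<open>The purpose of the notion of order: a term of order p is dominated by finitely many
  shifts of |\<alpha>|^p, hence is an absolutely summable error as soon as \<alpha> lies in the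
  corresponding sequence space.\<close>

lemma of_order_summable:
  assumes "of_order \<alpha> p f" "summable (\<lambda>k. norm (\<alpha> k) ^ p)"
  shows "summable (\<lambda>k. norm (f k))"
proof -
  obtain C W K where 1: "C \<ge> 0"
    "\<And>k W'. k \<ge> K \<Longrightarrow> W' \<ge> W \<Longrightarrow> norm (f k) \<le> C * window \<alpha> W' k ^ p"
    using assms(1) by (rule of_orderE) blast
  have "norm (norm (f k)) \<le> C * (real (W + 1) ^ p * (\<Sum>i\<le>W. norm (\<alpha> (k - i)) ^ p))" if "k \<ge> K" for k
  proof -
    have "norm (f k) \<le> C * window \<alpha> W k ^ p" using 1 that by simp
    also have "\<dots> \<le> C * (real (W + 1) ^ p * (\<Sum>i\<le>W. norm (\<alpha> (k - i)) ^ p))"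
      unfolding window_def using 1 by (intro mult_left_mono power_sum_le) auto
    finally show ?thesis by simp
  qed
  moreover have "summable (\<lambda>k. C * (real (W + 1) ^ p * (\<Sum>i\<le>W. norm (\<alpha> (k - i)) ^ p)))"
    by (intro summable_mult summable_sum summable_shift_back assms(2))
  ultimately show ?thesis by (rule summable_comparison_test'[rotated])
qed

lemma of_order_bounded_sums:
  assumes "of_order \<alpha> p f" "summable (\<lambda>k. norm (\<alpha> k) ^ p)"
  shows "bounded_sums (\<lambda>k. Re (f k))"
  by (rule bounded_sums_summable, rule summable_comparison_test'[OF of_order_summable[OF assms]])
    (simp add: abs_Re_le_cmod)

section \<open>Quartic forms in a slowly varying sequence\<close>

text \<open>Up to the telescoping differences of \<open>|\<alpha>\<^sub>k|\<^sup>4\<close>, first differences enter a quartic form only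
  through products of two of them; this is what makes \<open>\<alpha> \<in> \<ell>\<^sup>6\<close> and \<open>(S - 1)\<alpha> \<in> \<ell>\<^sup>3\<close> sufficient.\<close>

lemma Re_quartic:
  "Re (p * q * cnj r * cnj s) =
     (norm p ^ 4 + norm q ^ 4 + norm r ^ 4 + norm s ^ 4) / 4
     - (norm p ^ 2 - norm q ^ 2) ^ 2 / 4 - (norm r ^ 2 - norm s ^ 2) ^ 2 / 4
     - norm (p * q - r * s) ^ 2 / 2"
proof -
  have four: "norm z ^ 4 = (norm z ^ 2) ^ 2" for z :: complex by simp
  \<comment> \<open>Polarisation twice: 2 Re (x cnj y) = |x|^2 + |y|^2 - |x - y|^2 with x = p q and
    y = r s, and then the analogous real identity for |p|^2 |q|^2 and for |r|^2 |s|^2.\<close>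
  show ?thesis
    unfolding four cmod_power2 by (simp add: field_simps power2_eq_square)
qed

text \<open>The three error squares of \<open>Re_quartic\<close> have weights 1/4, 1/4 and 1/2,
  which add up to 1, and each square is at most (2 M D)^2.\<close>

lemma Re_quartic_bound:
  assumes M: "norm p \<le> M" "norm q \<le> M" "norm r \<le> M" "norm s \<le> M"
    and D: "norm (p - q) \<le> D" "norm (r - s) \<le> D" "norm (p - r) \<le> D" "norm (q - s) \<le> D"
  shows "\<bar>Re (p * q * cnj r * cnj s) - (norm p ^ 4 + norm q ^ 4 + norm r ^ 4 + norm s ^ 4) / 4\<bar>
    \<le> 4 * (M ^ 2 * D ^ 2)"
proof -
  have M0: "M \<ge> 0" using M(1) norm_ge_zero order_trans by blast
  have D0: "D \<ge> 0" using D(1) norm_ge_zero order_trans by blast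
  have sq: "(norm x ^ 2 - norm y ^ 2) ^ 2 \<le> 4 * (M ^ 2 * D ^ 2)"
    if "norm x \<le> M" "norm y \<le> M" "norm (x - y) \<le> D" for x y :: complex
  proof -
    have "\<bar>norm x ^ 2 - norm y ^ 2\<bar> = \<bar>norm x - norm y\<bar> * (norm x + norm y)"
      by (metis abs_mult abs_of_nonneg add_nonneg_nonneg mult.commute norm_ge_zero square_diff_square_factored power2_eq_square)
    also have "\<dots> \<le> D * (2 * M)"
      using that norm_triangle_ineq3[of x y] D0 by (intro mult_mono) auto
    finally have "\<bar>norm x ^ 2 - norm y ^ 2\<bar> ^ 2 \<le> (D * (2 * M)) ^ 2" by (intro power_mono) auto
    then show ?thesis by (simp add: power_mult_distrib mult_ac)
  qed
  have "norm (p * q - r * s) \<le> 2 * (M * D)"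
  proof -
    have "p * q - r * s = p * (q - s) + (p - r) * s" by (simp add: algebra_simps)
    then have "norm (p * q - r * s) \<le> norm p * norm (q - s) + norm (p - r) * norm s"
      by (metis norm_mult norm_triangle_ineq)
    also have "\<dots> \<le> M * D + D * M" using M D M0 D0 by (intro add_mono mult_mono) auto
    finally show ?thesis by (simp add: mult.commute)
  qed
  then have "norm (p * q - r * s) ^ 2 \<le> (2 * (M * D)) ^ 2" by (intro power_mono) auto
  then have E: "norm (p * q - r * s) ^ 2 \<le> 4 * (M ^ 2 * D ^ 2)" by (simp add: power_mult_distrib)
  have *: "\<bar>(t - a / 4 - b / 4 - e / 2) - t\<bar> \<le> m"
    if "0 \<le> a" "a \<le> m" "0 \<le> b" "b \<le> m" "0 \<le> e" "e \<le> m" for t a b e m :: real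
    using that by (simp add: abs_le_iff)
  show ?thesis
    unfolding Re_quartic
    by (rule *) (rule zero_le_power2 sq[OF M(1,2) D(1)] sq[OF M(3,4) D(2)] E)+
qed

text \<open>Here the exponents 6 and 3 meet: 2/6 + 2/3 = 1. An error M^3 D with a single difference
  would fall short, as 3/6 + 1/3 < 1.\<close>

lemma mult_squares_le:
  fixes M D :: real
  assumes "M \<ge> 0" "D \<ge> 0"
  shows "M ^ 2 * D ^ 2 \<le> M ^ 6 + D ^ 3"
proof (cases "D \<le> M ^ 2")
  case True
  then have "D ^ 2 \<le> (M ^ 2) ^ 2" using assms by (intro power_mono) auto
  then have "M ^ 2 * D ^ 2 \<le> M ^ 2 * (M ^ 2) ^ 2" by (intro mult_left_mono) auto
  also have "\<dots> = M ^ 6" by (simp flip: power_mult power_add)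
  finally show ?thesis using assms by (simp add: add_increasing2)
next
  case False
  then have "M ^ 2 * D ^ 2 \<le> D * D ^ 2" by (intro mult_right_mono) auto
  then show ?thesis using assms by (simp add: power3_eq_cube power2_eq_square mult.assoc add_increasing)
qed

text \<open>This is (S - 1)\<alpha> moved one index forward, so that windows looking backwards
  capture it. The truncated subtraction makes it 0 at index 0.\<close>

definition backward_difference :: "(nat \<Rightarrow> complex) \<Rightarrow> nat \<Rightarrow> complex" where
  "backward_difference \<alpha> k = \<alpha> k - \<alpha> (k - 1)"

lemma norm_diff_le_window:
  assumes "a \<le> W"
  shows "norm (\<alpha> (k - a) - \<alpha> k) \<le> window (backward_difference \<alpha>) W k"
proof -
  have "norm (\<alpha> (k - a) - \<alpha> k) \<le> (\<Sum>i<a. norm (backward_difference \<alpha> (k - i)))"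
  proof (induction a)
    case (Suc a)
    have "norm (\<alpha> (k - Suc a) - \<alpha> k)
        \<le> norm (\<alpha> (k - a) - \<alpha> k) + norm (backward_difference \<alpha> (k - a))"
      using norm_triangle_ineq4[of "\<alpha> (k - a) - \<alpha> k" "backward_difference \<alpha> (k - a)"]
      by (simp add: backward_difference_def)
    then show ?case using Suc by simp
  qed simp
  also have "\<dots> \<le> window (backward_difference \<alpha>) W k"
    unfolding window_def using assms by (intro sum_mono2) auto
  finally show ?thesis .
qed

lemma norm_le_window: "a \<le> W \<Longrightarrow> norm (\<alpha> (k - a)) \<le> window \<alpha> W k"
  unfolding window_def using member_le_sum[of a "{..W}" "\<lambda>i. norm (\<alpha> (k - i))"] by simp

lemma summable_window_power:
  assumes "summable (\<lambda>k. norm (\<alpha> k) ^ p)"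
  shows "summable (\<lambda>k. window \<alpha> W k ^ p)"
proof -
  have "of_order \<alpha> p (\<lambda>k. of_real (window \<alpha> W k ^ p))"
    unfolding of_order_def by (rule exI[of _ 1]) (auto simp: norm_power window_nonneg intro!: exI[of _ W])
  from of_order_summable[OF this assms] show ?thesis by (simp add: norm_power window_nonneg)
qed

text \<open>The shifts in a quartic monomial do not matter: it differs from the mean of the four
  shifted values of |\<alpha>|^4 by products of two differences, and each shifted value differs from
  |\<alpha>_k|^4 by a telescoping term. Later only the number of monomials has to be known.\<close>

lemma quartic_bounded_sums:
  assumes bd: "\<And>k. norm (\<alpha> k) \<le> 1"
    and s6: "summable (\<lambda>k. norm (\<alpha> k) ^ 6)"
    and s3: "summable (\<lambda>k. norm (backward_difference \<alpha> k) ^ 3)"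
  shows "bounded_sums (\<lambda>k. Re (\<alpha> (k - a) * \<alpha> (k - b) * cnj (\<alpha> (k - c)) * cnj (\<alpha> (k - d))) - norm (\<alpha> k) ^ 4)"
proof -
  define W where "W = a + b + c + d"
  define M where "M = window \<alpha> W"
  \<comment> \<open>The factor 2 arises because two shifted entries are compared through the entry
    at k.\<close>
  define D where "D = (\<lambda>k. 2 * window (backward_difference \<alpha>) W k)"
  define g where "g = (\<lambda>k. norm (\<alpha> k) ^ 4)"
  define e where "e = (\<lambda>k. Re (\<alpha> (k - a) * \<alpha> (k - b) * cnj (\<alpha> (k - c)) * cnj (\<alpha> (k - d)))
      - (g (k - a) + g (k - b) + g (k - c) + g (k - d)) / 4)"
  have M0: "M k \<ge> 0" and D0: "D k \<ge> 0" for k by (auto simp: M_def D_def window_nonneg)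
  have diff: "norm (\<alpha> (k - i) - \<alpha> (k - j)) \<le> D k" if "i \<le> W" "j \<le> W" for i j k
    using norm_diff_le_window[OF that(1), of \<alpha> k] norm_diff_le_window[OF that(2), of \<alpha> k]
      norm_triangle_ineq4[of "\<alpha> (k - i) - \<alpha> k" "\<alpha> (k - j) - \<alpha> k"]
    by (simp add: D_def)
  have le: "norm (\<bar>e k\<bar>) \<le> 4 * (M k ^ 6 + D k ^ 3)" for k
  proof -
    have "\<bar>e k\<bar> \<le> 4 * (M k ^ 2 * D k ^ 2)"
      unfolding e_def g_def
      by (rule Re_quartic_bound) (auto simp: M_def W_def intro!: norm_le_window diff)
    also have "\<dots> \<le> 4 * (M k ^ 6 + D k ^ 3)" by (intro mult_left_mono mult_squares_le M0 D0) auto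
    finally show ?thesis by simp
  qed
  have "summable (\<lambda>k. 4 * (M k ^ 6 + D k ^ 3))"
    unfolding M_def D_def power_mult_distrib
    by (intro summable_mult summable_add summable_window_power s6 s3)
  then have "summable (\<lambda>k. \<bar>e k\<bar>)" by (rule summable_comparison_test') (rule le)
  then have e: "bounded_sums e" by (rule bounded_sums_summable)
  have t: "bounded_sums (\<lambda>k. g (k - i) - g k)" for i
    by (rule bounded_sums_telescope[of _ 1]) (use bd in \<open>simp add: g_def power_le_one\<close>)
  have "bounded_sums (\<lambda>k. e k + 1/4 * (((g (k - a) - g k) + (g (k - b) - g k))
      + ((g (k - c) - g k) + (g (k - d) - g k))))"
    by (intro bounded_sums_add bounded_sums_cmult e t)
  then show ?thesis
    by (rule bounded_sums_eventually_cong[of _ 0]) (simp add: e_def g_def field_simps)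
qed

section \<open>Expansion of the coefficients of a logarithm of orthogonal polynomials\<close>

text \<open>The numbers \<open>\<beta> k j\<close> are the Taylor coefficients of \<open>b\<^sub>k = \<Phi>\<^sub>k / \<Phi>\<^sub>k\<^sup>*\<close> and the numbers \<open>F k j\<close>
  are those of \<open>log (1 - \<alpha>\<^sub>k z b\<^sub>k(z))\<close>.\<close>

locale log_coefficients =
  fixes \<alpha> :: "nat \<Rightarrow> complex" and \<beta> F :: "nat \<Rightarrow> nat \<Rightarrow> complex"
  assumes bd: "\<And>k. norm (\<alpha> k) \<le> 1"
    and \<beta>_0: "\<And>k. \<beta> (Suc k) 0 = - cnj (\<alpha> k)"
    and \<beta>_Suc: "\<And>k j. \<beta> (Suc k) (Suc j) = \<beta> k j + \<alpha> k * (\<Sum>i\<le>j. \<beta> k i * \<beta> (Suc k) (j - i))"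
    and F_Suc: "\<And>k j. of_nat (Suc j) * F k (Suc j) = - (of_nat (Suc j) * (\<alpha> k * \<beta> k j))
      + (\<Sum>i<j. of_nat (Suc i) * F k (Suc i) * (\<alpha> k * \<beta> k (j - Suc i)))"
begin

text \<open>\<open>L j\<close> and \<open>R j\<close> are the linear and the cubic part of \<open>\<beta> k j\<close> as a function of \<open>\<alpha>\<close> and its
  conjugate.\<close>

definition L :: "nat \<Rightarrow> nat \<Rightarrow> complex" where
  "L j k = - cnj (\<alpha> (k - 1 - j))"

primrec R :: "nat \<Rightarrow> nat \<Rightarrow> complex" where
  "R 0 k = 0"
| "R (Suc j) k = R j (k - 1) + \<alpha> (k - 1) * (\<Sum>i\<le>j. L i (k - 1) * L (j - i) k)"

lemma L_Suc: "L (Suc j) k = L j (k - 1)"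
  by (simp add: L_def)

lemma \<beta>_Suc': "k \<ge> 1 \<Longrightarrow>
    \<beta> k (Suc j) = \<beta> (k - 1) j + \<alpha> (k - 1) * (\<Sum>i\<le>j. \<beta> (k - 1) i * \<beta> k (j - i))"
  using \<beta>_Suc[of "k - 1" j] by simp

lemma \<alpha>_order: "of_order \<alpha> 1 (\<lambda>k. \<alpha> (k - s))" "of_order \<alpha> 1 \<alpha>"
  using of_order_self[of \<alpha> s] of_order_self[of \<alpha> 0] by simp_all

lemma L_order: "of_order \<alpha> 1 (L j)"
  unfolding L_def diff_diff_left by (intro of_order_uminus of_order_cnj \<alpha>_order)

lemma weaken: "of_order \<alpha> p f \<Longrightarrow> q \<le> p \<Longrightarrow> of_order \<alpha> q f"
  by (rule of_order_weaken) (auto intro: bd)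

text \<open>The recursion for index j + 1 involves coefficients of all smaller indices, at k - 1 and
  at k alike, hence the strong induction on the coefficient index.\<close>

lemma \<beta>_order1: "of_order \<alpha> 1 (\<lambda>k. \<beta> k j)"
proof (induction j rule: less_induct)
  case (less j)
  show ?case
  proof (cases j)
    case 0
    have "- cnj (\<alpha> (k - 1)) = \<beta> k j" if "k \<ge> 1" for k using \<beta>_0[of "k - 1"] that 0 by simp
    then show ?thesis
      by (rule of_order_eventually_cong[OF of_order_uminus[OF of_order_cnj[OF \<alpha>_order(1)[of 1]]], of 1])
  next
    case (Suc m)
    have "of_order \<alpha> (1 + (1 + 1)) (\<lambda>k. \<alpha> (k - 1) * (\<Sum>i\<le>m. \<beta> (k - 1) i * \<beta> k (m - i)))"
      using Suc by (intro of_order_mult of_order_sum \<alpha>_order less of_order_shift[of _ _ "\<lambda>k. \<beta> k _"]) auto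
    then have "of_order \<alpha> 1 (\<lambda>k. \<beta> (k - 1) m + \<alpha> (k - 1) * (\<Sum>i\<le>m. \<beta> (k - 1) i * \<beta> k (m - i)))"
      using Suc by (intro of_order_add of_order_shift[of _ _ "\<lambda>k. \<beta> k m"] less) (simp, erule weaken, simp)
    then show ?thesis
      unfolding Suc by (rule of_order_eventually_cong[of _ _ _ 1]) (rule \<beta>_Suc'[symmetric])
  qed
qed

text \<open>The nonlinear term of the recursion has three small factors, so dropping it costs order
  3; what remains is a pure shift, and that is the recursion of \<open>L\<close>.\<close>

lemma \<beta>_order3: "of_order \<alpha> 3 (\<lambda>k. \<beta> k j - L j k)"
proof (induction j)
  case 0
  have "0 = \<beta> k 0 - L 0 k" if "k \<ge> 1" for k using \<beta>_0[of "k - 1"] that by (simp add: L_def)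
  then show ?case by (rule of_order_eventually_cong[OF of_order_0])
next
  case (Suc j)
  have "of_order \<alpha> (1 + (1 + 1)) (\<lambda>k. \<alpha> (k - 1) * (\<Sum>i\<le>j. \<beta> (k - 1) i * \<beta> k (j - i)))"
    by (intro of_order_mult of_order_sum \<alpha>_order \<beta>_order1 of_order_shift[of _ _ "\<lambda>k. \<beta> k _"])
  then have "of_order \<alpha> 3 (\<lambda>k. (\<beta> (k - 1) j - L j (k - 1))
      + \<alpha> (k - 1) * (\<Sum>i\<le>j. \<beta> (k - 1) i * \<beta> k (j - i)))"
    by (intro of_order_add of_order_shift[of _ _ "\<lambda>k. \<beta> k j - L j k"] Suc) (simp add: numeral_3_eq_3)
  then show ?case
    by (rule of_order_eventually_cong[of _ _ _ 1]) (simp add: \<beta>_Suc' L_Suc)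
qed

lemma \<beta>_product_order:
  "of_order \<alpha> 4 (\<lambda>k. \<beta> (k - s) i * \<beta> k j - L i (k - s) * L j k)"
proof -
  have "of_order \<alpha> (3 + 1) (\<lambda>k. (\<beta> (k - s) i - L i (k - s)) * \<beta> k j)"
    by (intro of_order_mult \<beta>_order1 of_order_shift[of _ _ "\<lambda>k. \<beta> k i - L i k"] \<beta>_order3)
  moreover have "of_order \<alpha> (1 + 3) (\<lambda>k. L i (k - s) * (\<beta> k j - L j k))"
    by (intro of_order_mult \<beta>_order3 of_order_shift[of _ _ "L i"] L_order)
  ultimately have "of_order \<alpha> 4 (\<lambda>k. (\<beta> (k - s) i - L i (k - s)) * \<beta> k j
      + L i (k - s) * (\<beta> k j - L j k))"
    by (intro of_order_add) simp_all
  then show ?thesis by (rule of_order_eventually_cong[of _ _ _ 0]) (simp add: algebra_simps)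
qed

text \<open>In the nonlinear term both factors may be replaced by their linear parts at the cost of
  order 4; the prefactor \<alpha> raises this to 5. The cubic terms produced in this way are
  collected by \<open>R\<close>.\<close>

lemma \<beta>_order5: "of_order \<alpha> 5 (\<lambda>k. \<beta> k j - L j k - R j k)"
proof (induction j)
  case 0
  have "0 = \<beta> k 0 - L 0 k - R 0 k" if "k \<ge> 1" for k using \<beta>_0[of "k - 1"] that by (simp add: L_def)
  then show ?case by (rule of_order_eventually_cong[OF of_order_0])
next
  case (Suc j)
  have "of_order \<alpha> (1 + 4) (\<lambda>k. \<alpha> (k - 1) * (\<Sum>i\<le>j. \<beta> (k - 1) i * \<beta> k (j - i) - L i (k - 1) * L (j - i) k))"
    by (intro of_order_mult of_order_sum \<alpha>_order \<beta>_product_order)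
  then have "of_order \<alpha> 5 (\<lambda>k. (\<beta> (k - 1) j - L j (k - 1) - R j (k - 1))
      + \<alpha> (k - 1) * (\<Sum>i\<le>j. \<beta> (k - 1) i * \<beta> k (j - i) - L i (k - 1) * L (j - i) k))"
    by (intro of_order_add of_order_shift[of _ _ "\<lambda>k. \<beta> k j - L j k - R j k"] Suc) simp
  then show ?case
    by (rule of_order_eventually_cong[of _ _ _ 1])
      (simp add: \<beta>_Suc' L_Suc sum_subtractf algebra_simps)
qed

lemma F_Suc_eq: "F k (Suc j) = - (\<alpha> k * \<beta> k j)
    + (\<Sum>i<j. of_nat (Suc i) / of_nat (Suc j) * (F k (Suc i) * (\<alpha> k * \<beta> k (j - Suc i))))"
proof -
  have "F k (Suc j) = (of_nat (Suc j) * F k (Suc j)) / of_nat (Suc j)" by (simp del: of_nat_Suc)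
  also have "\<dots> = - (\<alpha> k * \<beta> k j)
      + (\<Sum>i<j. of_nat (Suc i) * F k (Suc i) * (\<alpha> k * \<beta> k (j - Suc i))) / of_nat (Suc j)"
    by (subst F_Suc) (simp add: diff_divide_distrib del: of_nat_Suc)
  finally show ?thesis by (simp add: sum_divide_distrib mult_ac del: of_nat_Suc)
qed

lemma u_order: "of_order \<alpha> 2 (\<lambda>k. \<alpha> k * \<beta> k j)"
  using of_order_mult[OF \<alpha>_order(2) \<beta>_order1[of j]] by (simp add: numeral_2_eq_2)

lemma F_order2: "of_order \<alpha> 2 (\<lambda>k. F k (Suc j))"
proof (induction j rule: less_induct)
  case (less j)
  have "of_order \<alpha> 2 (\<lambda>k. of_nat (Suc i) / of_nat (Suc j) * (F k (Suc i) * (\<alpha> k * \<beta> k (j - Suc i))))"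
    if "i < j" for i
    using weaken[OF of_order_mult[OF less[OF that] u_order], of 2] by (intro of_order_cmult) simp
  then show ?case
    unfolding F_Suc_eq[of _ j] by (intro of_order_add of_order_uminus u_order of_order_sum) simp
qed

lemma F_order4: "of_order \<alpha> 4 (\<lambda>k. F k (Suc j) + \<alpha> k * \<beta> k j)"
proof -
  have "of_order \<alpha> 4 (\<lambda>k. F k (Suc i) * (\<alpha> k * \<beta> k (j - Suc i)))" for i
    using of_order_mult[OF F_order2 u_order] by simp
  then have "of_order \<alpha> 4 (\<lambda>k. \<Sum>i<j. of_nat (Suc i) / of_nat (Suc j) * (F k (Suc i) * (\<alpha> k * \<beta> k (j - Suc i))))"
    by (intro of_order_sum of_order_cmult)
  then show ?thesis
    by (rule of_order_eventually_cong[of _ _ _ 0]) (subst F_Suc_eq, simp del: of_nat_Suc)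
qed

text \<open>This is log (1 - u) = -u - u^2/2 up to cubic terms, for u = \<alpha>_k z b_k of order 2.
  In u the coefficient of b_k is kept up to an error of order 5, in u^2 only linear parts are kept.
  The recursion produces the unsymmetrised weights (i+1)/(j+1) in place of 1/2.\<close>

lemma F_order6: "of_order \<alpha> 6 (\<lambda>k. F k (Suc j) + \<alpha> k * (L j k + R j k)
    + (\<Sum>i<j. of_nat (Suc i) / of_nat (Suc j) * (\<alpha> k * \<alpha> k * (L i k * L (j - Suc i) k))))"
proof -
  \<comment> \<open>Two replacements, each with an error of order 6: \<open>F\<close> by its leading
    term (4 + 2), and then the product of two \<beta> by the product of their linear parts (1 + 1 +
    4).\<close>
  have *: "of_order \<alpha> 6 (\<lambda>k. F k (Suc i) * (\<alpha> k * \<beta> k (j - Suc i)) + \<alpha> k * \<alpha> k * (L i k * L (j - Suc i) k))" for i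
  proof -
    have "of_order \<alpha> (4 + 2) (\<lambda>k. (F k (Suc i) + \<alpha> k * \<beta> k i) * (\<alpha> k * \<beta> k (j - Suc i)))"
      by (intro of_order_mult F_order4 u_order)
    moreover have "of_order \<alpha> (1 + 1 + 4) (\<lambda>k. \<alpha> k * \<alpha> k * (\<beta> k i * \<beta> k (j - Suc i) - L i k * L (j - Suc i) k))"
      using \<beta>_product_order[of 0 i "j - Suc i"] by (intro of_order_mult \<alpha>_order) simp
    ultimately have "of_order \<alpha> 6 (\<lambda>k. (F k (Suc i) + \<alpha> k * \<beta> k i) * (\<alpha> k * \<beta> k (j - Suc i))
        - \<alpha> k * \<alpha> k * (\<beta> k i * \<beta> k (j - Suc i) - L i k * L (j - Suc i) k))"
      by (intro of_order_diff) simp_all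
    then show ?thesis by (rule of_order_eventually_cong[of _ _ _ 0]) (simp add: algebra_simps)
  qed
  have "of_order \<alpha> (1 + 5) (\<lambda>k. \<alpha> k * (\<beta> k j - L j k - R j k))"
    by (intro of_order_mult \<alpha>_order \<beta>_order5)
  then have "of_order \<alpha> 6 (\<lambda>k. (\<Sum>i<j. of_nat (Suc i) / of_nat (Suc j) *
        (F k (Suc i) * (\<alpha> k * \<beta> k (j - Suc i)) + \<alpha> k * \<alpha> k * (L i k * L (j - Suc i) k)))
      - \<alpha> k * (\<beta> k j - L j k - R j k))"
    by (intro of_order_diff of_order_sum of_order_cmult *) simp
  then show ?thesis
  proof (rule of_order_eventually_cong[of _ _ _ 0])
    fix k
    show "(\<Sum>i<j. of_nat (Suc i) / of_nat (Suc j) *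
        (F k (Suc i) * (\<alpha> k * \<beta> k (j - Suc i)) + \<alpha> k * \<alpha> k * (L i k * L (j - Suc i) k)))
      - \<alpha> k * (\<beta> k j - L j k - R j k) = F k (Suc j) + \<alpha> k * (L j k + R j k)
    + (\<Sum>i<j. of_nat (Suc i) / of_nat (Suc j) * (\<alpha> k * \<alpha> k * (L i k * L (j - Suc i) k)))"
    proof -
      have "s + t - a * (b - l - r) = - (a * b) + s + a * (l + r) + t" for s t a b l r :: complex
        by (simp add: algebra_simps)
      then show ?thesis
        by (subst F_Suc_eq[of k j]) (simp only: distrib_left[of "of_nat _ / of_nat _"] sum.distrib)
    qed
  qed
qed

section \<open>Partial sums of the expanded coefficients\<close>

context
  assumes s6: "summable (\<lambda>k. norm (\<alpha> k) ^ 6)"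
    and s3: "summable (\<lambda>k. norm (backward_difference \<alpha> k) ^ 3)"
begin

text \<open>The two minus signs in \<open>L\<close> cancel, so the product is a monomial with two
  plain and two conjugated factors and counts with a positive sign.\<close>

lemma quartic_LL:
  "bounded_sums (\<lambda>k. Re (\<alpha> k * (\<alpha> (k - s) * (L i (k - t) * L j (k - r)))) - norm (\<alpha> k) ^ 4)"
  using quartic_bounded_sums[OF bd s6 s3, of 0 s "t + (1 + i)" "r + (1 + j)"]
  by (simp add: L_def diff_diff_left mult_ac)

text \<open>A count of monomials: each step of the recursion of \<open>R\<close> adds j + 1 of them,
  giving the triangular numbers. The shift s is kept arbitrary because the recursion evaluates the
  previous \<open>R\<close> one index earlier.\<close>

lemma quartic_R:
  "bounded_sums (\<lambda>k. Re (\<alpha> k * R j (k - s)) - real (j * (j + 1)) / 2 * norm (\<alpha> k) ^ 4)"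
proof (induction j arbitrary: s)
  case (Suc j)
  have t: "k - s - 1 = k - Suc s" for k by simp
  have "bounded_sums (\<lambda>k. (Re (\<alpha> k * R j (k - Suc s)) - real (j * (j + 1)) / 2 * norm (\<alpha> k) ^ 4)
      + (\<Sum>i\<le>j. Re (\<alpha> k * (\<alpha> (k - Suc s) * (L i (k - Suc s) * L (j - i) (k - s)))) - norm (\<alpha> k) ^ 4))"
    by (intro bounded_sums_add bounded_sums_sum quartic_LL Suc)
  then show ?case
    by (rule bounded_sums_eventually_cong[of _ 0])
      (simp only: R.simps t distrib_left sum_distrib_left sum_subtractf plus_complex.sel Re_sum,
       simp add: algebra_simps add_divide_distrib)
qed (simp add: bounded_sums_0)

text \<open>The weights of i and j - 1 - i add up to 1, so on average each is the coefficient 1/2 of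
  u^2 in the logarithm.\<close>

lemma sum_Suc_ratio: "(\<Sum>i<j. real (Suc i) / real (Suc j)) = real j / 2"
proof -
  have "(\<Sum>i<j. real (Suc i)) = real (Suc j) * real j / 2"
    by (induction j) (simp_all add: field_simps)
  then show ?thesis unfolding sum_divide_distrib[symmetric] by simp
qed

text \<open>With j = n - 1 the quartic count is j(j+1)/2 + j/2 = (n^2 - 1)/2. The quadratic term is
  Re (\<alpha>_k cnj \<alpha>_{k-n}), which polarisation turns into a mean of two squares minus half
  of the squared difference; shifting the index turns the mean into |\<alpha>_k|^2.\<close>

lemma F_bounded_sums:
  assumes n: "n \<ge> 1"
  shows "bounded_sums (\<lambda>k. Re (F k n) - norm (\<alpha> k) ^ 2
    + (norm (\<alpha> k - \<alpha> (k - n)) ^ 2 / 2 + (real n ^ 2 - 1) / 2 * norm (\<alpha> k) ^ 4))"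
proof -
  obtain j where j: "n = Suc j" using n by (cases n) auto
  define g where "g = (\<lambda>k. norm (\<alpha> k) ^ 2)"
  have 1: "bounded_sums (\<lambda>k. g (k - n) - g k)"
    by (rule bounded_sums_telescope[of _ 1]) (use bd in \<open>simp add: g_def power_le_one\<close>)
  have 2: "Re (\<alpha> k * L j k) = - (g k + g (k - n)) / 2 + norm (\<alpha> k - \<alpha> (k - n)) ^ 2 / 2" for k
    unfolding g_def j L_def cmod_power2 by (simp add: power2_eq_square field_simps)
  have 3: "bounded_sums (\<lambda>k. Re (F k (Suc j) + \<alpha> k * (L j k + R j k)
    + (\<Sum>i<j. of_nat (Suc i) / of_nat (Suc j) * (\<alpha> k * \<alpha> k * (L i k * L (j - Suc i) k)))))"
    by (rule of_order_bounded_sums[OF F_order6 s6])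
  have 4: "bounded_sums (\<lambda>k. Re (\<alpha> k * R j k) - real (j * (j + 1)) / 2 * norm (\<alpha> k) ^ 4)"
    using quartic_R[of j 0] by simp
  have 5: "bounded_sums (\<lambda>k. \<Sum>i<j. real (Suc i) / real (Suc j) *
      (Re (\<alpha> k * (\<alpha> k * (L i k * L (j - Suc i) k))) - norm (\<alpha> k) ^ 4))"
    using quartic_LL[of 0 _ 0 _ 0] by (intro bounded_sums_sum bounded_sums_cmult) simp
  have "bounded_sums (\<lambda>k. Re (F k (Suc j) + \<alpha> k * (L j k + R j k)
      + (\<Sum>i<j. of_nat (Suc i) / of_nat (Suc j) * (\<alpha> k * \<alpha> k * (L i k * L (j - Suc i) k))))
    - (Re (\<alpha> k * R j k) - real (j * (j + 1)) / 2 * norm (\<alpha> k) ^ 4)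
    - (\<Sum>i<j. real (Suc i) / real (Suc j) *
      (Re (\<alpha> k * (\<alpha> k * (L i k * L (j - Suc i) k))) - norm (\<alpha> k) ^ 4))
    + 1 / 2 * (g (k - n) - g k))"
    by (rule bounded_sums_add[OF bounded_sums_diff[OF bounded_sums_diff[OF 3 4] 5] bounded_sums_cmult[OF 1]])
  then show ?thesis
  proof (rule bounded_sums_eventually_cong[of _ 0])
    fix k
    define T where "T = (\<Sum>i<j. real (Suc i) / real (Suc j) * Re (\<alpha> k * (\<alpha> k * (L i k * L (j - Suc i) k))))"
    have scale: "Re (of_nat a / of_nat b * z) = real a / real b * Re z" for a b z
    proof -
      have "of_nat a / of_nat b = complex_of_real (real a / real b)" by simp
      then show ?thesis by (simp only: Re_complex_of_real times_complex.sel Im_complex_of_real)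
    qed
    have "Re (\<Sum>i<j. of_nat (Suc i) / of_nat (Suc j) * (\<alpha> k * \<alpha> k * (L i k * L (j - Suc i) k))) = T"
      unfolding T_def Re_sum scale by (simp only: mult.assoc)
    moreover have "(\<Sum>i<j. real (Suc i) / real (Suc j) *
      (Re (\<alpha> k * (\<alpha> k * (L i k * L (j - Suc i) k))) - norm (\<alpha> k) ^ 4)) = T - real j / 2 * norm (\<alpha> k) ^ 4"
      unfolding T_def right_diff_distrib sum_subtractf sum_distrib_right[symmetric] sum_Suc_ratio ..
    ultimately show "Re (F k (Suc j) + \<alpha> k * (L j k + R j k)
      + (\<Sum>i<j. of_nat (Suc i) / of_nat (Suc j) * (\<alpha> k * \<alpha> k * (L i k * L (j - Suc i) k))))
    - (Re (\<alpha> k * R j k) - real (j * (j + 1)) / 2 * norm (\<alpha> k) ^ 4)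
    - (\<Sum>i<j. real (Suc i) / real (Suc j) *
      (Re (\<alpha> k * (\<alpha> k * (L i k * L (j - Suc i) k))) - norm (\<alpha> k) ^ 4))
    + 1 / 2 * (g (k - n) - g k) = Re (F k n) - norm (\<alpha> k) ^ 2
    + (norm (\<alpha> k - \<alpha> (k - n)) ^ 2 / 2 + (real n ^ 2 - 1) / 2 * norm (\<alpha> k) ^ 4)"
      unfolding distrib_left plus_complex.sel 2
      by (simp add: g_def j field_simps power2_eq_square)
  qed
qed

end

end

section \<open>From bounded entropies to the two summability conditions\<close>

lemma ln_one_minus_cubic_bound:
  fixes x :: real
  assumes "0 \<le> x" "x \<le> 1/2"
  shows "\<bar>ln (1 - x) + x + x\<^sup>2 / 2\<bar> \<le> x ^ 3"
proof -
  define f where "f = (\<lambda>x::real. ln (1 - x) + x + x\<^sup>2 / 2)"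
  have der: "(f has_real_derivative (- 1 / (1 - y) + 1 + y)) (at y)" if "0 \<le> y" "y \<le> x" for y
    unfolding f_def using that assms
    by (auto intro!: derivative_eq_intros simp: field_simps)
  \<comment> \<open>Two monotonicity arguments starting from f 0 = 0: f decreases, while f + x^3
    increases because 2 - 3y is positive on [0, 1/2].\<close>
  have "f x \<le> f 0"
  proof (rule DERIV_nonpos_imp_nonincreasing[OF assms(1)])
    fix y assume y: "0 \<le> y" "y \<le> x"
    have "- 1 / (1 - y) + 1 + y = - y\<^sup>2 / (1 - y)"
      using y assms by (simp add: field_simps power2_eq_square)
    also have "\<dots> \<le> 0" using y assms by (intro divide_nonpos_nonneg) auto
    finally show "\<exists>z. (f has_real_derivative z) (at y) \<and> z \<le> 0" using der[OF y] by blast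
  qed
  moreover have "f 0 + 0 ^ 3 \<le> f x + x ^ 3"
  proof (rule DERIV_nonneg_imp_nondecreasing[OF assms(1)])
    fix y assume y: "0 \<le> y" "y \<le> x"
    have "- 1 / (1 - y) + 1 + y + 3 * y\<^sup>2 = y\<^sup>2 * (2 - 3 * y) / (1 - y)"
      using y assms by (simp add: field_simps power2_eq_square)
    also have "\<dots> \<ge> 0" using y assms by (intro divide_nonneg_nonneg mult_nonneg_nonneg) auto
    finally have "- 1 / (1 - y) + 1 + y + 3 * y\<^sup>2 \<ge> 0" .
    moreover have "((\<lambda>x. f x + x ^ 3) has_real_derivative (- 1 / (1 - y) + 1 + y + 3 * y\<^sup>2)) (at y)"
      by (rule derivative_eq_intros der[OF y] refl)+ simp
    ultimately show "\<exists>z. ((\<lambda>x. f x + x ^ 3) has_real_derivative z) (at y) \<and> z \<ge> 0" by blast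
  qed
  ultimately show ?thesis by (simp add: f_def)
qed

lemma ln_bounded_sums:
  assumes "summable (\<lambda>k. norm (\<alpha> k :: complex) ^ 6)"
  shows "bounded_sums (\<lambda>k. ln (1 - norm (\<alpha> k) ^ 2) + norm (\<alpha> k) ^ 2 + norm (\<alpha> k) ^ 4 / 2)"
proof -
  have "(\<lambda>k. norm (\<alpha> k) ^ 6) \<longlonglongrightarrow> 0" using assms by (rule summable_LIMSEQ_zero)
  \<comment> \<open>The threshold 1/8 = (1/2)^3 ensures |\<alpha>_k|^2 \<le> 1/2, the range of the
    cubic bound for the logarithm, whose remainder is then |\<alpha>_k|^6.\<close>
  then have "eventually (\<lambda>k. norm (\<alpha> k) ^ 6 < 1/8) sequentially" by (rule order_tendstoD) simp
  then obtain K where K: "\<And>k. k \<ge> K \<Longrightarrow> norm (\<alpha> k) ^ 6 < 1/8" by (auto simp: eventually_sequentially)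
  have "\<bar>\<bar>ln (1 - norm (\<alpha> k) ^ 2) + norm (\<alpha> k) ^ 2 + norm (\<alpha> k) ^ 4 / 2\<bar>\<bar> \<le> norm (\<alpha> k) ^ 6" if "k \<ge> K" for k
  proof -
    have "(norm (\<alpha> k) ^ 2) ^ 3 < (1/2) ^ 3" using K[OF that] by (simp flip: power_mult add: power3_eq_cube)
    then have "norm (\<alpha> k) ^ 2 \<le> 1/2" by (meson less_imp_le not_le power_mono zero_le_power2 norm_ge_zero not_less zero_le_divide_1_iff zero_le_numeral)
    from ln_one_minus_cubic_bound[OF _ this] show ?thesis by (simp flip: power_mult)
  qed
  then have "summable (\<lambda>k. \<bar>ln (1 - norm (\<alpha> k) ^ 2) + norm (\<alpha> k) ^ 2 + norm (\<alpha> k) ^ 4 / 2\<bar>)"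
    by (intro summable_comparison_test'[OF assms]) simp
  then show ?thesis by (rule bounded_sums_summable)
qed

text \<open>The quartic coefficients add up to (n^2 - 1)/2 + 1/2 = n^2/2 and the terms
  |\<alpha>_k|^2 cancel, so Z plus the partial sums of a nonnegative q stays bounded. Thus Z is
  bounded below exactly if q is summable, and both summands of q are nonnegative; n \<ge> 1 lets the
  quartic one control |\<alpha>_k|^4.\<close>

lemma (in log_coefficients) partial_sums_bounded_below_iff:
  assumes n: "n \<ge> 1"
    and s6: "\<alpha> \<in> ell 6" and s3: "(\<lambda>k. left_shift \<alpha> k - \<alpha> k) \<in> ell 3"
    and Z_def: "\<And>N. Z N = (\<Sum>k<N. ln (1 - norm (\<alpha> k) ^ 2) + Re (F k n))"
  shows "\<alpha> \<in> ell 4 \<Longrightarrow> (\<lambda>k. (left_shift ^^ n) \<alpha> k - \<alpha> k) \<in> ell 2 \<Longrightarrow> \<exists>C. \<forall>N. Z N \<ge> - C"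
    and "(\<And>N. Z N \<ge> - C) \<Longrightarrow> \<alpha> \<in> ell 4 \<and> (\<lambda>k. (left_shift ^^ n) \<alpha> k - \<alpha> k) \<in> ell 2"
proof -
  have sum6: "summable (\<lambda>k. norm (\<alpha> k) ^ 6)" using s6 by (simp add: ell_def)
  have sum3: "summable (\<lambda>k. norm (backward_difference \<alpha> k) ^ 3)"
    using s3 by (subst summable_Suc_iff[symmetric]) (simp add: ell_def left_shift_def backward_difference_def)
  have shift: "(left_shift ^^ n) \<alpha> k = \<alpha> (k + n)" for k
    by (induction n arbitrary: k) (simp_all add: left_shift_def)
  have sum2: "(\<lambda>k. (left_shift ^^ n) \<alpha> k - \<alpha> k) \<in> ell 2 \<longleftrightarrow> summable (\<lambda>k. norm (\<alpha> k - \<alpha> (k - n)) ^ 2)"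
    using summable_iff_shift[of "\<lambda>k. norm (\<alpha> k - \<alpha> (k - n)) ^ 2" n] by (simp add: ell_def shift)
  define q where "q = (\<lambda>k. norm (\<alpha> k - \<alpha> (k - n)) ^ 2 / 2 + real n ^ 2 / 2 * norm (\<alpha> k) ^ 4)"
  have "bounded_sums (\<lambda>k. (ln (1 - norm (\<alpha> k) ^ 2) + norm (\<alpha> k) ^ 2 + norm (\<alpha> k) ^ 4 / 2)
    + (Re (F k n) - norm (\<alpha> k) ^ 2
    + (norm (\<alpha> k - \<alpha> (k - n)) ^ 2 / 2 + (real n ^ 2 - 1) / 2 * norm (\<alpha> k) ^ 4)))"
    by (intro bounded_sums_add ln_bounded_sums F_bounded_sums sum6 sum3 n)
  then have "bounded_sums (\<lambda>k. (ln (1 - norm (\<alpha> k) ^ 2) + Re (F k n)) + q k)"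
    by (rule bounded_sums_eventually_cong[of _ 0]) (simp add: q_def field_simps)
  then obtain B where "\<And>N. \<bar>\<Sum>k<N. (ln (1 - norm (\<alpha> k) ^ 2) + Re (F k n)) + q k\<bar> \<le> B"
    unfolding bounded_sums_def by blast
  then have B: "\<bar>Z N + (\<Sum>k<N. q k)\<bar> \<le> B" for N unfolding Z_def sum.distrib .
  have q0: "q k \<ge> 0" for k by (simp add: q_def)
  show "\<exists>C. \<forall>N. Z N \<ge> - C" if "\<alpha> \<in> ell 4" "(\<lambda>k. (left_shift ^^ n) \<alpha> k - \<alpha> k) \<in> ell 2"
  proof -
    have "summable (\<lambda>k. norm (\<alpha> k) ^ 4)" "summable (\<lambda>k. norm (\<alpha> k - \<alpha> (k - n)) ^ 2)"
      using that sum2 by (simp_all add: ell_def)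
    from summable_add[OF summable_divide[OF this(2), of 2] summable_mult[OF this(1), of "real n ^ 2 / 2"]]
    have "summable q" by (simp add: q_def)
    then have le: "(\<Sum>k<N. q k) \<le> suminf q" for N using q0 by (intro sum_le_suminf) auto
    have "Z N \<ge> - (B + suminf q)" for N using B[of N] le[of N] by (simp add: abs_le_iff)
    then show ?thesis by blast
  qed
  show "\<alpha> \<in> ell 4 \<and> (\<lambda>k. (left_shift ^^ n) \<alpha> k - \<alpha> k) \<in> ell 2" if "\<And>N. Z N \<ge> - C"
  proof -
    have le: "(\<Sum>k<N. norm (q k)) \<le> B + C" for N using B[of N] that[of N] q0 by (simp add: abs_le_iff)
    have "summable (\<lambda>k. norm (q k))"
      by (rule bounded_imp_summable[of _ "B + C"]) (simp, metis le lessThan_Suc_atMost)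
    then have sq: "summable q" by (rule summable_norm_cancel)
    have "summable (\<lambda>k. norm (\<alpha> k) ^ 4)"
    proof (rule summable_comparison_test'[OF summable_mult[OF sq, of 2]])
      fix k
      have "1 * norm (\<alpha> k) ^ 4 \<le> real n ^ 2 * norm (\<alpha> k) ^ 4"
        using n by (intro mult_right_mono) simp_all
      then show "norm (norm (\<alpha> k) ^ 4) \<le> 2 * q k"
        by (simp add: q_def add_increasing)
    qed
    moreover have "summable (\<lambda>k. norm (\<alpha> k - \<alpha> (k - n)) ^ 2)"
      by (rule summable_comparison_test'[OF summable_mult[OF sq, of 2], of 0]) (simp add: q_def)
    ultimately show ?thesis using sum2 by (simp add: ell_def)
  qed
qed

section \<open>Integration over the circle\<close>

lemma angle_measure_eq_density:
  "angle_measure = density lborel (\<lambda>x. ennreal (indicator {0..2*pi} x / (2 * pi)))"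
  unfolding angle_measure_def uniform_measure_def
proof (rule arg_cong[of _ _ "density lborel"], rule ext)
  fix x :: real
  show "indicator {0..2*pi} x / emeasure lborel {0..2*pi} = ennreal (indicator {0..2*pi} x / (2 * pi))"
    by (auto simp: indicator_def divide_ennreal ennreal_1[symmetric] simp del: ennreal_1)
qed

lemma sets_angle_measure [measurable_cong, simp]: "sets angle_measure = sets borel"
  by (simp add: angle_measure_def)

lemma space_angle_measure [simp]: "space angle_measure = UNIV"
  by (simp add: angle_measure_def)

lemma prob_space_angle_measure: "prob_space angle_measure"
  unfolding angle_measure_def by (rule prob_space_uniform_measure) auto

interpretation angle: prob_space angle_measure
  by (rule prob_space_angle_measure)

lemma AE_angle_measure_range: "AE t in angle_measure. t \<in> {0..2*pi}"
  unfolding angle_measure_def by (rule AE_uniform_measureI) auto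

lemma integrable_angle_measure:
  fixes f :: "real \<Rightarrow> 'a::{banach,second_countable_topology}"
  assumes f: "continuous_on UNIV f"
  shows "integrable angle_measure f"
proof -
  have "compact (f ` {0..2*pi})"
    using f by (intro compact_continuous_image) (auto intro: continuous_on_subset)
  then obtain B where B: "\<And>t. t \<in> {0..2*pi} \<Longrightarrow> norm (f t) \<le> B"
    by (meson bounded_iff compact_imp_bounded imageI)
  have "f \<in> borel_measurable angle_measure"
    using borel_measurable_continuous_onI[OF f] by (simp cong: measurable_cong_sets)
  moreover have "AE t in angle_measure. norm (f t) \<le> B"
    using AE_angle_measure_range by eventually_elim (rule B)
  ultimately show ?thesis by (rule angle.integrable_const_bound[rotated])
qed

lemma integral_angle_measure:
  fixes f :: "real \<Rightarrow> 'a::euclidean_space"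
  assumes f: "continuous_on UNIV f" and I: "(f has_integral I) {0..2*pi}"
  shows "(\<integral>t. f t \<partial>angle_measure) = I /\<^sub>R (2 * pi)"
proof -
  have m: "f \<in> borel_measurable borel" using borel_measurable_continuous_onI[OF f] .
  have "(\<integral>t. f t \<partial>angle_measure) = (\<integral>t. (indicator {0..2*pi} t / (2 * pi)) *\<^sub>R f t \<partial>lborel)"
    unfolding angle_measure_eq_density using m by (subst integral_density) auto
  also have "\<dots> = (\<integral>t. (1 / (2 * pi)) *\<^sub>R (indicator {0..2*pi} t *\<^sub>R f t) \<partial>lborel)" by simp
  also have "\<dots> = (1 / (2 * pi)) *\<^sub>R (LINT t:{0..2*pi}|lborel. f t)"
    unfolding set_lebesgue_integral_def by (rule integral_scaleR_right)
  also have "(LINT t:{0..2*pi}|lborel. f t) = integral {0..2*pi} f"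
    using f by (intro set_borel_integral_eq_integral borel_integrable_atLeastAtMost')
      (auto intro: continuous_on_subset)
  also have "integral {0..2*pi} f = I" using I by (rule integral_unique)
  finally show ?thesis by (simp only: inverse_eq_divide)
qed

section \<open>Fourier coefficients of boundary values of holomorphic functions\<close>

lemma continuous_on_cis_compose:
  assumes "continuous_on (sphere 0 1) f"
  shows "continuous_on UNIV (\<lambda>t. f (cis t))"
  by (rule continuous_on_compose2[OF assms]) (auto intro!: continuous_intros)

text \<open>Cauchy's formula for derivatives on the unit circle itself: continuity up to the
  boundary is enough, so no limit over smaller radii is taken.\<close>

lemma Fourier_coefficient_holomorphic:
  assumes f: "continuous_on (cball 0 1) f" "f holomorphic_on ball 0 1"
  shows "(\<integral>t. f (cis t) * cis (- real k * t) \<partial>angle_measure) = (deriv ^^ k) f 0 / fact k"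
proof -
  have c: "continuous_on UNIV (\<lambda>t. f (cis t))"
    using f(1) by (intro continuous_on_cis_compose) (auto intro: continuous_on_subset)
  have "((\<lambda>u. f u / (u - 0) ^ Suc k) has_contour_integral (2 * pi * \<i>) / fact k * (deriv ^^ k) f 0)
      (part_circlepath 0 1 0 (2 * pi))"
    using Cauchy_has_contour_integral_higher_derivative_circlepath[OF f, of 0 k]
    by (simp add: circlepath_def)
  then have "((\<lambda>t. f (cis t) / cis t ^ Suc k * \<i> * cis t) has_integral
      (2 * pi * \<i>) / fact k * (deriv ^^ k) f 0) {0..2*pi}"
    by (subst (asm) has_contour_integral_part_circlepath_iff) simp_all
  \<comment> \<open>The factor -\<i> removes the \<i> that comes from the derivative of the
    parametrisation.\<close>
  then have "((\<lambda>t. (f (cis t) / cis t ^ Suc k * \<i> * cis t) * (-\<i>)) has_integral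
      ((2 * pi * \<i>) / fact k * (deriv ^^ k) f 0) * (-\<i>)) {0..2*pi}"
    by (rule has_integral_mult_left)
  moreover have "(f (cis t) / cis t ^ Suc k * \<i> * cis t) * (-\<i>) = f (cis t) * cis (- real k * t)" for t
  proof -
    have "cis (- real k * t) = inverse (cis t ^ k)" unfolding Complex.DeMoivre cis_inverse by simp
    then show ?thesis by (simp add: field_simps)
  qed
  ultimately have "((\<lambda>t. f (cis t) * cis (- real k * t)) has_integral
      (2 * pi) * ((deriv ^^ k) f 0 / fact k)) {0..2*pi}"
    by (simp add: mult_ac)
  then show ?thesis
    by (subst integral_angle_measure) (auto intro!: continuous_intros c simp: scaleR_conv_of_real)
qed

corollary mean_value_holomorphic:
  assumes "continuous_on (cball 0 1) f" "f holomorphic_on ball 0 1"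
  shows "(\<integral>t. f (cis t) \<partial>angle_measure) = f 0"
  using Fourier_coefficient_holomorphic[OF assms, of 0] by simp

text \<open>The mean value property for f(z) z^k, which vanishes at 0.\<close>

corollary Fourier_coefficient_holomorphic_negative:
  assumes f: "continuous_on (cball 0 1) f" "f holomorphic_on ball 0 1" and "k \<ge> 1"
  shows "(\<integral>t. f (cis t) * cis (real k * t) \<partial>angle_measure) = 0"
proof -
  have "(\<integral>t. f (cis t) * cis t ^ k \<partial>angle_measure) = f 0 * 0 ^ k"
    using f by (intro mean_value_holomorphic continuous_intros holomorphic_intros)
  then show ?thesis unfolding Complex.DeMoivre using \<open>k \<ge> 1\<close> by (simp add: zero_power)
qed

text \<open>Only finiteness is required, since the Bernstein--Szego measures enter before their
  total mass is known to be 1. Inner products can then be computed alike for them and for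
  \<mu>.\<close>

locale circle_measure = finite_measure \<nu> for \<nu> :: "complex measure" +
  assumes sets_eq [measurable_cong, simp]: "sets \<nu> = sets borel"
    and AE_sphere: "AE z in \<nu>. z \<in> sphere 0 1"
begin

lemma integrable_continuous:
  fixes f :: "complex \<Rightarrow> 'a::{banach,second_countable_topology}"
  assumes f: "continuous_on UNIV f"
  shows "integrable \<nu> f"
proof -
  have "compact (f ` sphere 0 1)"
    using f by (intro compact_continuous_image) (auto intro: continuous_on_subset)
  then obtain B where B: "\<And>z. z \<in> sphere 0 1 \<Longrightarrow> norm (f z) \<le> B"
    by (meson bounded_iff compact_imp_bounded imageI)
  have "f \<in> borel_measurable \<nu>"
    using borel_measurable_continuous_onI[OF f] by (simp cong: measurable_cong_sets)
  moreover have "AE z in \<nu>. norm (f z) \<le> B"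
    using AE_sphere by eventually_elim (rule B)
  ultimately show ?thesis by (rule integrable_const_bound[rotated])
qed

lemma integral_cong_sphere:
  fixes f g :: "complex \<Rightarrow> 'a::{banach,second_countable_topology}"
  assumes "continuous_on UNIV f" "continuous_on UNIV g" "\<And>z. norm z = 1 \<Longrightarrow> f z = g z"
  shows "(\<integral>z. f z \<partial>\<nu>) = (\<integral>z. g z \<partial>\<nu>)"
proof (rule integral_cong_AE)
  show "f \<in> borel_measurable \<nu>" "g \<in> borel_measurable \<nu>"
    using assms by (simp_all add: borel_measurable_continuous_onI cong: measurable_cong_sets)
  show "AE z in \<nu>. f z = g z" using AE_sphere by eventually_elim (auto intro: assms)
qed

definition ip :: "complex poly \<Rightarrow> complex poly \<Rightarrow> complex" where
  "ip p q = (\<integral>z. cnj (poly p z) * poly q z \<partial>\<nu>)"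

lemma ip_add_right: "ip p (q + r) = ip p q + ip p r"
  unfolding ip_def poly_add distrib_left
  by (intro Bochner_Integration.integral_add integrable_continuous continuous_intros)

lemma ip_smult_right: "ip p (smult c q) = c * ip p q"
  unfolding ip_def poly_smult by (simp add: mult.left_commute)

lemma ip_diff_right: "ip p (q - r) = ip p q - ip p r"
  using ip_add_right[of p q "smult (-1) r"] ip_smult_right[of p "-1" r] by simp

lemma ip_commute: "ip q p = cnj (ip p q)"
  unfolding ip_def Bochner_Integration.integral_cnj[symmetric] by (simp add: mult.commute)

lemma ip_add_left: "ip (p + q) r = ip p r + ip q r"
  by (metis ip_commute ip_add_right complex_cnj_add)

lemma ip_smult_left: "ip (smult c p) q = cnj c * ip p q"
  by (metis ip_commute ip_smult_right complex_cnj_mult)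

text \<open>\<open>pCons 0\<close> is multiplication by z, which is isometric on the circle.\<close>

lemma ip_shift: "ip (pCons 0 p) (pCons 0 q) = ip p q"
proof -
  have "cnj z * z = 1" if "norm z = 1" for z :: complex
    using that complex_norm_square[of z] by (simp add: mult.commute)
  then have "cnj (poly (pCons 0 p) z) * poly (pCons 0 q) z = cnj (poly p z) * poly q z"
    if "norm z = 1" for z
    using that by (simp add: mult_ac)
  then show ?thesis unfolding ip_def by (intro integral_cong_sphere continuous_intros)
qed

lemma ip_sum_left: "ip (\<Sum>i\<in>A. f i) q = (\<Sum>i\<in>A. ip (f i) q)"
  by (induction A rule: infinite_finite_induct) (simp_all add: ip_add_left, simp_all add: ip_def)

lemma ip_lower_degree:
  assumes "\<And>j. j < k \<Longrightarrow> ip (monom 1 j) p = 0" "q = 0 \<or> degree q < k"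
  shows "ip q p = 0"
proof -
  have "q = (\<Sum>j\<le>degree q. smult (coeff q j) (monom 1 j))"
    by (subst poly_as_sum_of_monoms[symmetric]) (simp add: smult_monom)
  then have "ip q p = (\<Sum>j\<le>degree q. ip (smult (coeff q j) (monom 1 j)) p)"
    by (metis ip_sum_left)
  also have "\<dots> = 0"
    using assms by (intro sum.neutral) (auto simp: ip_smult_left)
  finally show ?thesis .
qed

end

section \<open>The Szego recursion\<close>

text \<open>The polynomial z^k cnj (p (1 / cnj z)), that is, p^* at level k. The level is a separate
  parameter so that the operation is defined for polynomials of any degree at most k.\<close>

definition reversed_poly :: "nat \<Rightarrow> complex poly \<Rightarrow> complex poly" where
  "reversed_poly k p = (\<Sum>j\<le>k. monom (cnj (coeff p (k - j))) j)"

lemma coeff_reversed_poly: "coeff (reversed_poly k p) j = (if j \<le> k then cnj (coeff p (k - j)) else 0)"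
  by (simp add: reversed_poly_def coeff_sum)

lemma degree_reversed_poly: "degree (reversed_poly k p) \<le> k"
  by (rule degree_le) (simp add: coeff_reversed_poly)

lemma poly_eq_sum:
  fixes p :: "'a::comm_semiring_1 poly"
  assumes "degree p \<le> k"
  shows "poly p z = (\<Sum>j\<le>k. coeff p j * z ^ j)"
  unfolding poly_altdef using assms
  by (intro sum.mono_neutral_left) (auto simp: coeff_eq_0)

lemma poly_reversed_poly:
  assumes "degree p \<le> k" "norm z = 1"
  shows "poly (reversed_poly k p) z = z ^ k * cnj (poly p z)"
proof -
  have z: "cnj z * z = 1" using assms(2) complex_norm_square[of z] by (simp add: mult.commute)
  have "z ^ k * cnj (poly p z) = (\<Sum>j\<le>k. cnj (coeff p j) * (cnj z ^ j * z ^ k))"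
    unfolding poly_eq_sum[OF assms(1)] by (simp add: sum_distrib_left mult_ac)
  also have "\<dots> = (\<Sum>j\<le>k. cnj (coeff p j) * z ^ (k - j))"
  proof (intro sum.cong refl)
    fix j assume "j \<in> {..k}"
    then have "z ^ k = z ^ j * z ^ (k - j)" by (simp flip: power_add)
    then have "cnj z ^ j * z ^ k = (cnj z * z) ^ j * z ^ (k - j)" by (simp add: power_mult_distrib)
    then show "cnj (coeff p j) * (cnj z ^ j * z ^ k) = cnj (coeff p j) * z ^ (k - j)"
      by (simp add: z)
  qed
  also have "\<dots> = (\<Sum>j\<le>k. cnj (coeff p (k - j)) * z ^ j)"
    by (rule sum.reindex_bij_witness[of _ "\<lambda>j. k - j" "\<lambda>j. k - j"]) auto
  also have "\<dots> = poly (reversed_poly k p) z"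
    by (simp add: reversed_poly_def poly_sum poly_monom)
  finally show ?thesis by simp
qed

lemma norm_poly_reversed_poly:
  "degree p \<le> k \<Longrightarrow> norm z = 1 \<Longrightarrow> norm (poly (reversed_poly k p) z) = norm (poly p z)"
  by (simp add: poly_reversed_poly norm_mult norm_power)

context circle_measure
begin

text \<open>Reversal exchanges z^j and z^(k-j). Consequently \<open>\<Phi>s k\<close> is orthogonal
  to z, ..., z^k, where \<open>\<Phi> k\<close> is orthogonal to 1, ..., z^(k-1).\<close>

lemma ip_monom_reversed_poly:
  assumes "degree p \<le> k" "j \<le> k"
  shows "ip (monom 1 j) (reversed_poly k p) = cnj (ip (monom 1 (k - j)) p)"
proof -
  have "ip (monom 1 j) (reversed_poly k p) = ip p (monom 1 (k - j))"
    unfolding ip_def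
  proof (intro integral_cong_sphere continuous_intros)
    fix z :: complex assume z: "norm z = 1"
    then have z1: "cnj z * z = 1" using complex_norm_square[of z] by (simp add: mult.commute)
    have "z ^ k = z ^ j * z ^ (k - j)" using assms by (simp flip: power_add)
    then have "cnj z ^ j * z ^ k = (cnj z * z) ^ j * z ^ (k - j)" by (simp add: power_mult_distrib)
    then have *: "cnj z ^ j * z ^ k = z ^ (k - j)" by (simp add: z1)
    have "cnj (poly (monom 1 j) z) * poly (reversed_poly k p) z = (cnj z ^ j * z ^ k) * cnj (poly p z)"
      using poly_reversed_poly[OF assms(1) z] by (simp add: poly_monom mult.assoc)
    then show "cnj (poly (monom 1 j) z) * poly (reversed_poly k p) z = cnj (poly p z) * poly (monom 1 (k - j)) z"
      by (simp only: * poly_monom) simp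
  qed
  then show ?thesis using ip_commute by metis
qed

lemma ip_reversed_poly_self:
  assumes "degree p \<le> k"
  shows "ip (reversed_poly k p) (reversed_poly k p) = ip p p"
  unfolding ip_def
proof (intro integral_cong_sphere continuous_intros)
  fix z :: complex assume z: "norm z = 1"
  have "cnj w * w = of_real (norm w ^ 2)" for w
    using complex_norm_square[of w] by (simp add: mult.commute)
  then show "cnj (poly (reversed_poly k p) z) * poly (reversed_poly k p) z = cnj (poly p z) * poly p z"
    using norm_poly_reversed_poly[OF assms z] by simp
qed

end

locale opuc =
  fixes \<mu> :: "complex measure"
  assumes mu: "nontrivial_circle_measure \<mu>"
begin

sublocale circle_measure \<mu>
proof -
  interpret prob_space \<mu> using mu by (simp add: nontrivial_circle_measure_def)
  show "circle_measure \<mu>"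
    by unfold_locales (use mu in \<open>auto simp: nontrivial_circle_measure_def\<close>)
qed

abbreviation \<Phi> :: "nat \<Rightarrow> complex poly" where
  "\<Phi> \<equiv> monic_orthogonal_poly \<mu>"

abbreviation \<Phi>s :: "nat \<Rightarrow> complex poly" where
  "\<Phi>s k \<equiv> reversed_poly k (\<Phi> k)"

abbreviation \<alpha> :: "nat \<Rightarrow> complex" where
  "\<alpha> \<equiv> verblunsky \<mu>"

lemma degree_\<Phi>: "degree (\<Phi> k) = k"
  and coeff_\<Phi>: "coeff (\<Phi> k) k = 1"
  and ip_monom_\<Phi>: "j < k \<Longrightarrow> ip (monom 1 j) (\<Phi> k) = 0"
  using is_monic_orthogonal_poly_monic_orthogonal_poly[OF mu, of k]
  by (auto simp: is_monic_orthogonal_poly_def ip_def poly_monom)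

lemma \<Phi>_0: "\<Phi> 0 = 1"
  using degree_\<Phi>[of 0] coeff_\<Phi>[of 0] by (metis coeff_pCons_0 one_pCons degree_eq_zeroE)

lemma \<Phi>_neq_0: "\<Phi> k \<noteq> 0"
  using coeff_\<Phi>[of k] by auto

lemma poly_\<Phi>_0: "poly (\<Phi> (Suc k)) 0 = - cnj (\<alpha> k)"
  by (simp add: verblunsky_def)

lemma poly_\<Phi>s_0: "poly (\<Phi>s k) 0 = 1"
  by (simp add: poly_0_coeff_0 coeff_reversed_poly coeff_\<Phi>)

text \<open>The defect r has degree at most k and vanishes at 0 by the choice of \<alpha>_k, so r =
  z q with q zero or of degree below k. All three polynomials in r are orthogonal to z, ..., z^k, so
  q is orthogonal to 1, ..., z^(k-1), hence to itself.\<close>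

lemma szego_recursion: "\<Phi> (Suc k) = pCons 0 (\<Phi> k) - smult (cnj (\<alpha> k)) (\<Phi>s k)"
proof -
  define r where "r = \<Phi> (Suc k) - pCons 0 (\<Phi> k) + smult (cnj (\<alpha> k)) (\<Phi>s k)"
  have cr: "coeff r j = 0" if "j > k" for j
  proof (cases "j = Suc k")
    case True
    then show ?thesis by (simp add: r_def coeff_reversed_poly coeff_\<Phi>)
  next
    case False
    then show ?thesis using that degree_\<Phi>
      by (auto simp: r_def coeff_reversed_poly coeff_pCons coeff_eq_0 split: nat.split)
  qed
  have r0: "coeff r 0 = 0"
    using poly_\<Phi>_0[of k] by (simp add: r_def coeff_reversed_poly coeff_\<Phi> poly_0_coeff_0)
  obtain q where q: "r = pCons 0 q" using r0 by (cases r) auto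
  have "q = 0 \<or> degree q < k"
  proof (rule disjCI)
    assume "\<not> degree q < k"
    then have "lead_coeff q = 0" using cr[of "Suc (degree q)"] by (simp add: q)
    then show "q = 0" by simp
  qed
  moreover have "ip (monom 1 j) q = 0" if "j < k" for j
  proof -
    have "ip (monom 1 j) q = ip (monom 1 (Suc j)) r"
      unfolding q monom_Suc by (simp add: ip_shift)
    also have "\<dots> = ip (monom 1 (Suc j)) (\<Phi> (Suc k)) - ip (monom 1 (Suc j)) (pCons 0 (\<Phi> k))
        + cnj (\<alpha> k) * ip (monom 1 (Suc j)) (\<Phi>s k)"
      by (simp add: r_def ip_add_right ip_diff_right ip_smult_right)
    also have "ip (monom 1 (Suc j)) (pCons 0 (\<Phi> k)) = 0"
      unfolding monom_Suc using that by (simp add: ip_shift ip_monom_\<Phi>)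
    also have "ip (monom 1 (Suc j)) (\<Phi>s k) = 0"
      using that by (simp add: ip_monom_reversed_poly degree_\<Phi> ip_monom_\<Phi>)
    finally show ?thesis using that by (simp add: ip_monom_\<Phi>)
  qed
  ultimately have "ip q q = 0" by (rule ip_lower_degree[rotated])
  then have "q = 0" using poly_eq_0_of_L2_norm_eq_0[OF mu] by (simp add: ip_def)
  then show ?thesis using q by (simp add: r_def algebra_simps)
qed

lemma szego_recursion_reversed: "\<Phi>s (Suc k) = \<Phi>s k - smult (\<alpha> k) (pCons 0 (\<Phi> k))"
proof (rule poly_eqI)
  fix j
  show "coeff (\<Phi>s (Suc k)) j = coeff (\<Phi>s k - smult (\<alpha> k) (pCons 0 (\<Phi> k))) j"
  proof (cases j)
    case 0
    then show ?thesis by (simp add: coeff_reversed_poly coeff_\<Phi>)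
  next
    case (Suc i)
    show ?thesis
    proof (cases "i \<le> k")
      case True
      then have "coeff (\<Phi>s (Suc k)) j = cnj (coeff (pCons 0 (\<Phi> k)) (k - i)) - \<alpha> k * coeff (\<Phi> k) i"
        using Suc by (simp add: coeff_reversed_poly szego_recursion)
      also have "cnj (coeff (pCons 0 (\<Phi> k)) (k - i)) = coeff (\<Phi>s k) j"
        using Suc True by (cases "k - i") (auto simp: coeff_reversed_poly coeff_pCons intro!: arg_cong[of _ _ "coeff (\<Phi> k)"])
      finally show ?thesis using Suc by simp
    next
      case False
      then show ?thesis using Suc by (simp add: coeff_reversed_poly coeff_eq_0 degree_\<Phi>)
    qed
  qed
qed

text \<open>Pythagoras for z \<Phi>_k = \<Phi>_{k+1} + cnj \<alpha>_k \<Phi>_k^*. It holds for every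
  measure making \<Phi>_{k+1} orthogonal to lower powers, and is needed for \<mu> as well as for its
  approximations.\<close>

lemma ip_\<Phi>_Suc:
  assumes "circle_measure \<nu>"
    and orth: "\<And>j. j < Suc k \<Longrightarrow> circle_measure.ip \<nu> (monom 1 j) (\<Phi> (Suc k)) = 0"
  shows "circle_measure.ip \<nu> (\<Phi> (Suc k)) (\<Phi> (Suc k)) =
    of_real (1 - norm (\<alpha> k) ^ 2) * circle_measure.ip \<nu> (\<Phi> k) (\<Phi> k)"
proof -
  interpret \<nu>: circle_measure \<nu> by fact
  have z1: "\<nu>.ip (\<Phi>s k) (\<Phi> (Suc k)) = 0"
    using degree_reversed_poly[of k "\<Phi> k"] by (intro \<nu>.ip_lower_degree[OF orth]) auto
  then have z2: "\<nu>.ip (\<Phi> (Suc k)) (\<Phi>s k) = 0" using \<nu>.ip_commute[of "\<Phi>s k" "\<Phi> (Suc k)"] by simp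
  have "pCons 0 (\<Phi> k) = \<Phi> (Suc k) + smult (cnj (\<alpha> k)) (\<Phi>s k)" by (simp add: szego_recursion)
  then have "\<nu>.ip (\<Phi> k) (\<Phi> k) = \<nu>.ip (\<Phi> (Suc k) + smult (cnj (\<alpha> k)) (\<Phi>s k)) (\<Phi> (Suc k) + smult (cnj (\<alpha> k)) (\<Phi>s k))"
    using \<nu>.ip_shift by metis
  also have "\<dots> = \<nu>.ip (\<Phi> (Suc k)) (\<Phi> (Suc k)) + \<alpha> k * cnj (\<alpha> k) * \<nu>.ip (\<Phi> k) (\<Phi> k)"
    by (simp add: \<nu>.ip_add_left \<nu>.ip_add_right \<nu>.ip_smult_left \<nu>.ip_smult_right z1 z2
        \<nu>.ip_reversed_poly_self degree_\<Phi>)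
  also have "\<alpha> k * cnj (\<alpha> k) = of_real (norm (\<alpha> k) ^ 2)" by (rule complex_norm_square[symmetric])
  finally show ?thesis by (simp add: algebra_simps)
qed

text \<open>The squared norm of \<Phi>_N in product form, since the sum rule takes its
  logarithm.\<close>

definition \<omega> :: "nat \<Rightarrow> real" where
  "\<omega> N = (\<Prod>k<N. 1 - norm (\<alpha> k) ^ 2)"

lemma ip_1_1: "ip 1 1 = 1"
proof -
  interpret prob_space \<mu> using mu by (simp add: nontrivial_circle_measure_def)
  show ?thesis by (simp add: ip_def prob_space)
qed

lemma ip_\<Phi>_\<Phi>: "ip (\<Phi> N) (\<Phi> N) = of_real (\<omega> N)"
proof (induction N)
  case 0
  then show ?case by (simp add: \<Phi>_0 ip_1_1 \<omega>_def)
next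
  case (Suc N)
  then show ?case
    using ip_\<Phi>_Suc[OF circle_measure_axioms ip_monom_\<Phi>, of N] by (simp add: \<omega>_def mult.commute)
qed

lemma ip_self: "ip p p = of_real (\<integral>z. norm (poly p z) ^ 2 \<partial>\<mu>)"
proof -
  have "cnj w * w = of_real (norm w ^ 2)" for w
    using complex_norm_square[of w] by (simp add: mult.commute)
  then show ?thesis unfolding ip_def by (simp only: integral_complex_of_real)
qed

lemma \<omega>_eq_integral: "\<omega> N = (\<integral>z. norm (poly (\<Phi> N) z) ^ 2 \<partial>\<mu>)"
  using ip_\<Phi>_\<Phi>[of N] unfolding ip_self by (simp only: of_real_eq_iff)

lemma \<omega>_pos: "\<omega> N > 0"
proof -
  have "\<omega> N \<ge> 0" unfolding \<omega>_eq_integral by simp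
  moreover have "ip (\<Phi> N) (\<Phi> N) \<noteq> 0"
    using poly_eq_0_of_L2_norm_eq_0[OF mu, of "\<Phi> N"] \<Phi>_neq_0 by (auto simp: ip_def)
  then have "\<omega> N \<noteq> 0" using ip_\<Phi>_\<Phi> by auto
  ultimately show ?thesis by simp
qed

lemma norm_\<alpha>_less_1: "norm (\<alpha> k) < 1"
proof -
  have "\<omega> (Suc k) = \<omega> k * (1 - norm (\<alpha> k) ^ 2)" by (simp add: \<omega>_def)
  then have "1 - norm (\<alpha> k) ^ 2 > 0" using \<omega>_pos[of k] \<omega>_pos[of "Suc k"] by (simp add: zero_less_mult_iff)
  then show ?thesis by (simp add: power_less_one_iff abs_square_less_1)
qed

text \<open>Both claims run through one induction: |u| \<le> |s| and |a| < 1 keep s - a u away from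
  0, and |s - a u|^2 - |u - cnj a s|^2 = (1 - |a|^2)(|s|^2 - |u|^2) transports the inequality. In
  other words, b_k is a Schur function.\<close>

lemma \<Phi>s_dominates:
  assumes z: "norm z \<le> 1"
  shows "poly (\<Phi>s k) z \<noteq> 0 \<and> norm (poly (\<Phi> k) z) \<le> norm (poly (\<Phi>s k) z)"
proof (induction k)
  case 0
  have "\<Phi>s 0 = 1" by (rule poly_eqI) (simp add: coeff_reversed_poly \<Phi>_0)
  then show ?case by (simp add: \<Phi>_0)
next
  case (Suc k)
  define u where "u = z * poly (\<Phi> k) z"
  define s where "s = poly (\<Phi>s k) z"
  define a where "a = \<alpha> k"
  have a: "norm a < 1" by (simp add: a_def norm_\<alpha>_less_1)
  have s: "s \<noteq> 0" using Suc by (simp add: s_def)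
  have us: "norm u \<le> norm s"
  proof -
    have "norm u \<le> 1 * norm (poly (\<Phi> k) z)" unfolding u_def norm_mult using z by (intro mult_right_mono) auto
    then show ?thesis using Suc by (simp add: s_def)
  qed
  have 1: "poly (\<Phi>s (Suc k)) z = s - a * u"
    by (simp add: szego_recursion_reversed s_def a_def u_def)
  have 2: "poly (\<Phi> (Suc k)) z = u - cnj a * s"
    by (simp add: szego_recursion s_def a_def u_def)
  have "norm (a * u) < norm s"
  proof -
    have "norm a * norm u \<le> norm a * norm s" using us by (intro mult_left_mono) auto
    also have "\<dots> < 1 * norm s" using a s by (intro mult_strict_right_mono) auto
    finally show ?thesis by (simp add: norm_mult)
  qed
  then have nz: "s - a * u \<noteq> 0" by auto
  have "norm (s - a * u) ^ 2 - norm (u - cnj a * s) ^ 2 = (1 - norm a ^ 2) * (norm s ^ 2 - norm u ^ 2)"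
    unfolding cmod_power2 by (simp add: power2_eq_square algebra_simps)
  also have "\<dots> \<ge> 0"
    using a us by (intro mult_nonneg_nonneg) (auto simp: power_le_one power_mono)
  finally have "norm (u - cnj a * s) ^ 2 \<le> norm (s - a * u) ^ 2" by simp
  then have "norm (u - cnj a * s) \<le> norm (s - a * u)" by (rule power2_le_imp_le) simp
  then show ?case unfolding 1 2 using nz by simp
qed

lemma norm_\<Phi>s_eq: "norm z = 1 \<Longrightarrow> norm (poly (\<Phi>s k) z) = norm (poly (\<Phi> k) z)"
  by (rule norm_poly_reversed_poly) (simp_all add: degree_\<Phi>)

lemma \<Phi>_nonzero_circle: "norm z = 1 \<Longrightarrow> poly (\<Phi> k) z \<noteq> 0"
  using norm_\<Phi>s_eq[of z k] \<Phi>s_dominates[of z k] by auto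

section \<open>Bernstein--Szego approximation\<close>

definition bs_density :: "nat \<Rightarrow> real \<Rightarrow> real" where
  "bs_density N t = \<omega> N / norm (poly (\<Phi> N) (cis t)) ^ 2"

definition bs_measure :: "nat \<Rightarrow> complex measure" where
  "bs_measure N = distr (density angle_measure (\<lambda>t. ennreal (bs_density N t))) borel cis"

lemma bs_density_pos: "bs_density N t > 0"
  by (simp add: bs_density_def \<omega>_pos \<Phi>_nonzero_circle)

lemma continuous_bs_density: "continuous_on A (bs_density N)"
  unfolding bs_density_def by (intro continuous_intros) (auto simp: \<Phi>_nonzero_circle)

lemma borel_measurable_bs_density [measurable]: "bs_density N \<in> borel_measurable borel"
  by (rule borel_measurable_continuous_onI[OF continuous_bs_density])

lemma measurable_cis [measurable]: "cis \<in> borel_measurable borel"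
  by (rule borel_measurable_continuous_onI) (intro continuous_intros)

lemma integral_bs_measure:
  fixes f :: "complex \<Rightarrow> 'a::{banach,second_countable_topology}"
  assumes [measurable]: "f \<in> borel_measurable borel"
  shows "(\<integral>z. f z \<partial>bs_measure N) = (\<integral>t. bs_density N t *\<^sub>R f (cis t) \<partial>angle_measure)"
  unfolding bs_measure_def
  by (subst integral_distr, simp_all, subst integral_density) (auto simp: less_imp_le[OF bs_density_pos])

lemma circle_measure_bs_measure: "circle_measure (bs_measure N)"
proof -
  have "integrable angle_measure (bs_density N)"
    by (rule integrable_angle_measure[OF continuous_bs_density])
  then have "(\<integral>\<^sup>+t. ennreal (bs_density N t) \<partial>angle_measure) < \<infinity>"
    using integrableD(2)[of angle_measure "bs_density N"] bs_density_pos
    by (simp add: less_top abs_of_pos)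
  then have "emeasure (bs_measure N) (space (bs_measure N)) \<noteq> \<infinity>"
    by (simp add: bs_measure_def emeasure_distr emeasure_density)
  moreover have "AE z in bs_measure N. z \<in> sphere 0 1"
    unfolding bs_measure_def by (subst AE_distr_iff) auto
  ultimately show ?thesis
    by (intro circle_measure.intro finite_measureI circle_measure_axioms.intro) (auto simp: bs_measure_def)
qed

text \<open>On the circle the density turns cnj (z^j) \<Phi>_N into a multiple of z^(N-j) /
  \<Phi>_N^*, which is holomorphic in the disc because \<Phi>_N^* has no zeros there, and vanishes
  at 0.\<close>

lemma bs_orthogonal_top:
  assumes "j < N"
  shows "circle_measure.ip (bs_measure N) (monom 1 j) (\<Phi> N) = 0"
proof -
  interpret \<nu>: circle_measure "bs_measure N" by (rule circle_measure_bs_measure)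
  define g where "g = (\<lambda>z. of_real (\<omega> N) * z ^ (N - j) / poly (\<Phi>s N) z)"
  have "\<nu>.ip (monom 1 j) (\<Phi> N) = (\<integral>t. bs_density N t *\<^sub>R (cnj (cis t ^ j) * poly (\<Phi> N) (cis t)) \<partial>angle_measure)"
    unfolding \<nu>.ip_def poly_monom
    by (subst integral_bs_measure)
      (auto intro!: borel_measurable_continuous_onI continuous_intros)
  also have "\<dots> = (\<integral>t. g (cis t) \<partial>angle_measure)"
  proof (rule Bochner_Integration.integral_cong[OF refl])
    fix t
    define z where "z = cis t"
    have z: "norm z = 1" by (simp add: z_def)
    then have z1: "cnj z * z = 1" using complex_norm_square[of z] by (simp add: mult.commute)
    have nz: "poly (\<Phi> N) z \<noteq> 0" "z \<noteq> 0" using \<Phi>_nonzero_circle z by auto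
    have "z ^ N = z ^ j * z ^ (N - j)" using assms by (simp flip: power_add)
    then have "cnj z ^ j * z ^ N = (cnj z * z) ^ j * z ^ (N - j)" by (simp add: power_mult_distrib)
    then have p: "z ^ (N - j) = cnj z ^ j * z ^ N" by (simp add: z1)
    have "bs_density N t *\<^sub>R (cnj (z ^ j) * poly (\<Phi> N) z)
        = of_real (\<omega> N) / (poly (\<Phi> N) z * cnj (poly (\<Phi> N) z)) * (cnj z ^ j * poly (\<Phi> N) z)"
      unfolding complex_norm_square[symmetric] by (simp add: bs_density_def z_def scaleR_conv_of_real)
    also have "\<dots> = of_real (\<omega> N) * cnj z ^ j / cnj (poly (\<Phi> N) z)" using nz by (simp add: field_simps)
    also have "\<dots> = g z"
      unfolding g_def p poly_reversed_poly[OF eq_refl[OF degree_\<Phi>] z] using nz by (simp add: field_simps)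
    finally show "bs_density N t *\<^sub>R (cnj (cis t ^ j) * poly (\<Phi> N) (cis t)) = g (cis t)" by (simp add: z_def)
  qed
  also have "\<dots> = g 0"
    unfolding g_def using \<Phi>s_dominates
    by (intro mean_value_holomorphic continuous_intros holomorphic_intros) auto
  also have "\<dots> = 0" using assms by (simp add: g_def)
  finally show ?thesis .
qed

lemma bs_norm_top: "circle_measure.ip (bs_measure N) (\<Phi> N) (\<Phi> N) = of_real (\<omega> N)"
proof -
  interpret \<nu>: circle_measure "bs_measure N" by (rule circle_measure_bs_measure)
  have "\<nu>.ip (\<Phi> N) (\<Phi> N) = (\<integral>t. bs_density N t *\<^sub>R (cnj (poly (\<Phi> N) (cis t)) * poly (\<Phi> N) (cis t)) \<partial>angle_measure)"
    unfolding \<nu>.ip_def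
    by (subst integral_bs_measure)
      (auto intro!: borel_measurable_continuous_onI continuous_intros)
  also have "\<dots> = (\<integral>t. of_real (\<omega> N) \<partial>angle_measure)"
  proof (rule Bochner_Integration.integral_cong[OF refl])
    fix t
    have "cnj (poly (\<Phi> N) (cis t)) * poly (\<Phi> N) (cis t) = of_real (norm (poly (\<Phi> N) (cis t)) ^ 2)"
      by (metis complex_norm_square mult.commute)
    then show "bs_density N t *\<^sub>R (cnj (poly (\<Phi> N) (cis t)) * poly (\<Phi> N) (cis t)) = of_real (\<omega> N)"
      using \<Phi>_nonzero_circle[of "cis t" N] by (simp add: bs_density_def scaleR_conv_of_real)
  qed
  also have "\<dots> = of_real (\<omega> N)" using angle.prob_space by simp
  finally show ?thesis .
qed

text \<open>Downward induction from N: the inverse Szego recursion recovers \<Phi>_k from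
  \<Phi>_{k+1} and its reversal, so orthogonality for the top polynomial forces it for all lower
  ones, with the same norms.\<close>

lemma bs_orthogonal:
  assumes "k \<le> N"
  shows "(\<forall>j<k. circle_measure.ip (bs_measure N) (monom 1 j) (\<Phi> k) = 0) \<and>
    circle_measure.ip (bs_measure N) (\<Phi> k) (\<Phi> k) = of_real (\<omega> k)"
  using assms
proof (induction rule: inc_induct)
  case base
  then show ?case by (simp add: bs_orthogonal_top bs_norm_top)
next
  case (step k)
  interpret \<nu>: circle_measure "bs_measure N" by (rule circle_measure_bs_measure)
  define c where "c = 1 - norm (\<alpha> k) ^ 2"
  have c: "c \<noteq> 0" using norm_\<alpha>_less_1[of k] norm_ge_zero[of "\<alpha> k"] unfolding c_def
    by (auto simp: power2_eq_1_iff simp del: norm_ge_zero)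
  \<comment> \<open>The two Szego recursions solved for z \<Phi>_k; the determinant c is nonzero
    because |\<alpha>_k| < 1.\<close>
  have inv: "smult (of_real c) (pCons 0 (\<Phi> k)) = \<Phi> (Suc k) + smult (cnj (\<alpha> k)) (\<Phi>s (Suc k))"
  proof -
    have c_eq: "of_real c = 1 - \<alpha> k * cnj (\<alpha> k)" by (simp add: c_def complex_norm_square[symmetric])
    have alg: "a - smult x b + smult x (b - smult y a) = smult (1 - y * x) a"
      for a b :: "complex poly" and x y
      by (simp add: smult_diff_right smult_diff_left mult.commute)
    show ?thesis
      unfolding szego_recursion_reversed unfolding szego_recursion[of k] c_eq by (rule alg[symmetric])
  qed
  have orth: "\<nu>.ip (monom 1 j) (\<Phi> k) = 0" if "j < k" for j
  proof -
    have "of_real c * \<nu>.ip (monom 1 j) (\<Phi> k) = \<nu>.ip (monom 1 (Suc j)) (smult (of_real c) (pCons 0 (\<Phi> k)))"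
      by (simp add: \<nu>.ip_smult_right monom_Suc \<nu>.ip_shift)
    also have "\<dots> = \<nu>.ip (monom 1 (Suc j)) (\<Phi> (Suc k))
        + cnj (\<alpha> k) * cnj (\<nu>.ip (monom 1 (k - j)) (\<Phi> (Suc k)))"
      unfolding inv using that
      by (simp add: \<nu>.ip_add_right \<nu>.ip_smult_right \<nu>.ip_monom_reversed_poly degree_\<Phi>)
    also have "\<dots> = 0" using step that by simp
    finally show ?thesis using c by simp
  qed
  have "\<nu>.ip (\<Phi> (Suc k)) (\<Phi> (Suc k)) = of_real c * \<nu>.ip (\<Phi> k) (\<Phi> k)"
    unfolding c_def using step by (intro ip_\<Phi>_Suc[OF circle_measure_bs_measure]) auto
  moreover have "\<omega> (Suc k) = c * \<omega> k" by (simp add: \<omega>_def c_def)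
  ultimately have "of_real c * \<nu>.ip (\<Phi> k) (\<Phi> k) = of_real c * of_real (\<omega> k)"
    using step by (metis of_real_mult)
  then have "\<nu>.ip (\<Phi> k) (\<Phi> k) = of_real (\<omega> k)" using c by simp
  with orth show ?case by simp
qed

text \<open>Subtracting a multiple of \<Phi>_d lowers the degree. For d > 0 the integral of \<Phi>_d
  vanishes under both measures, and d = 0 compares the total masses.\<close>

lemma bs_ip_1:
  assumes "degree p \<le> N"
  shows "circle_measure.ip (bs_measure N) 1 p = ip 1 p"
  using assms
proof (induction "degree p" arbitrary: p rule: less_induct)
  case less
  interpret \<nu>: circle_measure "bs_measure N" by (rule circle_measure_bs_measure)
  define d where "d = degree p"
  define r where "r = p - smult (coeff p d) (\<Phi> d)"
  have \<Phi>: "\<nu>.ip 1 (\<Phi> d) = ip 1 (\<Phi> d)"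
  proof (cases d)
    case 0
    then show ?thesis using bs_orthogonal[of 0 N] by (simp add: \<Phi>_0 ip_1_1 \<omega>_def)
  next
    case (Suc i)
    have "\<nu>.ip (monom 1 0) (\<Phi> d) = 0" "ip (monom 1 0) (\<Phi> d) = 0"
      using bs_orthogonal[of d N] ip_monom_\<Phi>[of 0 d] less.prems Suc by (auto simp: d_def)
    then show ?thesis by (simp add: monom_0 flip: one_pCons)
  qed
  have rc: "coeff r j = 0" if "j \<ge> d" for j
    using that coeff_\<Phi>[of d] by (cases "j = d") (auto simp: r_def coeff_eq_0 degree_\<Phi> d_def)
  have r: "\<nu>.ip 1 r = ip 1 r"
  proof (cases "r = 0")
    case True
    then show ?thesis by (simp add: \<nu>.ip_def ip_def)
  next
    case False
    then have "degree r < d" using rc[of "degree r"] by (metis leading_coeff_0_iff not_le)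
    then show ?thesis using less.hyps[of r] less.prems by (simp add: d_def)
  qed
  have p: "p = r + smult (coeff p d) (\<Phi> d)" by (simp add: r_def)
  show ?case
    by (subst (1 2) p) (simp add: \<nu>.ip_add_right \<nu>.ip_smult_right ip_add_right ip_smult_right r \<Phi>)
qed

text \<open>On the circle the moments form a Toeplitz matrix: only the difference of exponents
  counts, which reduces everything to inner products with 1.\<close>

lemma bs_ip:
  assumes "m \<le> N" "degree p \<le> N"
  shows "circle_measure.ip (bs_measure N) (monom 1 m) p = ip (monom 1 m) p"
proof -
  interpret \<nu>: circle_measure "bs_measure N" by (rule circle_measure_bs_measure)
  have shift: "circle_measure.ip \<kappa> (monom 1 a) (monom 1 (a + b)) = circle_measure.ip \<kappa> 1 (monom 1 b)"
    if "circle_measure \<kappa>" for \<kappa> a b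
  proof -
    interpret \<kappa>: circle_measure \<kappa> by fact
    show ?thesis by (induction a) (simp_all add: monom_Suc \<kappa>.ip_shift monom_0 flip: one_pCons)
  qed
  have mono: "\<nu>.ip (monom 1 a) (monom 1 b) = ip (monom 1 a) (monom 1 b)" if "a \<le> b" "b \<le> N" for a b
    using shift[OF circle_measure_bs_measure, of N a "b - a"] shift[OF circle_measure_axioms, of a "b - a"]
      bs_ip_1[of "monom 1 (b - a)" N] that by (simp add: degree_monom_eq)
  have *: "\<nu>.ip (monom 1 j) (monom 1 m) = ip (monom 1 j) (monom 1 m)" if "j \<le> N" for j
  proof (cases "j \<le> m")
    case True then show ?thesis using mono assms by simp
  next
    case False
    then show ?thesis using mono[of m j] that \<nu>.ip_commute[of "monom 1 m" "monom 1 j"]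
        ip_commute[of "monom 1 m" "monom 1 j"] by simp
  qed
  have "p = (\<Sum>j\<le>degree p. smult (coeff p j) (monom 1 j))"
    by (subst poly_as_sum_of_monoms[symmetric]) (simp add: smult_monom)
  then have "\<nu>.ip p (monom 1 m) = (\<Sum>j\<le>degree p. \<nu>.ip (smult (coeff p j) (monom 1 j)) (monom 1 m))"
    and "ip p (monom 1 m) = (\<Sum>j\<le>degree p. ip (smult (coeff p j) (monom 1 j)) (monom 1 m))"
    by (metis \<nu>.ip_sum_left, metis ip_sum_left)
  then have "\<nu>.ip p (monom 1 m) = ip p (monom 1 m)"
    using assms * by (simp add: \<nu>.ip_smult_left ip_smult_left)
  then show ?thesis using \<nu>.ip_commute[of p "monom 1 m"] ip_commute[of p "monom 1 m"] by simp
qed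

end

section \<open>Weak convergence of the Bernstein--Szego measures\<close>

lemma real_polynomial_function_on_circle:
  fixes f :: "complex \<Rightarrow> real"
  assumes "real_polynomial_function f"
  shows "\<exists>p m. \<forall>z. norm z = 1 \<longrightarrow> of_real (f z) = cnj (poly (monom 1 m) z) * poly p z"
  using assms
proof induction
  case (linear f)
  define a b where "a = f 1" and "b = f \<i>"
  \<comment> \<open>This p is z times a Re z + b Im z, simplified by z cnj z = 1. Real polynomials
    thus become trigonometric ones, in a form that is an inner product of z^m with a
    polynomial.\<close>
  define p where "p = [:of_real a / 2 + \<i> * of_real b / 2, 0, of_real a / 2 - \<i> * of_real b / 2:]"
  have "of_real (f z) = cnj (poly (monom 1 1) z) * poly p z" if z: "norm z = 1" for z
  proof -
    interpret bounded_linear f by fact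
    have "f z = f (Re z *\<^sub>R 1 + Im z *\<^sub>R \<i>)"
      by (rule arg_cong[of _ _ f]) (simp add: complex_eq_iff)
    then have fz: "f z = Re z * a + Im z * b" by (simp only: add scaleR a_def b_def real_scaleR_def)
    have z1: "cnj z * z = 1" using z complex_norm_square[of z] by (simp add: mult.commute)
    have "cnj z * poly p z = (of_real a / 2 + \<i> * of_real b / 2) * cnj z
        + (of_real a / 2 - \<i> * of_real b / 2) * ((cnj z * z) * z)"
      by (simp add: p_def algebra_simps)
    also have "\<dots> = of_real (f z)" unfolding z1 fz by (simp add: complex_eq_iff field_simps)
    finally show ?thesis by (simp add: poly_monom)
  qed
  then show ?case by blast
next
  case (const c)
  have "of_real c = cnj (poly (monom 1 0) z) * poly [:of_real c:] z" for z
    by (simp add: poly_monom)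
  then show ?case by blast
next
  case (add f g)
  then obtain p m q l where
    p: "\<And>z. norm z = 1 \<Longrightarrow> of_real (f z) = cnj (poly (monom 1 m) z) * poly p z" and
    q: "\<And>z. norm z = 1 \<Longrightarrow> of_real (g z) = cnj (poly (monom 1 l) z) * poly q z" by blast
  have "of_real (f z + g z) = cnj (poly (monom 1 (m + l)) z) * poly (monom 1 l * p + monom 1 m * q) z"
    if z: "norm z = 1" for z
  proof -
    have z1: "cnj z * z = 1" using z complex_norm_square[of z] by (simp add: mult.commute)
    have "cnj (poly (monom 1 (m + l)) z) * poly (monom 1 l * p + monom 1 m * q) z
        = (cnj z * z) ^ l * (cnj z ^ m * poly p z) + (cnj z * z) ^ m * (cnj z ^ l * poly q z)"
      by (simp add: poly_monom power_add power_mult_distrib algebra_simps)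
    then show ?thesis using p[OF z] q[OF z] by (simp add: z1 poly_monom)
  qed
  then show ?case by blast
next
  case (mult f g)
  then obtain p m q l where
    p: "\<And>z. norm z = 1 \<Longrightarrow> of_real (f z) = cnj (poly (monom 1 m) z) * poly p z" and
    q: "\<And>z. norm z = 1 \<Longrightarrow> of_real (g z) = cnj (poly (monom 1 l) z) * poly q z" by blast
  have "of_real (f z * g z) = cnj (poly (monom 1 (m + l)) z) * poly (p * q) z" if "norm z = 1" for z
    using p[OF that] q[OF that] by (simp add: poly_monom power_add mult_ac)
  then show ?case by blast
qed

context circle_measure
begin

lemma integral_eq_ip:
  fixes f :: "complex \<Rightarrow> real"
  assumes "continuous_on UNIV f" "\<And>z. norm z = 1 \<Longrightarrow> of_real (f z) = cnj (poly (monom 1 m) z) * poly p z"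
  shows "complex_of_real (\<integral>z. f z \<partial>\<nu>) = ip (monom 1 m) p"
proof -
  have "complex_of_real (\<integral>z. f z \<partial>\<nu>) = (\<integral>z. of_real (f z) \<partial>\<nu>)" by (rule integral_complex_of_real[symmetric])
  also have "\<dots> = ip (monom 1 m) p"
    unfolding ip_def using assms by (intro integral_cong_sphere continuous_intros) auto
  finally show ?thesis .
qed

lemma integral_diff_le:
  fixes f g :: "complex \<Rightarrow> real"
  assumes "continuous_on UNIV f" "continuous_on UNIV g"
    and "\<And>z. norm z = 1 \<Longrightarrow> \<bar>f z - g z\<bar> \<le> e"
  shows "\<bar>(\<integral>z. f z \<partial>\<nu>) - (\<integral>z. g z \<partial>\<nu>)\<bar> \<le> e * measure \<nu> (space \<nu>)"
proof -
  have i: "integrable \<nu> f" "integrable \<nu> g" using assms by (auto intro: integrable_continuous)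
  have "\<bar>(\<integral>z. f z \<partial>\<nu>) - (\<integral>z. g z \<partial>\<nu>)\<bar> = \<bar>\<integral>z. f z - g z \<partial>\<nu>\<bar>" using i by simp
  also have "\<dots> \<le> (\<integral>z. \<bar>f z - g z\<bar> \<partial>\<nu>)" by (rule integral_abs_bound)
  also have "\<dots> \<le> (\<integral>z. e \<partial>\<nu>)"
    using i AE_sphere by (intro integral_mono_AE) (auto intro: assms(3) elim!: eventually_mono)
  finally show ?thesis by (simp add: mult.commute)
qed

end

context opuc
begin

text \<open>For a trigonometric polynomial the integrals agree exactly once N is large; the two
  approximation errors are uniform because both measures have mass 1.\<close>

lemma bs_measure_tendsto:
  fixes f :: "complex \<Rightarrow> real"
  assumes f: "continuous_on UNIV f"
  shows "(\<lambda>N. \<integral>z. f z \<partial>bs_measure N) \<longlonglongrightarrow> (\<integral>z. f z \<partial>\<mu>)"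
proof (rule LIMSEQ_I)
  fix r :: real assume r: "r > 0"
  have cs: "continuous_on (sphere 0 1) f" using f by (rule continuous_on_subset) simp
  have "0 < r / 3" using r by simp
  obtain g where g: "real_polynomial_function g" "\<And>z. z \<in> sphere 0 1 \<Longrightarrow> \<bar>f z - g z\<bar> < r / 3"
    by (rule Stone_Weierstrass_real_polynomial_function[OF compact_sphere cs \<open>0 < r / 3\<close>]) blast
  have cg: "continuous_on UNIV g"
    using g(1) by (intro continuous_at_imp_continuous_on ballI continuous_real_polymonial_function)
  obtain p m where pm: "\<And>z. norm z = 1 \<Longrightarrow> of_real (g z) = cnj (poly (monom 1 m) z) * poly p z"
    using real_polynomial_function_on_circle[OF g(1)] by blast
  have "norm ((\<integral>z. f z \<partial>bs_measure N) - (\<integral>z. f z \<partial>\<mu>)) < r" if N: "N \<ge> m + degree p" for N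
  proof -
    interpret \<nu>: circle_measure "bs_measure N" by (rule circle_measure_bs_measure)
    have one: "complex_of_real (\<integral>z. 1 \<partial>bs_measure N) = \<nu>.ip (monom 1 0) 1"
      "complex_of_real (\<integral>z. 1 \<partial>\<mu>) = ip (monom 1 0) 1"
      by (rule \<nu>.integral_eq_ip integral_eq_ip; simp add: poly_monom)+
    have ip1: "ip (monom 1 0) 1 = 1" using ip_1_1 by (simp add: monom_0 flip: one_pCons)
    have "complex_of_real (measure \<mu> (space \<mu>)) = of_real 1" using one(2) unfolding ip1 by simp
    then have m1: "measure \<mu> (space \<mu>) = 1" by (simp only: of_real_eq_iff)
    have "complex_of_real (measure (bs_measure N) (space (bs_measure N))) = of_real 1"
      using one(1) bs_ip[of 0 N 1] unfolding ip1 by simp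
    then have m2: "measure (bs_measure N) (space (bs_measure N)) = 1" by (simp only: of_real_eq_iff)
    have "complex_of_real (\<integral>z. g z \<partial>bs_measure N) = of_real (\<integral>z. g z \<partial>\<mu>)"
      using \<nu>.integral_eq_ip[OF cg pm] integral_eq_ip[OF cg pm] bs_ip[of m N p] N by simp
    then have "(\<integral>z. g z \<partial>bs_measure N) = (\<integral>z. g z \<partial>\<mu>)" by (simp only: of_real_eq_iff)
    moreover have "\<bar>(\<integral>z. f z \<partial>bs_measure N) - (\<integral>z. g z \<partial>bs_measure N)\<bar> \<le> r / 3 * 1"
      unfolding m2[symmetric] using g(2) by (intro \<nu>.integral_diff_le f cg less_imp_le) auto
    moreover have "\<bar>(\<integral>z. f z \<partial>\<mu>) - (\<integral>z. g z \<partial>\<mu>)\<bar> \<le> r / 3 * 1"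
      unfolding m1[symmetric] using g(2) by (intro integral_diff_le f cg less_imp_le) auto
    ultimately show ?thesis using r unfolding real_norm_def abs_le_iff abs_less_iff by linarith
  qed
  then show "\<exists>no. \<forall>N\<ge>no. norm ((\<integral>z. f z \<partial>bs_measure N) - (\<integral>z. f z \<partial>\<mu>)) < r" by blast
qed

end

section \<open>Simultaneous approximation of Borel functions by continuous functions\<close>

text \<open>A single g must serve both measures: the entropy inequality compares an integral over
  arc length with one over \<mu>, and \<mu> may have a singular part.\<close>

definition L1_approximable :: "complex measure \<Rightarrow> complex measure \<Rightarrow> (complex \<Rightarrow> real) \<Rightarrow> bool" where
  "L1_approximable M N f \<longleftrightarrow> (\<forall>e>0. \<exists>g. continuous_on UNIV g \<and> bounded (range g) \<and>
     (\<integral>z. \<bar>f z - g z\<bar> \<partial>M) < e \<and> (\<integral>z. \<bar>f z - g z\<bar> \<partial>N) < e)"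

lemma L1_approximableD:
  assumes "L1_approximable M N f" "e > 0"
  obtains g where "continuous_on UNIV g" "bounded (range g)"
    "(\<integral>z. \<bar>f z - g z\<bar> \<partial>M) < e" "(\<integral>z. \<bar>f z - g z\<bar> \<partial>N) < e"
  using assms unfolding L1_approximable_def by blast

lemma finite_measure_regular:
  fixes M :: "complex measure"
  assumes "finite_measure M" and s: "sets M = sets borel" and A: "A \<in> sets borel" and e: "e > 0"
  obtains K U where "compact K" "open U" "K \<subseteq> A" "A \<subseteq> U" "measure M (U - K) < e"
proof -
  interpret finite_measure M by fact
  have fin: "emeasure M (space M) \<noteq> \<infinity>" by simp
  have "\<exists>K. K \<subseteq> A \<and> compact K \<and> measure M A < measure M K + e / 2"
  \<comment> \<open>\<open>ennreal\<close> sends negative numbers to 0, so the argument through the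
    supremum is made for \<open>measure M A \<ge> e / 2\<close>; otherwise the empty set
    serves.\<close>
  proof (cases "measure M A < e / 2")
    case True
    then show ?thesis by (intro exI[of _ "{}"]) simp
  next
    case False
    have "ennreal (measure M A - e / 2) < emeasure M A"
      unfolding emeasure_eq_measure using e False by (intro ennreal_lessI) auto
    also have "emeasure M A = (SUP K \<in> {K. K \<subseteq> A \<and> compact K}. emeasure M K)"
      by (rule inner_regular[OF s fin A])
    finally obtain K where K: "K \<subseteq> A" "compact K" "ennreal (measure M A - e / 2) < emeasure M K"
      unfolding less_SUP_iff by blast
    then have "measure M A - e / 2 < measure M K"
      unfolding emeasure_eq_measure using False by (subst (asm) ennreal_less_iff) auto
    then show ?thesis using K by (intro exI[of _ K]) auto
  qed
  then obtain K where K: "K \<subseteq> A" "compact K" "measure M A < measure M K + e / 2" by blast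
  have "(INF U \<in> {U. A \<subseteq> U \<and> open U}. emeasure M U) < ennreal (measure M A + e / 2)"
    unfolding outer_regular[OF s fin A, symmetric] unfolding emeasure_eq_measure
    using e by (intro ennreal_lessI) (auto simp: add_nonneg_pos)
  then obtain U where U: "A \<subseteq> U" "open U" "emeasure M U < ennreal (measure M A + e / 2)"
    unfolding INF_less_iff by blast
  have U': "measure M U < measure M A + e / 2"
    using U(3) unfolding emeasure_eq_measure by (subst (asm) ennreal_less_iff) auto
  have sets: "K \<in> sets M" "U \<in> sets M"
    using s K U compact_imp_closed[OF K(2)] by (auto intro: borel_closed borel_open)
  have "measure M (U - K) = measure M U - measure M K"
    using K U sets by (intro finite_measure_Diff) auto
  then have "measure M (U - K) < e" using K U' by simp
  then show ?thesis using that[of K U] K U by blast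
qed

lemma L1_approximable_indicator:
  assumes M: "finite_measure M" "sets M = sets borel" and N: "finite_measure N" "sets N = sets borel"
    and A: "A \<in> sets borel"
  shows "L1_approximable M N (indicator A)"
  unfolding L1_approximable_def
proof (intro allI impI)
  fix e :: real assume e: "e > 0"
  obtain K1 U1 where 1: "compact K1" "open U1" "K1 \<subseteq> A" "A \<subseteq> U1" "measure M (U1 - K1) < e"
    using finite_measure_regular[OF M A e] by blast
  obtain K2 U2 where 2: "compact K2" "open U2" "K2 \<subseteq> A" "A \<subseteq> U2" "measure N (U2 - K2) < e"
    using finite_measure_regular[OF N A e] by blast
  \<comment> \<open>The set U - K lies in U1 - K1 and in U2 - K2, so one Urysohn function between K
    and U is close to the indicator for both measures.\<close>
  define K U where "K = K1 \<union> K2" and "U = U1 \<inter> U2"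
  have KU: "closed K" "closed (- U)" "K \<inter> (- U) = {}"
    using 1 2 by (auto simp: K_def U_def compact_imp_closed open_Int)
  obtain g :: "complex \<Rightarrow> real" where g: "continuous_on UNIV g" "\<And>z. g z \<in> closed_segment 1 0"
    "\<And>z. z \<in> K \<Longrightarrow> g z = 1" "\<And>z. z \<in> - U \<Longrightarrow> g z = 0"
    by (rule Urysohn[OF KU]) blast
  have g01: "0 \<le> g z" "g z \<le> 1" for z using g(2)[of z] by (auto simp: closed_segment_eq_real_ivl split: if_splits)
  have le: "\<bar>indicator A z - g z\<bar> \<le> indicator (U - K) z" for z
    using g01[of z] g(3,4)[of z] 1 2 by (auto simp: indicator_def K_def U_def)
  have "(\<integral>z. \<bar>indicator A z - g z\<bar> \<partial>L) < e"
    if L: "finite_measure L" "sets L = sets borel" and sub: "U - K \<subseteq> U' - K'" "U' - K' \<in> sets borel" "measure L (U' - K') < e"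
    for L U' K'
  proof -
    interpret finite_measure L by fact
    note [measurable_cong] = L(2)
    have [measurable]: "g \<in> borel_measurable borel" by (rule borel_measurable_continuous_onI[OF g(1)])
    have [measurable]: "A \<in> sets borel" by fact
    have bound1: "\<bar>indicator A z - g z\<bar> \<le> 1" for z
      using g01[of z] by (cases "z \<in> A") (auto simp: abs_le_iff)
    have "(\<integral>z. \<bar>indicator A z - g z\<bar> \<partial>L) \<le> (\<integral>z. indicator (U' - K') z \<partial>L)"
    proof (rule integral_mono_AE)
      show "integrable L (\<lambda>z. \<bar>indicator A z - g z\<bar>)"
        by (rule integrable_const_bound[of _ 1]) (use bound1 in auto)
      show "integrable L (indicator (U' - K') :: _ \<Rightarrow> real)"
        using sub L by (intro integrable_real_indicator) (auto simp: less_top[symmetric])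
      show "AE z in L. \<bar>indicator A z - g z\<bar> \<le> indicator (U' - K') z"
        using sub by (intro AE_I2 order_trans[OF le]) (auto simp: indicator_def)
    qed
    also have "\<dots> = measure L (U' - K')" using sub L by simp
    finally show ?thesis using sub by simp
  qed
  note * = this
  have "(\<integral>z. \<bar>indicator A z - g z\<bar> \<partial>M) < e" "(\<integral>z. \<bar>indicator A z - g z\<bar> \<partial>N) < e"
    using 1 2 by (auto intro!: *[OF M, of U1 K1] *[OF N, of U2 K2] simp: K_def U_def compact_imp_closed)
  moreover have "bounded (range g)" by (rule boundedI[of _ 1]) (use g01 in \<open>auto simp: abs_le_iff\<close>, smt (verit) g01)
  ultimately show "\<exists>g. continuous_on UNIV g \<and> bounded (range g) \<and>
     (\<integral>z. \<bar>indicator A z - g z\<bar> \<partial>M) < e \<and> (\<integral>z. \<bar>indicator A z - g z\<bar> \<partial>N) < e"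
    using g(1) by blast
qed

lemma integrable_bounded:
  fixes f :: "complex \<Rightarrow> real"
  assumes "finite_measure M" "sets M = sets borel" "f \<in> borel_measurable borel" "bounded (range f)"
  shows "integrable M f"
proof -
  interpret finite_measure M by fact
  obtain B where "\<And>z. norm (f z) \<le> B" using assms(4) by (auto simp: bounded_iff)
  then show ?thesis using assms(2,3) by (intro integrable_const_bound[of _ B]) (auto cong: measurable_cong_sets)
qed

lemma L1_approximable_bounded:
  assumes M: "finite_measure M" "sets M = sets borel" and N: "finite_measure N" "sets N = sets borel"
    and f: "f \<in> borel_measurable borel" "\<And>z. 0 \<le> f z" and bd: "bounded (range f)"
  shows "L1_approximable M N f"
  using f bd
proof (induction f rule: borel_measurable_induct_real)
  case (set A)
  then show ?case by (intro L1_approximable_indicator M N) simp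
next
  case (mult u c)
  show ?case
  proof (cases "c = 0")
    case True
    then show ?thesis by (auto simp: L1_approximable_def intro!: exI[of _ "\<lambda>_. 0"])
  next
    case False
    then have c: "c > 0" using mult.hyps by simp
    obtain B where B: "\<And>z. norm (c * u z) \<le> B" using mult.prems by (auto simp: bounded_iff)
    have "norm (u z) \<le> B / c" for z using B[of z] c by (simp add: field_simps abs_mult)
    then have "bounded (range u)" by (auto simp: bounded_iff)
    then have ap: "L1_approximable M N u" using mult.IH by blast
    show ?thesis
      unfolding L1_approximable_def
    proof (intro allI impI)
      fix e :: real assume "e > 0"
      then have "e / c > 0" using c by simp
      from L1_approximableD[OF ap this] obtain g where g: "continuous_on UNIV g" "bounded (range g)"
        "(\<integral>z. \<bar>u z - g z\<bar> \<partial>M) < e / c" "(\<integral>z. \<bar>u z - g z\<bar> \<partial>N) < e / c" by blast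
      have eq: "\<bar>c * u z - c * g z\<bar> = c * \<bar>u z - g z\<bar>" for z
        using c by (simp add: abs_mult flip: right_diff_distrib)
      obtain G where "\<And>z. norm (g z) \<le> G" using g(2) by (auto simp: bounded_iff)
      then have "norm (c * g z) \<le> c * G" for z using c by (simp add: abs_mult)
      then have "bounded (range (\<lambda>z. c * g z))" by (auto simp: bounded_iff)
      then show "\<exists>g. continuous_on UNIV g \<and> bounded (range g) \<and>
         (\<integral>z. \<bar>c * u z - g z\<bar> \<partial>M) < e \<and> (\<integral>z. \<bar>c * u z - g z\<bar> \<partial>N) < e"
        using g c by (intro exI[of _ "\<lambda>z. c * g z"])
          (auto simp: eq field_simps intro!: continuous_intros)
    qed
  qed
next
  case (add u v)
  obtain B where B: "\<And>z. norm (v z + u z) \<le> B" using add.prems by (auto simp: bounded_iff add.commute)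
  have "norm (u z) \<le> B" "norm (v z) \<le> B" for z
    using B[of z] add.hyps by (auto simp: add_nonneg_nonneg) (smt (verit) add.hyps)+
  then have bu: "bounded (range u)" and bv: "bounded (range v)" by (auto simp: bounded_iff)
  have apu: "L1_approximable M N u" and apv: "L1_approximable M N v" using add.IH bu bv by blast+
  have tri: "(\<integral>z. \<bar>u z + v z - (g z + h z)\<bar> \<partial>L) \<le> (\<integral>z. \<bar>u z - g z\<bar> \<partial>L) + (\<integral>z. \<bar>v z - h z\<bar> \<partial>L)"
    if L: "finite_measure L" "sets L = sets borel" and
      g: "continuous_on UNIV g" "bounded (range g)" and h: "continuous_on UNIV h" "bounded (range h)" for L g h
  proof -
    have i: "integrable L u" "integrable L v" "integrable L g" "integrable L h"
      using add.hyps bu bv g h by (auto intro!: integrable_bounded[OF L] borel_measurable_continuous_onI)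
    have "(\<integral>z. \<bar>u z + v z - (g z + h z)\<bar> \<partial>L) \<le> (\<integral>z. \<bar>u z - g z\<bar> + \<bar>v z - h z\<bar> \<partial>L)"
      using i by (intro integral_mono integrable_abs Bochner_Integration.integrable_diff
          Bochner_Integration.integrable_add) auto
    also have "\<dots> = (\<integral>z. \<bar>u z - g z\<bar> \<partial>L) + (\<integral>z. \<bar>v z - h z\<bar> \<partial>L)"
      using i by (intro Bochner_Integration.integral_add integrable_abs Bochner_Integration.integrable_diff)
    finally show ?thesis .
  qed
  show ?case
    unfolding L1_approximable_def
  proof (intro allI impI)
    fix e :: real assume "e > 0"
    then have e2: "e / 2 > 0" by simp
    from L1_approximableD[OF apu e2] obtain g where g: "continuous_on UNIV g" "bounded (range g)"
      "(\<integral>z. \<bar>u z - g z\<bar> \<partial>M) < e / 2" "(\<integral>z. \<bar>u z - g z\<bar> \<partial>N) < e / 2" by blast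
    from L1_approximableD[OF apv e2] obtain h where h: "continuous_on UNIV h" "bounded (range h)"
      "(\<integral>z. \<bar>v z - h z\<bar> \<partial>M) < e / 2" "(\<integral>z. \<bar>v z - h z\<bar> \<partial>N) < e / 2" by blast
    have "bounded (range (\<lambda>z. g z + h z))" by (rule bounded_plus_comp[OF g(2) h(2)])
    moreover have "continuous_on UNIV (\<lambda>z. g z + h z)" using g h by (intro continuous_intros)
    moreover have "(\<integral>z. \<bar>u z + v z - (g z + h z)\<bar> \<partial>M) < e" "(\<integral>z. \<bar>u z + v z - (g z + h z)\<bar> \<partial>N) < e"
      using tri[OF M g(1,2) h(1,2)] tri[OF N g(1,2) h(1,2)] g h by simp_all
    ultimately show "\<exists>k. continuous_on UNIV k \<and> bounded (range k) \<and>
         (\<integral>z. \<bar>(v z + u z) - k z\<bar> \<partial>M) < e \<and> (\<integral>z. \<bar>(v z + u z) - k z\<bar> \<partial>N) < e"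
      by (intro exI[of _ "\<lambda>z. g z + h z"]) (simp add: add.commute)
  qed
next
  case (seq U)
  obtain B where B: "\<And>z. norm (f z) \<le> B" using seq.prems by (auto simp: bounded_iff)
  have le: "U i z \<le> f z" for i z
    using seq.hyps by (intro incseq_le[of "\<lambda>i. U i z"]) (auto simp: incseq_def le_fun_def)
  have Ub: "norm (U i z) \<le> B" for i z using le[of i z] B[of z] seq.hyps(2)[of i z] by simp
  then have bU: "bounded (range (U i))" for i by (auto simp: bounded_iff)
  then have ap: "L1_approximable M N (U i)" for i using seq.IH by blast
  have um: "f \<in> borel_measurable borel"
    by (rule borel_measurable_LIMSEQ_real[of _ U]) (use seq.hyps in auto)
  have tri: "(\<integral>z. \<bar>f z - g z\<bar> \<partial>L) \<le> (\<integral>z. \<bar>f z - U i z\<bar> \<partial>L) + (\<integral>z. \<bar>U i z - g z\<bar> \<partial>L)"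
    if L: "finite_measure L" "sets L = sets borel" and g: "continuous_on UNIV g" "bounded (range g)" for L g i
  proof -
    have i: "integrable L f" "integrable L (U i)" "integrable L g"
      by (intro integrable_bounded[OF L] um seq.hyps(1) seq.prems bU g(2) borel_measurable_continuous_onI g(1))+
    have "(\<integral>z. \<bar>f z - g z\<bar> \<partial>L) \<le> (\<integral>z. \<bar>f z - U i z\<bar> + \<bar>U i z - g z\<bar> \<partial>L)"
      using i by (intro integral_mono integrable_abs Bochner_Integration.integrable_diff
          Bochner_Integration.integrable_add) auto
    also have "\<dots> = (\<integral>z. \<bar>f z - U i z\<bar> \<partial>L) + (\<integral>z. \<bar>U i z - g z\<bar> \<partial>L)"
      using i by (intro Bochner_Integration.integral_add integrable_abs Bochner_Integration.integrable_diff)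
    finally show ?thesis .
  qed
  have lim: "(\<lambda>i. \<integral>z. \<bar>f z - U i z\<bar> \<partial>L) \<longlonglongrightarrow> (\<integral>z. 0 \<partial>L)"
    if L: "finite_measure L" "sets L = sets borel" for L
  proof (rule integral_dominated_convergence[where w = "\<lambda>_. B"])
    show "integrable L (\<lambda>_. B)" using L(1) by (rule finite_measure.integrable_const)
    show "AE z in L. (\<lambda>i. \<bar>f z - U i z\<bar>) \<longlonglongrightarrow> 0"
    proof (rule AE_I2)
      fix z
      have "(\<lambda>i. \<bar>f z - U i z\<bar>) \<longlonglongrightarrow> \<bar>f z - f z\<bar>"
        using seq.hyps by (intro tendsto_intros) auto
      then show "(\<lambda>i. \<bar>f z - U i z\<bar>) \<longlonglongrightarrow> 0" by simp
    qed
    show "AE z in L. norm \<bar>f z - U i z\<bar> \<le> B" for i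
      using le[of i] B seq.hyps(2)[of i] by (intro AE_I2) (simp add: abs_le_iff, smt (verit))
  qed (use um seq.hyps(1) L in \<open>auto cong: measurable_cong_sets\<close>)
  show ?case
    unfolding L1_approximable_def
  proof (intro allI impI)
    fix e :: real assume "e > 0"
    then have e2: "e / 2 > 0" by simp
    have "eventually (\<lambda>i. (\<integral>z. \<bar>f z - U i z\<bar> \<partial>M) < e / 2 \<and> (\<integral>z. \<bar>f z - U i z\<bar> \<partial>N) < e / 2) sequentially"
      using e2 by (intro eventually_conj order_tendstoD(2)[OF lim[OF M]] order_tendstoD(2)[OF lim[OF N]]) simp_all
    then obtain i where i: "(\<integral>z. \<bar>f z - U i z\<bar> \<partial>M) < e / 2" "(\<integral>z. \<bar>f z - U i z\<bar> \<partial>N) < e / 2"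
      by (auto simp: eventually_sequentially)
    from L1_approximableD[OF ap e2] obtain g where g: "continuous_on UNIV g" "bounded (range g)"
      "(\<integral>z. \<bar>U i z - g z\<bar> \<partial>M) < e / 2" "(\<integral>z. \<bar>U i z - g z\<bar> \<partial>N) < e / 2" by blast
    have "(\<integral>z. \<bar>f z - g z\<bar> \<partial>M) < e" "(\<integral>z. \<bar>f z - g z\<bar> \<partial>N) < e"
      using tri[OF M g(1,2), of i] tri[OF N g(1,2), of i] i g by simp_all
    then show "\<exists>g. continuous_on UNIV g \<and> bounded (range g) \<and>
         (\<integral>z. \<bar>f z - g z\<bar> \<partial>M) < e \<and> (\<integral>z. \<bar>f z - g z\<bar> \<partial>N) < e"
      using g by blast
  qed
qed

section \<open>The weighted entropy\<close>

lemma Arg2pi_cis: "0 \<le> t \<Longrightarrow> t < 2 * pi \<Longrightarrow> Arg2pi (cis t) = t"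
  by (rule Arg2pi_unique[of 1]) (simp_all add: cis_conv_exp mult.commute)

text \<open>\<open>Arg2pi\<close> is continuous off the closed half-line of nonnegative reals and is
  0 on it.\<close>

lemma borel_measurable_Arg2pi: "Arg2pi \<in> borel_measurable borel"
proof -
  have "(\<lambda>z. if z \<in> \<real>\<^sub>\<ge>\<^sub>0 then 0 else Arg2pi z) \<in> borel_measurable borel"
    by (intro borel_measurable_continuous_on_if continuous_at_imp_continuous_on ballI continuous_at_Arg2pi)
      (auto intro: borel_closed)
  moreover have "(\<lambda>z. if z \<in> \<real>\<^sub>\<ge>\<^sub>0 then 0 else Arg2pi z) = Arg2pi"
    by (auto simp: fun_eq_iff Arg2pi_eq_0 complex_nonneg_Reals_iff complex_is_Real_iff)
  ultimately show ?thesis by simp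
qed

lemma AE_angle_measure_Arg2pi: "AE t in angle_measure. Arg2pi (cis t) = t"
  unfolding angle_measure_def
  by (rule AE_uniform_measureI) (use AE_lborel_singleton[of "2 * pi"] in \<open>auto elim!: eventually_mono intro!: Arg2pi_cis\<close>)

definition weight :: "nat \<Rightarrow> real \<Rightarrow> real" where
  "weight n t = 1 - cos (real n * t)"

definition circle_weight :: "nat \<Rightarrow> complex \<Rightarrow> real" where
  "circle_weight n z = 1 - Re (z ^ n)"

lemma circle_weight_cis: "circle_weight n (cis t) = weight n t"
  by (simp add: circle_weight_def weight_def Complex.DeMoivre)

lemma weight_bounds: "0 \<le> weight n t" "weight n t \<le> 2"
  by (simp_all add: weight_def)

lemma circle_weight_bounds:
  assumes "norm z = 1"
  shows "0 \<le> circle_weight n z" "circle_weight n z \<le> 2"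
proof -
  have "\<bar>Re (z ^ n)\<bar> \<le> 1" using abs_Re_le_cmod[of "z ^ n"] assms by (simp add: norm_power)
  then show "0 \<le> circle_weight n z" "circle_weight n z \<le> 2" by (auto simp: circle_weight_def)
qed

lemma continuous_weight [continuous_intros]: "continuous_on A (weight n)"
  unfolding weight_def by (intro continuous_intros)

lemma continuous_circle_weight [continuous_intros]: "continuous_on A (circle_weight n)"
  unfolding circle_weight_def by (intro continuous_intros)

lemma weight_measurable [measurable]: "weight n \<in> borel_measurable borel"
  by (intro borel_measurable_continuous_onI continuous_intros)

lemma circle_weight_measurable [measurable]: "circle_weight n \<in> borel_measurable borel"
  by (intro borel_measurable_continuous_onI continuous_intros)

lemma integrable_angle_bounded:
  fixes f :: "real \<Rightarrow> real"
  assumes "f \<in> borel_measurable borel" "AE t in angle_measure. \<bar>f t\<bar> \<le> B"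
  shows "integrable angle_measure f"
  using assms by (intro angle.integrable_const_bound[of _ B]) (auto cong: measurable_cong_sets)

context opuc
begin

lemma emeasure_1: "emeasure \<mu> UNIV = 1"
proof -
  interpret prob_space \<mu> using mu by (simp add: nontrivial_circle_measure_def)
  show ?thesis using emeasure_space_1 sets_eq_imp_space_eq[OF sets_eq] by simp
qed

definition entropy :: "nat \<Rightarrow> nat \<Rightarrow> real" where
  "entropy n N = (\<integral>t. weight n t * ln (bs_density N t) \<partial>angle_measure)"

lemma integrable_weight_ln_bs: "integrable angle_measure (\<lambda>t. weight n t * ln (bs_density N t))"
  by (intro integrable_angle_measure continuous_intros continuous_bs_density)
    (use bs_density_pos in \<open>auto simp: less_imp_neq[symmetric]\<close>)

text \<open>Since \<open>ln x \<le> x - 1\<close> with \<open>x = w\<^sub>N h\<close>, the entropy of the approximations controls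
  the integral of \<open>ln h\<close> by that of \<open>h\<close>.\<close>

lemma entropy_continuous_bound:
  fixes h :: "complex \<Rightarrow> real"
  assumes h: "continuous_on UNIV h" "\<And>z. h z > 0" and C: "\<And>N. entropy n N \<ge> - C"
  shows "(\<integral>t. weight n t * ln (h (cis t)) \<partial>angle_measure) \<le> (\<integral>z. circle_weight n z * h z \<partial>\<mu>) + C"
proof -
  let ?I = "\<integral>t. weight n t * ln (h (cis t)) \<partial>angle_measure"
  have ch: "continuous_on UNIV (\<lambda>t. h (cis t))"
    by (rule continuous_on_cis_compose) (rule continuous_on_subset[OF h(1)], simp)
  have i1: "integrable angle_measure (\<lambda>t. weight n t * ln (h (cis t)))"
    using h(2) by (intro integrable_angle_measure continuous_intros ch) (auto simp: less_imp_neq[symmetric])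
  have "?I - C \<le> (\<integral>z. circle_weight n z * h z \<partial>bs_measure N)" for N
  proof -
    have i2: "integrable angle_measure (\<lambda>t. bs_density N t * (weight n t * h (cis t)))"
      by (intro integrable_angle_measure continuous_intros continuous_bs_density ch)
    have "entropy n N + ?I = (\<integral>t. weight n t * ln (bs_density N t) + weight n t * ln (h (cis t)) \<partial>angle_measure)"
      unfolding entropy_def using integrable_weight_ln_bs i1 by simp
    also have "\<dots> \<le> (\<integral>t. bs_density N t * (weight n t * h (cis t)) \<partial>angle_measure)"
    proof (intro integral_mono Bochner_Integration.integrable_add integrable_weight_ln_bs i1 i2)
      fix t
      have "ln (bs_density N t) + ln (h (cis t)) = ln (bs_density N t * h (cis t))"
        using bs_density_pos[of N t] h(2)[of "cis t"] by (simp add: ln_mult)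
      also have "\<dots> \<le> bs_density N t * h (cis t)"
        using bs_density_pos[of N t] h(2)[of "cis t"] ln_le_minus_one[of "bs_density N t * h (cis t)"] by simp
      finally have "weight n t * (ln (bs_density N t) + ln (h (cis t))) \<le> weight n t * (bs_density N t * h (cis t))"
        by (intro mult_left_mono weight_bounds)
      then show "weight n t * ln (bs_density N t) + weight n t * ln (h (cis t)) \<le> bs_density N t * (weight n t * h (cis t))"
        by (simp add: algebra_simps)
    qed
    also have "\<dots> = (\<integral>z. circle_weight n z * h z \<partial>bs_measure N)"
      by (subst integral_bs_measure)
        (auto simp: circle_weight_cis intro!: borel_measurable_continuous_onI continuous_intros h(1))
    finally show ?thesis using C[of N] by simp
  qed
  moreover have "(\<lambda>N. \<integral>z. circle_weight n z * h z \<partial>bs_measure N) \<longlonglongrightarrow> (\<integral>z. circle_weight n z * h z \<partial>\<mu>)"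
    by (intro bs_measure_tendsto continuous_intros h(1))
  ultimately have "?I - C \<le> (\<integral>z. circle_weight n z * h z \<partial>\<mu>)" by (intro LIMSEQ_le_const) auto
  then show ?thesis by simp
qed

text \<open>Reduction to continuous test functions by approximation in L^1 of arc length and of
  \<mu>. The values must stay at or above 1, where the logarithm is Lipschitz with constant
  1.\<close>

lemma entropy_borel_bound:
  fixes h :: "complex \<Rightarrow> real"
  assumes h: "h \<in> borel_measurable borel" "\<And>z. 1 \<le> h z" "\<And>z. h z \<le> B"
    and C: "\<And>N. entropy n N \<ge> - C"
  shows "(\<integral>t. weight n t * ln (h (cis t)) \<partial>angle_measure) \<le> (\<integral>z. circle_weight n z * h z \<partial>\<mu>) + C"
proof (rule field_le_epsilon)
  fix e :: real assume e: "e > 0"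
  define m where "m = distr angle_measure borel cis"
  have m: "finite_measure m" "sets m = sets borel"
    unfolding m_def by (auto intro!: prob_space.finite_measure angle.prob_space_distr)
  have [measurable]: "h \<in> borel_measurable borel" by (rule h)
  have "norm (h z) \<le> B" for z using h(2)[of z] h(3)[of z] by simp
  then have bh: "bounded (range h)" by (auto simp: bounded_iff)
  have "L1_approximable m \<mu> h"
    by (rule L1_approximable_bounded[OF m finite_measure_axioms sets_eq h(1) _ bh])
      (use h(2) in \<open>auto intro: order_trans[of 0 1]\<close>)
  \<comment> \<open>The weight is at most 2, so each of the two replacements of h costs at most 2
    (e/4) = e/2.\<close>
  moreover have "e / 4 > 0" using e by simp
  ultimately obtain f where f: "continuous_on UNIV f" "bounded (range f)"
    "(\<integral>z. \<bar>h z - f z\<bar> \<partial>m) < e / 4" "(\<integral>z. \<bar>h z - f z\<bar> \<partial>\<mu>) < e / 4"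
    by (rule L1_approximableD)
  \<comment> \<open>Clamping to [1, B], where h takes its values, does not increase the distance to
    h.\<close>
  define g where "g = (\<lambda>z. max 1 (min B (f z)))"
  have clamp: "1 \<le> max 1 (min B y) \<and> max 1 (min B y) \<le> B \<and> \<bar>x - max 1 (min B y)\<bar> \<le> \<bar>x - y\<bar>"
    if "1 \<le> x" "x \<le> B" for x y :: real
    using that by (auto simp: max_def min_def abs_if)
  have "g z \<ge> 1" "\<bar>h z - g z\<bar> \<le> \<bar>h z - f z\<bar>" "g z \<le> B" for z
    using clamp[of "h z" "f z"] h(2)[of z] h(3)[of z] unfolding g_def by blast+
  moreover have "continuous_on UNIV g" unfolding g_def by (intro continuous_intros f(1))
  ultimately have g: "continuous_on UNIV g" "\<And>z. g z \<ge> 1" "\<And>z. \<bar>h z - g z\<bar> \<le> \<bar>h z - f z\<bar>" "\<And>z. g z \<le> B"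
    by blast+
  have [measurable]: "f \<in> borel_measurable borel" "g \<in> borel_measurable borel"
    by (auto intro!: borel_measurable_continuous_onI f g)
  have "norm (g z) \<le> B" for z using g(2)[of z] g(4)[of z] by simp
  then have bg: "bounded (range g)" by (auto simp: bounded_iff)
  have bound_ln: "\<bar>weight n t * ln (k (cis t))\<bar> \<le> 2 * ln B" if "\<And>z. 1 \<le> k z" "\<And>z. k z \<le> B" for k t
  proof -
    have "0 \<le> ln (k (cis t))" "ln (k (cis t)) \<le> ln B"
      using that[of "cis t"] by (auto intro!: ln_mono)
    then have "weight n t * ln (k (cis t)) \<le> 2 * ln B" using weight_bounds[of n t] by (intro mult_mono) auto
    then show ?thesis using weight_bounds[of n t] \<open>0 \<le> ln _\<close> by simp
  qed
  have ig: "integrable angle_measure (\<lambda>t. weight n t * ln (g (cis t)))"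
    and ih: "integrable angle_measure (\<lambda>t. weight n t * ln (h (cis t)))"
    using bound_ln[of g, OF g(2,4)] bound_ln[of h, OF h(2,3)]
    by (auto intro!: integrable_angle_bounded[of _ "2 * ln B"])
  have if': "integrable m (\<lambda>z. \<bar>h z - f z\<bar>)" "integrable \<mu> (\<lambda>z. \<bar>h z - f z\<bar>)"
    by (intro integrable_abs Bochner_Integration.integrable_diff
       integrable_bounded[OF m] integrable_bounded[OF finite_measure_axioms sets_eq] f bh; measurable)+
  have if2: "integrable angle_measure (\<lambda>t. \<bar>h (cis t) - f (cis t)\<bar>)"
    using if'(1) unfolding m_def by (subst (asm) integrable_distr_eq) auto
  have "(\<integral>t. weight n t * ln (h (cis t)) \<partial>angle_measure) - (\<integral>t. weight n t * ln (g (cis t)) \<partial>angle_measure)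
      = (\<integral>t. weight n t * ln (h (cis t)) - weight n t * ln (g (cis t)) \<partial>angle_measure)"
    using ig ih by simp
  also have "\<dots> \<le> (\<integral>t. 2 * \<bar>h (cis t) - f (cis t)\<bar> \<partial>angle_measure)"
  proof (intro integral_mono Bochner_Integration.integrable_diff ig ih integrable_mult_right if2)
    fix t
    let ?z = "cis t"
    have gz: "g ?z > 0" and hz: "h ?z > 0" using g(2)[of ?z] h(2)[of ?z] by auto
    have "ln (h ?z) - ln (g ?z) \<le> (h ?z - g ?z) / g ?z" by (rule ln_diff_le[OF hz gz])
    also have "\<dots> \<le> \<bar>h ?z - g ?z\<bar> / 1" using g(2)[of ?z] by (intro frac_le) auto
    also have "\<dots> \<le> \<bar>h ?z - f ?z\<bar>" using g(3) by simp
    finally have "weight n t * (ln (h ?z) - ln (g ?z)) \<le> weight n t * \<bar>h ?z - f ?z\<bar>"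
      by (intro mult_left_mono weight_bounds)
    also have "\<dots> \<le> 2 * \<bar>h ?z - f ?z\<bar>" by (intro mult_right_mono weight_bounds) auto
    finally show "weight n t * ln (h ?z) - weight n t * ln (g ?z) \<le> 2 * \<bar>h ?z - f ?z\<bar>"
      by (simp add: right_diff_distrib)
  qed
  also have "\<dots> = 2 * (\<integral>z. \<bar>h z - f z\<bar> \<partial>m)"
    unfolding m_def by (subst integral_distr) auto
  also have "\<dots> \<le> e / 2" using f by simp
  finally have 1: "(\<integral>t. weight n t * ln (h (cis t)) \<partial>angle_measure)
    \<le> (\<integral>t. weight n t * ln (g (cis t)) \<partial>angle_measure) + e / 2" by simp
  have 2: "(\<integral>t. weight n t * ln (g (cis t)) \<partial>angle_measure) \<le> (\<integral>z. circle_weight n z * g z \<partial>\<mu>) + C"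
    using g by (intro entropy_continuous_bound C) (auto intro: less_le_trans[of 0 1])
  have ik: "integrable \<mu> (\<lambda>z. circle_weight n z * k z)" if [measurable]: "k \<in> borel_measurable borel"
    and k: "\<And>z. norm (k z) \<le> B" for k
  proof (rule integrable_const_bound[of _ "2 * B"])
    show "AE z in \<mu>. norm (circle_weight n z * k z) \<le> 2 * B"
      using AE_sphere
    proof eventually_elim
      case (elim z)
      then show ?case using circle_weight_bounds[of z n] k[of z]
        by (auto simp: abs_mult intro!: mult_mono)
    qed
    have "(\<lambda>z. circle_weight n z * k z) \<in> borel_measurable borel" by measurable
    then show "(\<lambda>z. circle_weight n z * k z) \<in> borel_measurable \<mu>" using sets_eq by (simp cong: measurable_cong_sets)
  qed
  have ikg: "integrable \<mu> (\<lambda>z. circle_weight n z * g z)" and ikh: "integrable \<mu> (\<lambda>z. circle_weight n z * h z)"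
    by (intro ik \<open>\<And>z. norm (g z) \<le> B\<close> \<open>\<And>z. norm (h z) \<le> B\<close>; measurable)+
  have "(\<integral>z. circle_weight n z * g z \<partial>\<mu>) \<le> (\<integral>z. circle_weight n z * h z + 2 * \<bar>h z - f z\<bar> \<partial>\<mu>)"
  proof (intro integral_mono_AE Bochner_Integration.integrable_add ikg ikh integrable_mult_right if')
    show "AE z in \<mu>. circle_weight n z * g z \<le> circle_weight n z * h z + 2 * \<bar>h z - f z\<bar>"
      using AE_sphere
    proof eventually_elim
      case (elim z)
      then have cw: "0 \<le> circle_weight n z" "circle_weight n z \<le> 2" using circle_weight_bounds by auto
      have "circle_weight n z * (g z - h z) \<le> circle_weight n z * \<bar>h z - f z\<bar>"
        using cw(1) g(3)[of z] by (intro mult_left_mono) auto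
      also have "\<dots> \<le> 2 * \<bar>h z - f z\<bar>" using cw(2) by (intro mult_right_mono) auto
      finally have "circle_weight n z * (g z - h z) \<le> 2 * \<bar>h z - f z\<bar>" .
      then show ?case by (simp add: algebra_simps)
    qed
  qed
  also have "\<dots> = (\<integral>z. circle_weight n z * h z \<partial>\<mu>) + 2 * (\<integral>z. \<bar>h z - f z\<bar> \<partial>\<mu>)"
    using ikh if'(2) by simp
  also have "\<dots> \<le> (\<integral>z. circle_weight n z * h z \<partial>\<mu>) + e / 2" using f by simp
  finally show "(\<integral>t. weight n t * ln (h (cis t)) \<partial>angle_measure) \<le> (\<integral>z. circle_weight n z * h z \<partial>\<mu>) + C + e"
    using 1 2 by simp
qed

end

section \<open>Comparison of the entropies with the logarithm of w\<close>

locale opuc_decomposition = opuc +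
  fixes w :: "real \<Rightarrow> real" and \<mu>s :: "complex measure"
  assumes decomposition: "circle_lebesgue_decomposition \<mu> w \<mu>s"
begin

definition ac :: "complex measure" where
  "ac = distr (density angle_measure (\<lambda>t. ennreal (w t))) borel cis"

lemma sets_ac [measurable_cong, simp]: "sets ac = sets borel"
  by (simp add: ac_def)

lemma w_measurable [measurable]: "w \<in> borel_measurable borel"
  and sets_\<mu>s: "sets \<mu>s = sets borel"
  and emeasure_eq: "A \<in> sets borel \<Longrightarrow> emeasure \<mu> A = emeasure ac A + emeasure \<mu>s A"
  using decomposition by (auto simp: circle_lebesgue_decomposition_def ac_def)

lemma AE_w_nonneg: "AE t in angle_measure. 0 \<le> w t"
  using AE_angle_measure_range
  by eventually_elim (use decomposition in \<open>auto simp: circle_lebesgue_decomposition_def\<close>)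

lemma nn_integral_ac:
  assumes [measurable]: "f \<in> borel_measurable borel"
  shows "(\<integral>\<^sup>+z. f z \<partial>ac) = (\<integral>\<^sup>+t. ennreal (w t) * f (cis t) \<partial>angle_measure)"
  unfolding ac_def by (subst nn_integral_distr, simp_all, subst nn_integral_density) auto

lemma nn_integral_ac_le:
  assumes [measurable]: "f \<in> borel_measurable borel"
  shows "(\<integral>\<^sup>+z. f z \<partial>ac) \<le> (\<integral>\<^sup>+z. f z \<partial>\<mu>)"
proof (rule nn_integral_mono_measure)
  show "ac \<le> \<mu>"
  proof (subst le_measure)
    show "\<forall>A\<in>sets ac. emeasure ac A \<le> emeasure \<mu> A" by (simp add: emeasure_eq)
  qed simp
qed simp

lemma nn_integral_w_le: "(\<integral>\<^sup>+t. ennreal (w t) \<partial>angle_measure) \<le> 1"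
  using nn_integral_ac[of "\<lambda>_. 1"] nn_integral_ac_le[of "\<lambda>_. 1"] emeasure_1
    sets_eq_imp_space_eq[OF sets_eq] by simp

text \<open>The entropy inequality is applied to test functions h_k whose integrals against \<mu>
  are bounded uniformly in k, although h_k increases to 1 / min(w, 1) off the singular part.
  Monotone convergence then bounds the negative part of P ln w.\<close>

lemma entropy_bounded_imp_negative_part_finite:
  assumes C: "\<And>N. entropy n N \<ge> - C"
  shows "(\<integral>\<^sup>+t. e2ennreal (- (ereal (weight n t) * ext_log (w t))) \<partial>angle_measure) < \<infinity>"
proof -
  obtain N where N: "N \<in> null_sets (distr angle_measure borel cis)" "emeasure \<mu>s (- N) = 0"
    using decomposition by (auto simp: circle_lebesgue_decomposition_def)
  have [measurable]: "N \<in> sets borel" using N(1) by (simp add: null_sets_def)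
  have AE_N: "AE t in angle_measure. cis t \<notin> N"
    using AE_distrD[OF _ AE_not_in[OF N(1)]] by simp
  have restr: "density \<mu> (indicator (- N)) = density ac (indicator (- N))"
  proof (rule measure_eqI)
    fix A assume "A \<in> sets (density \<mu> (indicator (- N)))"
    then have [measurable]: "A \<in> sets borel" by simp
    have "emeasure \<mu>s (- N \<inter> A) \<le> emeasure \<mu>s (- N)" by (rule emeasure_mono) (auto simp: sets_\<mu>s)
    then have "emeasure \<mu>s (- N \<inter> A) = 0" using N(2) by simp
    then show "emeasure (density \<mu> (indicator (- N))) A = emeasure (density ac (indicator (- N))) A"
      by (simp add: emeasure_restricted emeasure_eq)
  qed simp
  have [measurable]: "Arg2pi \<in> borel_measurable borel" by (rule borel_measurable_Arg2pi)
  \<comment> \<open>The cap at 1 gives h \<ge> 1 and discards the positive part of ln w, the floor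
    1/(k+1) keeps h bounded, and the value 1 on N makes the singular part harmless.\<close>
  define h where "h = (\<lambda>k::nat. \<lambda>z. if z \<in> N then 1 else 1 / max (min (w (Arg2pi z)) 1) (1 / real (Suc k)))"
  have [measurable]: "h k \<in> borel_measurable borel" for k unfolding h_def by measurable
  have h1: "1 \<le> h k z" for k z
  proof -
    have "max (min (w (Arg2pi z)) 1) (1 / real (Suc k)) > 0" by (simp add: less_max_iff_disj)
    moreover have "max (min (w (Arg2pi z)) 1) (1 / real (Suc k)) \<le> 1" by simp
    ultimately show ?thesis unfolding h_def by (simp only: le_divide_eq_1_pos split: if_split) simp
  qed
  have hk: "h k z \<le> real (Suc k)" for k z
  proof -
    have "1 / max (min (w (Arg2pi z)) 1) (1 / real (Suc k)) \<le> 1 / (1 / real (Suc k))"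
      by (rule divide_left_mono) (auto simp: less_max_iff_disj zero_less_divide_iff)
    then show ?thesis by (simp add: h_def)
  qed
  have wh: "ennreal (w t) * ennreal (h k (cis t)) \<le> 1 + ennreal (w t)"
    if "0 \<le> w t" "cis t \<notin> N" "Arg2pi (cis t) = t" for k t
  proof -
    have "w t * h k (cis t) \<le> 1 + w t"
    proof (cases "w t \<le> 1")
      case True
      have "w t / max (w t) (1 / real (Suc k)) \<le> 1" using that by (simp add: divide_le_eq_1 less_max_iff_disj)
      then show ?thesis using that True by (simp add: h_def)
    next
      case False
      then show ?thesis using that by (simp add: h_def)
    qed
    then show ?thesis using that h1[of k "cis t"]
      by (simp flip: ennreal_mult'' ennreal_plus ennreal_1 add: ennreal_leI)
  qed
  \<comment> \<open>With weight at most 2: the set N contributes at most 2 as h = 1 there, and the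
    rest at most 2 (1 + 1), since w h \<le> 1 + w and w has integral at most 1.\<close>
  have bound: "(\<integral>z. circle_weight n z * h k z \<partial>\<mu>) \<le> 6" for k
  proof -
    have AEb: "AE z in \<mu>. 0 \<le> circle_weight n z * h k z"
      using AE_sphere
    proof eventually_elim
      case (elim z)
      then show ?case using circle_weight_bounds[of z n] h1[of k z] by simp
    qed
    have int: "integrable \<mu> (\<lambda>z. circle_weight n z * h k z)"
    proof (rule integrable_const_bound[of _ "2 * real (Suc k)"])
      show "AE z in \<mu>. norm (circle_weight n z * h k z) \<le> 2 * real (Suc k)"
        using AE_sphere
      proof eventually_elim
        case (elim z)
        then have "circle_weight n z * h k z \<le> 2 * real (Suc k)"
          using circle_weight_bounds[of z n] h1[of k z] hk[of k z] by (intro mult_mono) auto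
        then show ?case using elim circle_weight_bounds[of z n] h1[of k z] by simp
      qed
      have "(\<lambda>z. circle_weight n z * h k z) \<in> borel_measurable borel" by measurable
      then show "(\<lambda>z. circle_weight n z * h k z) \<in> borel_measurable \<mu>" using sets_eq by (simp cong: measurable_cong_sets)
    qed
    have "ennreal (\<integral>z. circle_weight n z * h k z \<partial>\<mu>) = (\<integral>\<^sup>+z. ennreal (circle_weight n z * h k z) \<partial>\<mu>)"
      by (rule nn_integral_eq_integral[OF int AEb, symmetric])
    also have "\<dots> \<le> (\<integral>\<^sup>+z. 2 + indicator (- N) z * (2 * ennreal (h k z)) \<partial>\<mu>)"
    proof (rule nn_integral_mono_AE)
      show "AE z in \<mu>. ennreal (circle_weight n z * h k z) \<le> 2 + indicator (- N) z * (2 * ennreal (h k z))"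
        using AE_sphere
      proof eventually_elim
        case (elim z)
        have "ennreal (circle_weight n z * h k z) \<le> ennreal (2 * h k z)"
          using elim circle_weight_bounds[of z n] h1[of k z] by (intro ennreal_leI mult_right_mono) auto
        also have "\<dots> = 2 * ennreal (h k z)" using h1[of k z] by (simp add: ennreal_mult)
        also have "\<dots> \<le> 2 + indicator (- N) z * (2 * ennreal (h k z))"
          by (cases "z \<in> N") (simp_all add: h_def add_increasing)
        finally show ?case .
      qed
    qed
    also have "\<dots> = 2 + (\<integral>\<^sup>+z. indicator (- N) z * (2 * ennreal (h k z)) \<partial>\<mu>)"
      using emeasure_1 sets_eq_imp_space_eq[OF sets_eq] by (subst nn_integral_add) auto
    also have "(\<integral>\<^sup>+z. indicator (- N) z * (2 * ennreal (h k z)) \<partial>\<mu>) = (\<integral>\<^sup>+z. 2 * ennreal (h k z) \<partial>density \<mu> (indicator (- N)))"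
      by (rule nn_integral_density[symmetric]) auto
    also have "\<dots> = (\<integral>\<^sup>+z. indicator (- N) z * (2 * ennreal (h k z)) \<partial>ac)"
      unfolding restr by (rule nn_integral_density) auto
    also have "\<dots> = (\<integral>\<^sup>+t. ennreal (w t) * (indicator (- N) (cis t) * (2 * ennreal (h k (cis t)))) \<partial>angle_measure)"
      by (rule nn_integral_ac) measurable
    also have "\<dots> \<le> (\<integral>\<^sup>+t. 2 * (1 + ennreal (w t)) \<partial>angle_measure)"
    proof (rule nn_integral_mono_AE)
      show "AE t in angle_measure. ennreal (w t) * (indicator (- N) (cis t) * (2 * ennreal (h k (cis t)))) \<le> 2 * (1 + ennreal (w t))"
        using AE_w_nonneg AE_N AE_angle_measure_Arg2pi
      proof eventually_elim
        case (elim t)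
        have "ennreal (w t) * (indicator (- N) (cis t) * (2 * ennreal (h k (cis t)))) = 2 * (ennreal (w t) * ennreal (h k (cis t)))"
          using elim by (simp add: mult_ac)
        also have "\<dots> \<le> 2 * (1 + ennreal (w t))" by (intro mult_left_mono wh elim) auto
        finally show ?case .
      qed
    qed
    also have "\<dots> = 2 * (1 + (\<integral>\<^sup>+t. ennreal (w t) \<partial>angle_measure))"
      by (subst nn_integral_cmult, simp, subst nn_integral_add) (auto simp: angle.emeasure_space_1[simplified])
    also have "\<dots> \<le> 2 * (1 + 1)" by (intro mult_left_mono add_left_mono nn_integral_w_le) auto
    finally have "ennreal (\<integral>z. circle_weight n z * h k z \<partial>\<mu>) \<le> 2 + 2 * (1 + 1)" by (simp add: add_left_mono)
    also have "2 + 2 * (1 + 1) = ennreal 6" by simp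
    finally show ?thesis by (subst (asm) ennreal_le_iff) auto
  qed
  define q where "q = (\<lambda>k::nat. \<lambda>t. ennreal (weight n t * - ln (max (min (w t) 1) (1 / real (Suc k)))))"
  have [measurable]: "q k \<in> borel_measurable angle_measure" for k unfolding q_def by measurable
  have q_le: "(\<integral>\<^sup>+t. q k t \<partial>angle_measure) \<le> ennreal (6 + C)" for k
  proof -
    have ln0: "0 \<le> weight n t * ln (h k (cis t))" for t
      using h1[of k "cis t"] weight_bounds[of n t] by simp
    have int: "integrable angle_measure (\<lambda>t. weight n t * ln (h k (cis t)))"
    proof (rule integrable_angle_bounded[of _ "2 * ln (real (Suc k))"])
      have "weight n t * ln (h k (cis t)) \<le> 2 * ln (real (Suc k))" for t
        using weight_bounds[of n t] h1[of k "cis t"] hk[of k "cis t"] by (intro mult_mono) auto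
      then show "AE t in angle_measure. \<bar>weight n t * ln (h k (cis t))\<bar> \<le> 2 * ln (real (Suc k))"
        using ln0 by simp
    qed measurable
    have "(\<integral>\<^sup>+t. q k t \<partial>angle_measure) = (\<integral>\<^sup>+t. ennreal (weight n t * ln (h k (cis t))) \<partial>angle_measure)"
    proof (rule nn_integral_cong_AE)
      show "AE t in angle_measure. q k t = ennreal (weight n t * ln (h k (cis t)))"
        using AE_N AE_angle_measure_Arg2pi
      proof eventually_elim
        case (elim t)
        have "max (min (w t) 1) (1 / real (Suc k)) > 0" by (simp add: less_max_iff_disj)
        then show ?case using elim by (simp add: q_def h_def ln_div)
      qed
    qed
    also have "\<dots> = ennreal (\<integral>t. weight n t * ln (h k (cis t)) \<partial>angle_measure)"
      using ln0 by (intro nn_integral_eq_integral int) auto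
    also have "\<dots> \<le> ennreal (6 + C)"
      using entropy_borel_bound[of "h k" "real (Suc k)" C n] h1 hk C bound[of k]
      by (intro ennreal_leI) (simp, linarith?)
    finally show ?thesis .
  qed
  have inc: "incseq q"
    unfolding incseq_Suc_iff le_fun_def q_def
  proof (intro allI ennreal_leI mult_left_mono weight_bounds)
    fix k t
    have "1 / real (Suc (Suc k)) \<le> 1 / real (Suc k)" by (intro divide_left_mono) auto
    then have "ln (max (min (w t) 1) (1 / real (Suc (Suc k)))) \<le> ln (max (min (w t) 1) (1 / real (Suc k)))"
      by (intro ln_mono) (auto simp: less_max_iff_disj le_max_iff_disj)
    then show "- ln (max (min (w t) 1) (1 / real (Suc k))) \<le> - ln (max (min (w t) 1) (1 / real (Suc (Suc k))))" by simp
  qed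
  have "(\<integral>\<^sup>+t. e2ennreal (- (ereal (weight n t) * ext_log (w t))) \<partial>angle_measure) \<le> (\<integral>\<^sup>+t. (SUP k. q k t) \<partial>angle_measure)"
  proof (rule nn_integral_mono_AE)
    show "AE t in angle_measure. e2ennreal (- (ereal (weight n t) * ext_log (w t))) \<le> (SUP k. q k t)"
      using AE_w_nonneg
    proof eventually_elim
      case (elim t)
      consider "w t \<ge> 1" | "0 < w t" "w t < 1" | "w t = 0" using elim by linarith
      then show ?case
      proof cases
        case 1
        then have "- (ereal (weight n t) * ext_log (w t)) \<le> 0"
          using weight_bounds[of n t] by (simp add: ext_log_def)
        then show ?thesis by (simp add: e2ennreal_neg)
      next
        case 2
        obtain k where "1 / real (Suc k) < w t" using reals_Archimedean[OF 2(1)] by (auto simp: inverse_eq_divide)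
        then have "e2ennreal (- (ereal (weight n t) * ext_log (w t))) = q k t"
          using 2 by (simp add: q_def ext_log_def e2ennreal_ereal)
        then show ?thesis by (auto intro: SUP_upper)
      next
        case 3
        show ?thesis
        \<comment> \<open>At zeros of the weight the extended product 0 * (-\<infinity>) is 0. At
          other zeros of w the floor 1/(k+1) makes \<open>q k t\<close> exceed every bound as k
          grows.\<close>
        proof (cases "weight n t = 0")
          case True
          then show ?thesis by (simp add: zero_ereal_def[symmetric])
        next
          case False
          then have p: "weight n t > 0" using weight_bounds[of n t] by simp
          have "ennreal (real j) \<le> (SUP k. q k t)" for j
          proof -
            obtain k :: nat where k: "exp (real j / weight n t) < real k" using reals_Archimedean2 by blast
            then have "exp (real j / weight n t) \<le> real (Suc k)" by simp
            then have "real j / weight n t \<le> ln (real (Suc k))" by (subst ln_ge_iff) auto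
            then have "real j \<le> weight n t * ln (real (Suc k))" using p by (simp add: field_simps)
            also have "\<dots> = weight n t * - ln (max (min (w t) 1) (1 / real (Suc k)))"
              using 3 by (simp add: ln_div)
            finally have "ennreal (real j) \<le> q k t" unfolding q_def by (rule ennreal_leI)
            also have "\<dots> \<le> (SUP k. q k t)" by (rule SUP_upper) simp
            finally show ?thesis .
          qed
          then have "(SUP j. of_nat j) \<le> (SUP k. q k t)" by (intro SUP_least) (simp add: ennreal_of_nat_eq_real_of_nat)
          then have "(SUP k. q k t) = top" by (simp add: ennreal_SUP_of_nat_eq_top top_unique)
          then show ?thesis by (simp only: top_greatest)
        qed
      qed
    qed
  qed
  also have "\<dots> = (SUP k. \<integral>\<^sup>+t. q k t \<partial>angle_measure)"
    by (rule nn_integral_monotone_convergence_SUP[OF inc]) measurable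
  also have "\<dots> \<le> ennreal (6 + C)" by (intro SUP_least q_le)
  also have "\<dots> < \<infinity>" by simp
  finally show ?thesis .
qed

lemma ext_log_measurable: "(\<lambda>t. ereal (weight n t) * ext_log (w t)) \<in> borel_measurable borel"
  unfolding ext_log_def by measurable

text \<open>From ln x \<le> x and the integrability of w. With a finite positive part the extended
  integral is never a difference of two infinities.\<close>

lemma positive_part_finite:
  "(\<integral>\<^sup>+t. e2ennreal (ereal (weight n t) * ext_log (w t)) \<partial>angle_measure) < \<infinity>"
proof -
  have "(\<integral>\<^sup>+t. e2ennreal (ereal (weight n t) * ext_log (w t)) \<partial>angle_measure) \<le> (\<integral>\<^sup>+t. 2 * ennreal (w t) \<partial>angle_measure)"
  proof (rule nn_integral_mono_AE)
    show "AE t in angle_measure. e2ennreal (ereal (weight n t) * ext_log (w t)) \<le> 2 * ennreal (w t)"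
      using AE_w_nonneg
    proof eventually_elim
      case (elim t)
      show ?case
      proof (cases "w t > 0")
        case True
        have "weight n t * ln (w t) \<le> weight n t * w t"
          using ln_le_minus_one[OF True] by (intro mult_left_mono weight_bounds) simp
        also have "\<dots> \<le> 2 * w t" using elim by (intro mult_right_mono weight_bounds)
        finally have "ennreal (weight n t * ln (w t)) \<le> ennreal (2 * w t)" by (rule ennreal_leI)
        then show ?thesis using True by (simp add: ext_log_def e2ennreal_ereal ennreal_mult)
      next
        case False
        then have "ereal (weight n t) * ext_log (w t) \<le> 0" using weight_bounds[of n t] by (auto simp: ext_log_def)
        then show ?thesis by (simp add: e2ennreal_neg)
      qed
    qed
  qed
  also have "\<dots> = 2 * (\<integral>\<^sup>+t. ennreal (w t) \<partial>angle_measure)" by (rule nn_integral_cmult) simp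
  also have "\<dots> \<le> 2 * 1" by (intro mult_left_mono nn_integral_w_le) simp
  also have "\<dots> < \<infinity>" by (simp add: ennreal_mult_less_top)
  finally show ?thesis .
qed

lemma ext_integral_finite_iff:
  "ext_integral angle_measure (\<lambda>t. ereal (weight n t) * ext_log (w t)) > -\<infinity> \<longleftrightarrow>
   (\<integral>\<^sup>+t. e2ennreal (- (ereal (weight n t) * ext_log (w t))) \<partial>angle_measure) < \<infinity>"
proof -
  obtain a where a: "(\<integral>\<^sup>+t. e2ennreal (ereal (weight n t) * ext_log (w t)) \<partial>angle_measure) = ennreal a" "a \<ge> 0"
    using positive_part_finite[of n] by (metis ennreal_cases infinity_ennreal_def less_irrefl)
  show ?thesis
    unfolding ext_integral_def a
    by (cases "\<integral>\<^sup>+t. e2ennreal (- (ereal (weight n t) * ext_log (w t))) \<partial>angle_measure" rule: ennreal_cases)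
      (use a in \<open>auto simp: enn2ereal_ennreal\<close>)
qed

text \<open>ln (w / w_N) \<le> w / w_N, and 1 / w_N = |\<Phi>_N|^2 / \<omega>_N has \<mu>-integral
  1. The constant 2 is the maximum of the weight.\<close>

lemma negative_part_finite_imp_entropy_bounded:
  assumes fin: "(\<integral>\<^sup>+t. e2ennreal (- (ereal (weight n t) * ext_log (w t))) \<partial>angle_measure) < \<infinity>"
  shows "\<exists>C. \<forall>N. entropy n N \<ge> - C"
proof -
  let ?f = "\<lambda>t. ereal (weight n t) * ext_log (w t)"
  have m: "?f \<in> borel_measurable angle_measure" using ext_log_measurable by (simp cong: measurable_cong_sets)
  have "AE t in angle_measure. e2ennreal (- ?f t) \<noteq> \<infinity>"
    using fin m by (intro nn_integral_PInf_AE) auto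
  \<comment> \<open>Finiteness rules out w = 0 where the weight is positive, so up to a null set the
    weighted real logarithm, with ln 0 = 0, equals the weighted extended one.\<close>
  with AE_w_nonneg have pos: "AE t in angle_measure. w t > 0 \<or> w t = 0 \<and> weight n t = 0"
  proof eventually_elim
    case (elim t)
    show ?case
    proof (rule ccontr)
      assume "\<not> ?thesis"
      then have "w t = 0" "weight n t > 0" using elim weight_bounds[of n t] by auto
      then show False using elim by (simp add: ext_log_def e2ennreal_infty)
    qed
  qed
  have int: "integrable angle_measure (\<lambda>t. weight n t * ln (w t))"
  proof (rule integrableI_bounded)
    have "(\<integral>\<^sup>+t. ennreal (norm (weight n t * ln (w t))) \<partial>angle_measure)
        \<le> (\<integral>\<^sup>+t. e2ennreal (?f t) + e2ennreal (- ?f t) \<partial>angle_measure)"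
    proof (rule nn_integral_mono_AE)
      show "AE t in angle_measure. ennreal (norm (weight n t * ln (w t))) \<le> e2ennreal (?f t) + e2ennreal (- ?f t)"
        using pos
      proof eventually_elim
        case (elim t)
        then show ?case
          by (cases "weight n t * ln (w t) \<ge> 0") (auto simp: ext_log_def e2ennreal_ereal ennreal_neg add_increasing add_increasing2)
      qed
    qed
    also have "\<dots> = (\<integral>\<^sup>+t. e2ennreal (?f t) \<partial>angle_measure) + (\<integral>\<^sup>+t. e2ennreal (- ?f t) \<partial>angle_measure)"
      using m by (intro nn_integral_add) auto
    also have "\<dots> < \<infinity>" using fin positive_part_finite[of n] by simp
    finally show "(\<integral>\<^sup>+t. ennreal (norm (weight n t * ln (w t))) \<partial>angle_measure) < \<infinity>" .
  qed measurable
  have "entropy n N \<ge> - (2 - (\<integral>t. weight n t * ln (w t) \<partial>angle_measure))" for N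
  proof -
    have nn: "(\<integral>\<^sup>+t. ennreal (w t / bs_density N t) \<partial>angle_measure) \<le> 1"
    proof -
      have [measurable]: "poly (\<Phi> N) \<in> borel_measurable borel"
        by (intro borel_measurable_continuous_onI continuous_intros)
      have "(\<integral>\<^sup>+t. ennreal (w t / bs_density N t) \<partial>angle_measure)
          = (\<integral>\<^sup>+t. ennreal (w t) * ennreal (norm (poly (\<Phi> N) (cis t)) ^ 2 / \<omega> N) \<partial>angle_measure)"
      proof (rule nn_integral_cong_AE)
        show "AE t in angle_measure. ennreal (w t / bs_density N t) = ennreal (w t) * ennreal (norm (poly (\<Phi> N) (cis t)) ^ 2 / \<omega> N)"
          using AE_w_nonneg
          by eventually_elim (use \<omega>_pos[of N] in \<open>simp add: bs_density_def flip: ennreal_mult\<close>)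
      qed
      also have "\<dots> = (\<integral>\<^sup>+z. ennreal (norm (poly (\<Phi> N) z) ^ 2 / \<omega> N) \<partial>ac)"
        by (rule nn_integral_ac[symmetric]) measurable
      also have "\<dots> \<le> (\<integral>\<^sup>+z. ennreal (norm (poly (\<Phi> N) z) ^ 2 / \<omega> N) \<partial>\<mu>)"
        by (rule nn_integral_ac_le) measurable
      also have "\<dots> = ennreal (\<integral>z. norm (poly (\<Phi> N) z) ^ 2 / \<omega> N \<partial>\<mu>)"
        using \<omega>_pos[of N]
        by (intro nn_integral_eq_integral integrable_divide integrable_continuous continuous_intros) auto
      also have "(\<integral>z. norm (poly (\<Phi> N) z) ^ 2 / \<omega> N \<partial>\<mu>) = 1"
        using \<omega>_pos[of N] by (simp flip: \<omega>_eq_integral)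
      finally show ?thesis by simp
    qed
    have AE0: "AE t in angle_measure. 0 \<le> w t / bs_density N t"
      using AE_w_nonneg by eventually_elim (simp add: less_imp_le[OF bs_density_pos])
    have iw: "integrable angle_measure (\<lambda>t. w t / bs_density N t)"
      using nn AE0 by (intro integrableI_nonneg) (auto intro: le_less_trans)
    have iw1: "(\<integral>t. w t / bs_density N t \<partial>angle_measure) \<le> 1"
      using nn nn_integral_eq_integral[OF iw AE0] by simp
    have "(\<integral>t. weight n t * ln (w t) \<partial>angle_measure) \<le> (\<integral>t. weight n t * ln (bs_density N t) + 2 * (w t / bs_density N t) \<partial>angle_measure)"
    proof (rule integral_mono_AE)
      show "AE t in angle_measure. weight n t * ln (w t) \<le> weight n t * ln (bs_density N t) + 2 * (w t / bs_density N t)"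
        using pos AE0
      proof eventually_elim
        case (elim t)
        show ?case
        proof (cases "w t > 0")
          case True
          have b: "bs_density N t > 0" by (rule bs_density_pos)
          have "ln (w t) - ln (bs_density N t) = ln (w t / bs_density N t)" using True b by (simp add: ln_div)
          also have "\<dots> \<le> w t / bs_density N t" using ln_le_minus_one[of "w t / bs_density N t"] True b by simp
          finally have "weight n t * (ln (w t) - ln (bs_density N t)) \<le> weight n t * (w t / bs_density N t)"
            by (intro mult_left_mono weight_bounds)
          also have "\<dots> \<le> 2 * (w t / bs_density N t)" using elim by (intro mult_right_mono weight_bounds)
          finally show ?thesis by (simp add: right_diff_distrib)
        next
          case False
          then show ?thesis using elim by auto
        qed
      qed
    qed (intro int Bochner_Integration.integrable_add integrable_weight_ln_bs integrable_mult_right iw)+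
    also have "\<dots> = entropy n N + 2 * (\<integral>t. w t / bs_density N t \<partial>angle_measure)"
      unfolding entropy_def using integrable_weight_ln_bs iw by (simp del: times_divide_eq_right)
    finally show ?thesis using iw1 by simp
  qed
  then show ?thesis by blast
qed

end

section \<open>The step-by-step sum rule\<close>

context opuc
begin

definition ratio :: "nat \<Rightarrow> complex \<Rightarrow> complex" where
  "ratio k z = poly (\<Phi>s (Suc k)) z / poly (\<Phi>s k) z"

definition log_ratio :: "nat \<Rightarrow> complex \<Rightarrow> complex" where
  "log_ratio k z = Ln (ratio k z)"

definition log_coeff :: "nat \<Rightarrow> nat \<Rightarrow> complex" where
  "log_coeff k j = (deriv ^^ j) (log_ratio k) 0 / fact j"

text \<open>The Taylor series of b_k as a formal quotient, which exists because \<Phi>_k^* has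
  constant term 1; its recursions become pure algebra.\<close>

definition schur_fps :: "nat \<Rightarrow> complex fps" where
  "schur_fps k = fps_of_poly (\<Phi> k) * inverse (fps_of_poly (\<Phi>s k))"

lemma coeff_\<Phi>s_0: "coeff (\<Phi>s k) 0 = 1"
  using poly_\<Phi>s_0[of k] by (simp add: poly_0_coeff_0)

lemma schur_fps_mult: "schur_fps k * fps_of_poly (\<Phi>s k) = fps_of_poly (\<Phi> k)"
  unfolding schur_fps_def mult.assoc
  by (subst inverse_mult_eq_1) (simp_all add: coeff_\<Phi>s_0)

lemma fps_\<Phi>s_Suc: "fps_of_poly (\<Phi>s (Suc k)) =
    (1 - fps_const (\<alpha> k) * (fps_X * schur_fps k)) * fps_of_poly (\<Phi>s k)"
proof -
  have "fps_of_poly (\<Phi>s (Suc k)) = fps_of_poly (\<Phi>s k) - fps_const (\<alpha> k) * (fps_X * fps_of_poly (\<Phi> k))"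
    by (simp add: szego_recursion_reversed fps_of_poly_diff fps_of_poly_smult fps_of_poly_pCons mult_ac)
  then show ?thesis unfolding schur_fps_mult[of k, symmetric] by (simp add: algebra_simps)
qed

lemma fps_\<Phi>_Suc: "fps_of_poly (\<Phi> (Suc k)) =
    (fps_X * schur_fps k - fps_const (cnj (\<alpha> k))) * fps_of_poly (\<Phi>s k)"
proof -
  have "fps_of_poly (\<Phi> (Suc k)) = fps_X * fps_of_poly (\<Phi> k) - fps_const (cnj (\<alpha> k)) * fps_of_poly (\<Phi>s k)"
    by (simp add: szego_recursion[of k] fps_of_poly_diff fps_of_poly_smult fps_of_poly_pCons mult_ac)
  then show ?thesis unfolding schur_fps_mult[of k, symmetric] by (simp add: algebra_simps)
qed

text \<open>The quotient of the two Szego recursions, a step of Schur's algorithm, with the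
  denominator multiplied out so that coefficients can be compared without an inverse series.\<close>

lemma schur_fps_Suc: "schur_fps (Suc k) = fps_X * schur_fps k - fps_const (cnj (\<alpha> k))
    + fps_const (\<alpha> k) * (fps_X * (schur_fps k * schur_fps (Suc k)))"
proof -
  have "fps_of_poly (\<Phi>s k) \<noteq> 0" using coeff_\<Phi>s_0[of k] by auto
  moreover have "(schur_fps (Suc k) * (1 - fps_const (\<alpha> k) * (fps_X * schur_fps k))) * fps_of_poly (\<Phi>s k)
      = (fps_X * schur_fps k - fps_const (cnj (\<alpha> k))) * fps_of_poly (\<Phi>s k)"
    using schur_fps_mult[of "Suc k"] unfolding fps_\<Phi>s_Suc fps_\<Phi>_Suc by (simp only: mult.assoc)
  ultimately have "schur_fps (Suc k) * (1 - fps_const (\<alpha> k) * (fps_X * schur_fps k))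
      = fps_X * schur_fps k - fps_const (cnj (\<alpha> k))"
    using mult_right_cancel by blast
  then show ?thesis by (simp add: algebra_simps)
qed

lemma schur_fps_nth:
  "fps_nth (schur_fps (Suc k)) 0 = - cnj (\<alpha> k)"
  "fps_nth (schur_fps (Suc k)) (Suc j) = fps_nth (schur_fps k) j
    + \<alpha> k * (\<Sum>i\<le>j. fps_nth (schur_fps k) i * fps_nth (schur_fps (Suc k)) (j - i))"
proof -
  show "fps_nth (schur_fps (Suc k)) 0 = - cnj (\<alpha> k)"
    by (subst schur_fps_Suc) simp
  have "fps_nth (schur_fps (Suc k)) (Suc j) = fps_nth (fps_X * schur_fps k - fps_const (cnj (\<alpha> k))
    + fps_const (\<alpha> k) * (fps_X * (schur_fps k * schur_fps (Suc k)))) (Suc j)"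
    by (subst schur_fps_Suc) (rule refl)
  also have "\<dots> = fps_nth (schur_fps k) j + \<alpha> k * fps_nth (schur_fps k * schur_fps (Suc k)) j"
    by simp
  finally show "fps_nth (schur_fps (Suc k)) (Suc j) = fps_nth (schur_fps k) j
    + \<alpha> k * (\<Sum>i\<le>j. fps_nth (schur_fps k) i * fps_nth (schur_fps (Suc k)) (j - i))"
    by (simp add: fps_mult_nth atLeast0AtMost)
qed

text \<open>The deviation from 1 is \<alpha>_k z b_k(z) up to sign, and b_k is bounded by 1. The
  ratio thus stays in the right half-plane up to the boundary, where the principal logarithm is
  holomorphic.\<close>

lemma ratio_near_1:
  assumes "norm z \<le> 1"
  shows "norm (ratio k z - 1) < 1"
proof -
  have nz: "poly (\<Phi>s k) z \<noteq> 0" and le: "norm (poly (\<Phi> k) z) \<le> norm (poly (\<Phi>s k) z)"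
    using \<Phi>s_dominates[OF assms, of k] by auto
  have "ratio k z - 1 = - (\<alpha> k * (z * (poly (\<Phi> k) z / poly (\<Phi>s k) z)))"
    using nz by (simp add: ratio_def szego_recursion_reversed field_simps)
  then have "norm (ratio k z - 1) = norm (\<alpha> k) * (norm z * (norm (poly (\<Phi> k) z) / norm (poly (\<Phi>s k) z)))"
    by (simp add: norm_mult norm_divide)
  also have "\<dots> \<le> norm (\<alpha> k) * (1 * 1)"
    using assms nz le by (intro mult_left_mono mult_mono) (auto simp: divide_le_eq_1)
  also have "\<dots> < 1" using norm_\<alpha>_less_1 by simp
  finally show ?thesis .
qed

lemma ratio_not_nonpos:
  assumes "norm z \<le> 1"
  shows "ratio k z \<notin> \<real>\<^sub>\<le>\<^sub>0" "ratio k z \<noteq> 0"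
proof -
  have "\<bar>Re (ratio k z - 1)\<bar> < 1" using ratio_near_1[OF assms, of k] abs_Re_le_cmod le_less_trans by blast
  then have "Re (ratio k z) > 0" by simp
  then show "ratio k z \<notin> \<real>\<^sub>\<le>\<^sub>0" "ratio k z \<noteq> 0" by (auto simp: complex_nonpos_Reals_iff)
qed

lemma log_ratio_continuous: "continuous_on (cball 0 1) (log_ratio k)"
  and log_ratio_holomorphic: "log_ratio k holomorphic_on ball 0 1"
proof -
  have "continuous_on (cball 0 1) (ratio k)" "ratio k holomorphic_on ball 0 1"
    unfolding ratio_def using \<Phi>s_dominates by (auto intro!: continuous_intros holomorphic_intros)
  then show "continuous_on (cball 0 1) (log_ratio k)" "log_ratio k holomorphic_on ball 0 1"
    unfolding log_ratio_def using ratio_not_nonpos by (auto intro!: continuous_intros holomorphic_intros)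
qed

lemma log_ratio_0: "log_ratio k 0 = 0"
  by (simp add: log_ratio_def ratio_def poly_\<Phi>s_0)

lemma fps_of_poly_has_fps_expansion: "poly p has_fps_expansion fps_of_poly p" for p :: "complex poly"
  using eval_fps_has_fps_expansion[of "fps_of_poly p"] by (simp add: eval_fps_of_poly[abs_def])

lemma ratio_has_fps_expansion:
  "ratio k has_fps_expansion 1 - fps_const (\<alpha> k) * (fps_X * schur_fps k)"
proof -
  have "(\<lambda>z. poly (\<Phi>s (Suc k)) z * inverse (poly (\<Phi>s k) z)) has_fps_expansion
      fps_of_poly (\<Phi>s (Suc k)) * inverse (fps_of_poly (\<Phi>s k))"
    by (intro has_fps_expansion_mult has_fps_expansion_inverse fps_of_poly_has_fps_expansion)
      (simp add: coeff_\<Phi>s_0)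
  moreover have "fps_of_poly (\<Phi>s k) * inverse (fps_of_poly (\<Phi>s k)) = 1"
    using inverse_mult_eq_1[of "fps_of_poly (\<Phi>s k)"] by (simp add: coeff_\<Phi>s_0 mult.commute)
  ultimately show ?thesis
    unfolding fps_\<Phi>s_Suc mult.assoc by (simp add: ratio_def[abs_def] divide_inverse)
qed

text \<open>With G = log Q, comparison of the coefficients of z^j in G' Q = Q'; the constant term 1
  of Q isolates the coefficient of index j + 1.\<close>

lemma log_coeff_Suc:
  "of_nat (Suc j) * log_coeff k (Suc j) = - (of_nat (Suc j) * (\<alpha> k * fps_nth (schur_fps k) j))
    + (\<Sum>i<j. of_nat (Suc i) * log_coeff k (Suc i) * (\<alpha> k * fps_nth (schur_fps k) (j - Suc i)))"
proof -
  define Q where "Q = 1 - fps_const (\<alpha> k) * (fps_X * schur_fps k)"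
  define G where "G = fps_expansion (log_ratio k) 0"
  have Q: "fps_nth Q 0 = 1" "\<And>m. fps_nth Q (Suc m) = - (\<alpha> k * fps_nth (schur_fps k) m)"
    by (simp_all add: Q_def)
  have "log_ratio k analytic_on {0}"
    using log_ratio_holomorphic by (auto simp: analytic_at intro: exI[of _ "ball 0 1"])
  then have G: "log_ratio k has_fps_expansion G"
    unfolding G_def by (rule analytic_at_imp_has_fps_expansion_0)
  have Gn: "fps_nth G i = log_coeff k i" for i
    using fps_nth_fps_expansion[OF G, of i] by (simp add: log_coeff_def)
  have "(\<lambda>z. deriv (log_ratio k) z * ratio k z) has_fps_expansion fps_deriv G * Q"
    unfolding Q_def by (intro has_fps_expansion_mult has_fps_expansion_deriv G ratio_has_fps_expansion)
  moreover have "eventually (\<lambda>z. deriv (log_ratio k) z * ratio k z = deriv (ratio k) z) (nhds 0)"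
  proof -
    have "eventually (\<lambda>z. z \<in> ball (0::complex) 1) (nhds 0)" by (rule eventually_nhds_in_open) auto
    then show ?thesis
    proof eventually_elim
      case (elim z)
      have "ratio k holomorphic_on ball 0 1"
        unfolding ratio_def using \<Phi>s_dominates by (auto intro!: holomorphic_intros)
      then have "(ratio k has_field_derivative deriv (ratio k) z) (at z)"
        using elim by (intro holomorphic_derivI[of _ "ball 0 1"]) auto
      then have "(log_ratio k has_field_derivative inverse (ratio k z) * deriv (ratio k) z) (at z)"
        unfolding log_ratio_def[abs_def] using ratio_not_nonpos[of z k] elim
        by (auto intro!: derivative_eq_intros simp: divide_inverse mult.commute)
      then show ?case using ratio_not_nonpos[of z k] elim by (simp add: DERIV_imp_deriv)
    qed
  qed
  ultimately have "deriv (ratio k) has_fps_expansion fps_deriv G * Q"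
    by (subst (asm) has_fps_expansion_cong[OF _ refl]) auto
  moreover have "deriv (ratio k) has_fps_expansion fps_deriv Q"
    unfolding Q_def by (intro has_fps_expansion_deriv ratio_has_fps_expansion)
  ultimately have eq: "fps_deriv G * Q = fps_deriv Q" using fps_expansion_unique_complex by metis
  have "fps_nth (fps_deriv G * Q) j = (\<Sum>i\<le>j. of_nat (Suc i) * log_coeff k (Suc i) * fps_nth Q (j - i))"
    by (simp add: fps_mult_nth atLeast0AtMost Gn)
  also have "{..j} = insert j {..<j}" by auto
  also have "(\<Sum>i\<in>insert j {..<j}. of_nat (Suc i) * log_coeff k (Suc i) * fps_nth Q (j - i))
      = of_nat (Suc j) * log_coeff k (Suc j) + (\<Sum>i<j. of_nat (Suc i) * log_coeff k (Suc i) * fps_nth Q (j - i))"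
    by (simp add: Q)
  also have "(\<Sum>i<j. of_nat (Suc i) * log_coeff k (Suc i) * fps_nth Q (j - i))
      = - (\<Sum>i<j. of_nat (Suc i) * log_coeff k (Suc i) * (\<alpha> k * fps_nth (schur_fps k) (j - Suc i)))"
    unfolding sum_negf[symmetric]
  proof (intro sum.cong refl)
    fix i assume "i \<in> {..<j}"
    then have "j - i = Suc (j - Suc i)" by auto
    then show "of_nat (Suc i) * log_coeff k (Suc i) * fps_nth Q (j - i)
        = - (of_nat (Suc i) * log_coeff k (Suc i) * (\<alpha> k * fps_nth (schur_fps k) (j - Suc i)))"
      by (simp only: Q) simp
  qed
  also have "fps_nth (fps_deriv G * Q) j = - (of_nat (Suc j) * (\<alpha> k * fps_nth (schur_fps k) j))"
    unfolding eq by (simp add: Q)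
  finally show ?thesis by (simp add: algebra_simps)
qed

sublocale log_coefficients \<alpha> "\<lambda>k. fps_nth (schur_fps k)" log_coeff
  by unfold_locales (rule less_imp_le[OF norm_\<alpha>_less_1] schur_fps_nth log_coeff_Suc)+

text \<open>P is 1 minus half the sum of the frequencies n and -n. The constant term gives the value
  0 at the origin, one frequency integrates to 0 by holomorphy, and the other yields the n-th Taylor
  coefficient.\<close>

lemma integral_weight_Re_log_ratio:
  assumes n: "n \<ge> 1"
  shows "integrable angle_measure (\<lambda>t. weight n t * Re (log_ratio k (cis t)))"
    and "(\<integral>t. weight n t * Re (log_ratio k (cis t)) \<partial>angle_measure) = - Re (log_coeff k n) / 2"
proof -
  let ?f = "\<lambda>t. log_ratio k (cis t)"
  have cf: "continuous_on UNIV ?f"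
    by (rule continuous_on_cis_compose) (rule continuous_on_subset[OF log_ratio_continuous], simp)
  have cc: "continuous_on UNIV (\<lambda>t. ?f t * cis (c * t))" for c
    by (intro continuous_intros cf)
  show "integrable angle_measure (\<lambda>t. weight n t * Re (log_ratio k (cis t)))"
    by (intro integrable_angle_measure continuous_intros cf)
  have w: "complex_of_real (weight n t) * ?f t = ?f t - (1/2) * (?f t * cis (real n * t)) - (1/2) * (?f t * cis (- real n * t))" for t
    by (simp add: weight_def complex_eq_iff field_simps)
  have "(\<integral>t. of_real (weight n t) * ?f t \<partial>angle_measure)
      = (\<integral>t. ?f t \<partial>angle_measure) - (1/2) * (\<integral>t. ?f t * cis (real n * t) \<partial>angle_measure)
        - (1/2) * (\<integral>t. ?f t * cis (- real n * t) \<partial>angle_measure)"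
    unfolding w
    by (subst Bochner_Integration.integral_diff,
        (intro Bochner_Integration.integrable_diff integrable_mult_right integrable_angle_measure cf cc)+)+
      (simp only: integral_mult_right_zero)
  also have "\<dots> = - log_coeff k n / 2"
    using mean_value_holomorphic[OF log_ratio_continuous log_ratio_holomorphic, of k]
      Fourier_coefficient_holomorphic_negative[OF log_ratio_continuous log_ratio_holomorphic n, of k]
      Fourier_coefficient_holomorphic[OF log_ratio_continuous log_ratio_holomorphic, of k n]
    by (simp add: log_ratio_0 log_coeff_def)
  finally have *: "(\<integral>t. of_real (weight n t) * ?f t \<partial>angle_measure) = - log_coeff k n / 2" .
  have "(\<integral>t. weight n t * Re (?f t) \<partial>angle_measure) = (\<integral>t. Re (of_real (weight n t) * ?f t) \<partial>angle_measure)" by simp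
  also have "\<dots> = Re (\<integral>t. of_real (weight n t) * ?f t \<partial>angle_measure)"
    by (intro integral_Re integrable_angle_measure continuous_intros cf)
  finally show "(\<integral>t. weight n t * Re (?f t) \<partial>angle_measure) = - Re (log_coeff k n) / 2"
    unfolding * by simp
qed

section \<open>Summation over the steps\<close>

lemma integral_weight:
  assumes n: "n \<ge> 1"
  shows "(\<integral>t. weight n t \<partial>angle_measure) = 1"
proof -
  have "(\<integral>t. 1 * cis (real n * t) \<partial>angle_measure) = 0"
    by (rule Fourier_coefficient_holomorphic_negative[OF _ _ n]) auto
  moreover have "Re (\<integral>t. cis (real n * t) \<partial>angle_measure) = (\<integral>t. Re (cis (real n * t)) \<partial>angle_measure)"
    by (intro integral_Re[symmetric] integrable_angle_measure continuous_intros)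
  ultimately have 0: "(\<integral>t. cos (real n * t) \<partial>angle_measure) = 0" by simp
  have "(\<integral>t. 1 - cos (real n * t) \<partial>angle_measure) = (\<integral>t. 1 \<partial>angle_measure) - (\<integral>t. cos (real n * t) \<partial>angle_measure)"
    by (intro Bochner_Integration.integral_diff integrable_angle_measure continuous_intros)
  then show ?thesis using 0 angle.prob_space by (simp add: weight_def)
qed

lemma ln_norm_\<Phi>s:
  assumes "norm z \<le> 1"
  shows "ln (norm (poly (\<Phi>s N) z)) = (\<Sum>k<N. Re (log_ratio k z))"
proof (induction N)
  case 0
  have "\<Phi>s 0 = 1" by (rule poly_eqI) (simp add: coeff_reversed_poly \<Phi>_0)
  then show ?case by simp
next
  case (Suc N)
  have nz: "poly (\<Phi>s N) z \<noteq> 0" "poly (\<Phi>s (Suc N)) z \<noteq> 0" using \<Phi>s_dominates[OF assms] by auto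
  have "Re (log_ratio N z) = ln (norm (poly (\<Phi>s (Suc N)) z)) - ln (norm (poly (\<Phi>s N) z))"
    using nz by (simp add: log_ratio_def ratio_def Re_Ln norm_divide ln_div)
  then show ?case using Suc by simp
qed

text \<open>On the circle |\<Phi>_N| may be replaced by |\<Phi>_N^*|, whose logarithm splits into
  the logarithms of the ratios. The square in the density contributes a factor -2, which meets the
  -1/2 of each step; ln \<omega>_N keeps its value because the weight has mean 1.\<close>

lemma entropy_eq:
  assumes n: "n \<ge> 1"
  shows "entropy n N = (\<Sum>k<N. ln (1 - norm (\<alpha> k) ^ 2) + Re (log_coeff k n))"
proof -
  have pos: "1 - norm (\<alpha> k) ^ 2 > 0" for k
    using norm_\<alpha>_less_1[of k] by (simp add: power_less_one_iff)
  have "ln (\<omega> N) = (\<Sum>k<N. ln (1 - norm (\<alpha> k) ^ 2))"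
    unfolding \<omega>_def using pos by (subst ln_prod) (auto simp: less_imp_neq[symmetric])
  moreover have "ln (bs_density N t) = ln (\<omega> N) - 2 * ln (norm (poly (\<Phi>s N) (cis t)))" for t
  proof -
    have "norm (poly (\<Phi>s N) (cis t)) = norm (poly (\<Phi> N) (cis t))" by (rule norm_\<Phi>s_eq) simp
    then show ?thesis
      unfolding bs_density_def using \<omega>_pos[of N] \<Phi>_nonzero_circle[of "cis t" N]
      by (simp add: ln_div ln_realpow)
  qed
  ultimately have e: "ln (bs_density N t) = (\<Sum>k<N. ln (1 - norm (\<alpha> k) ^ 2)) - 2 * (\<Sum>k<N. Re (log_ratio k (cis t)))" for t
    by (simp only: ln_norm_\<Phi>s norm_cis order_refl)
  have eq: "weight n t * ln (bs_density N t) = (\<Sum>k<N. ln (1 - norm (\<alpha> k) ^ 2) * weight n t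
      - 2 * (weight n t * Re (log_ratio k (cis t))))" for t
    unfolding e sum_subtractf right_diff_distrib sum_distrib_left by (simp add: mult_ac)
  have iw: "integrable angle_measure (weight n)" by (intro integrable_angle_measure continuous_weight)
  have "entropy n N = (\<Sum>k<N. \<integral>t. ln (1 - norm (\<alpha> k) ^ 2) * weight n t
      - 2 * (weight n t * Re (log_ratio k (cis t))) \<partial>angle_measure)"
    unfolding entropy_def eq
    by (intro Bochner_Integration.integral_sum Bochner_Integration.integrable_diff integrable_mult_right iw
        integral_weight_Re_log_ratio n)
  also have "\<dots> = (\<Sum>k<N. ln (1 - norm (\<alpha> k) ^ 2) + Re (log_coeff k n))"
    using iw integral_weight_Re_log_ratio[OF n] integral_weight[OF n] by (intro sum.cong) simp_all
  finally show ?thesis .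
qed

end

theorem theorem5p12:
  fixes \<mu> \<mu>s :: "complex measure" and w :: "real \<Rightarrow> real"
    and \<alpha> :: "nat \<Rightarrow> complex" and n :: nat
  assumes "nontrivial_circle_measure \<mu>"
    and "circle_lebesgue_decomposition \<mu> w \<mu>s"
    and "\<alpha> = verblunsky \<mu>"
    and "n \<ge> 1"
    and "\<alpha> \<in> ell 6"
    and "(\<lambda>k. left_shift \<alpha> k - \<alpha> k) \<in> ell 3"
  shows "ext_integral angle_measure
           (\<lambda>\<theta>. ereal (1 - cos (real n * \<theta>)) * ext_log (w \<theta>)) > -\<infinity>
         \<longleftrightarrow> \<alpha> \<in> ell 4 \<and> (\<lambda>k. (left_shift ^^ n) \<alpha> k - \<alpha> k) \<in> ell 2"
proof -
  interpret opuc_decomposition \<mu> w \<mu>s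
    using assms(1,2) by unfold_locales
  note sum_rule = partial_sums_bounded_below_iff[OF assms(4) assms(5,6)[unfolded assms(3)] entropy_eq[OF assms(4)]]
  have "ext_integral angle_measure (\<lambda>\<theta>. ereal (weight n \<theta>) * ext_log (w \<theta>)) > -\<infinity>
      \<longleftrightarrow> (\<exists>C. \<forall>N. entropy n N \<ge> - C)"
    unfolding ext_integral_finite_iff
    using negative_part_finite_imp_entropy_bounded entropy_bounded_imp_negative_part_finite by blast
  also have "\<dots> \<longleftrightarrow> verblunsky \<mu> \<in> ell 4 \<and> (\<lambda>k. (left_shift ^^ n) (verblunsky \<mu>) k - verblunsky \<mu> k) \<in> ell 2"
    using sum_rule by blast
  finally show ?thesis unfolding assms(3) weight_def .
qed

end
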